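(* Let $F$ and $G$ be $\varphi$-functions, and $0<p<\infty$. (i) If the lower Boyd index satisfies $p(L_{F,G})>p$, and if $G\succ H^{-1}\circ T^p$ for some $N$-function $H$ satisfying condition $(J)$, then $L_{F,G}$ is $p$-convex. (ii) If $L_{F,G}$ is $p$-convex, then $p(L_{F,G})\ge p$, and $G\succ H^{-1}\circ T^p$ for some $N$-function $H$ satisfying condition $(J)$.
   Context: A $\varphi$-function is a continuous, strictly increasing function $F:[0,\infty)\to[0,\infty)$ with $F(0)=0$ and $\lim_{t\to\infty}F(t)=\infty$. $T^p$ denotes $t\mapsto t^p$. Two $\varphi$-functions $F,G$ are equivalent if for some $c<\infty$, $F(t/c)\le G(t)\le F(ct)$ for all $t\ge0$. For $\varphi$-functions $F,G$, write $G\succ F$ (and $F\prec G$) if $G\circ F^{-1}$ is equivalent to a convex function. An $N$-function is a $\varphi$-function equivalent to a $\varphi$-function $F_0$ such that $F_0(t)/t$ is strictly increasing, $F_0(t)/t\to\infty$ as $t\to\infty$, and $F_0(t)/t\to0$ as $t\to0$. A $\varphi$-function $H^*$ is complementary to $H$ if for some $c<\infty$, $t/c\le H^{-1}(t)\,(H^* )^{-1}(t)\le ct$ for all $t\ge0$. For a $\varphi$-function $F$ put $\tilde F(t)=1/F(1/t)$ for $t>0$, $\tilde F(0)=0$. Functions live on $[0,\infty)$ with Lebesgue measure $\lambda$; $f^*(x)=\sup\{t:\lambda(|f|\ge t)\ge x\}$. Luxemburg functional: $\|f\|_G=\inf\{c>0:\int_0^\infty G(|f(x)|/c)\,dx\le1\}$.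 An $N$-function $H$ satisfies condition $(J)$ if, for a function $H^*$ complementary to $H$, the function $x\mapsto 1/(\widetilde{H^*})^{-1}(x)$ has finite Luxemburg functional $\|\cdot\|_{H^*}$. Orlicz--Lorentz functional: $\|f\|_{F,G}=\|f^*\circ\tilde F\circ\tilde G^{-1}\|_G$, space $L_{F,G}=\{f:\|f\|_{F,G}<\infty\}$. Dilation operators $d_af(x)=f(ax)$, $\|d_a\|_{X\to X}=\sup\{\|d_af\|_X/\|f\|_X:0<\|f\|_X<\infty\}$; lower Boyd index $p(X)=\sup\{p:\exists c<\infty,\ \|d_a\|_{X\to X}\le c\,a^{-1/p}\ \forall a<1\}$. $X$ is $p$-convex if there is $C<\infty$ with $\|(\sum_{i=1}^n|f_i|^p)^{1/p}\|_X\le C(\sum_{i=1}^n\|f_i\|_X^p)^{1/p}$ for all $n$ and $f_1,\dots,f_n\in X$. *)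

theory Defs
  imports "HOL-Analysis.Analysis"
begin

text \<open>All functions live on [0,\<infinity>); values at negative arguments are irrelevant.\<close>

definition phi_function :: "(real \<Rightarrow> real) \<Rightarrow> bool" where
  "phi_function F \<longleftrightarrow> continuous_on {0..} F \<and> strict_mono_on {0..} F \<and> F 0 = 0
     \<and> (\<forall>t\<ge>0. F t \<ge> 0) \<and> filterlim F at_top at_top"

definition phi_inv :: "(real \<Rightarrow> real) \<Rightarrow> real \<Rightarrow> real" where
  "phi_inv F y = (THE x. 0 \<le> x \<and> F x = y)"

definition phi_equiv :: "(real \<Rightarrow> real) \<Rightarrow> (real \<Rightarrow> real) \<Rightarrow> bool" where
  "phi_equiv F G \<longleftrightarrow> (\<exists>c>0. \<forall>t\<ge>0. F (t / c) \<le> G t \<and> G t \<le> F (c * t))"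

definition phi_succ :: "(real \<Rightarrow> real) \<Rightarrow> (real \<Rightarrow> real) \<Rightarrow> bool" where
  "phi_succ G F \<longleftrightarrow> (\<exists>K. convex_on {0..} K \<and> phi_equiv (\<lambda>t. G (phi_inv F t)) K)"

definition N_function :: "(real \<Rightarrow> real) \<Rightarrow> bool" where
  "N_function H \<longleftrightarrow> phi_function H \<and>
     (\<exists>F0. phi_function F0 \<and> strict_mono_on {0<..} (\<lambda>t. F0 t / t)
        \<and> filterlim (\<lambda>t. F0 t / t) at_top at_top
        \<and> ((\<lambda>t. F0 t / t) \<longlongrightarrow> 0) (at_right 0)
        \<and> phi_equiv H F0)"

definition complementary :: "(real \<Rightarrow> real) \<Rightarrow> (real \<Rightarrow> real) \<Rightarrow> bool" where
  "complementary H Hs \<longleftrightarrow> phi_function Hs \<and>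
     (\<exists>c>0. \<forall>t\<ge>0. t / c \<le> phi_inv H t * phi_inv Hs t \<and> phi_inv H t * phi_inv Hs t \<le> c * t)"

definition tilde :: "(real \<Rightarrow> real) \<Rightarrow> real \<Rightarrow> real" where
  "tilde F t = (if t > 0 then 1 / F (1 / t) else 0)"

text \<open>Luxemburg functional on [0,\<infinity>) with Lebesgue measure (value \<infinity> if no c works).\<close>
definition lux :: "(real \<Rightarrow> real) \<Rightarrow> (real \<Rightarrow> real) \<Rightarrow> ennreal" where
  "lux G f = Inf {ennreal c | c. c > 0 \<and>
      (\<integral>\<^sup>+ x. indicator {0..} x * ennreal (G (\<bar>f x\<bar> / c)) \<partial>lborel) \<le> 1}"

definition condJ :: "(real \<Rightarrow> real) \<Rightarrow> bool" where
  "condJ H \<longleftrightarrow> (\<exists>Hs. complementary H Hs \<and> lux Hs (\<lambda>x. 1 / phi_inv (tilde Hs) x) < \<infinity>)"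

definition level_set :: "(real \<Rightarrow> real) \<Rightarrow> real \<Rightarrow> real set" where
  "level_set f x = {t. ennreal x \<le> emeasure lborel {y \<in> {0..}. t \<le> \<bar>f y\<bar>}}"

definition rearr :: "(real \<Rightarrow> real) \<Rightarrow> real \<Rightarrow> real" where
  "rearr f x = Sup (level_set f x)"

text \<open>Orlicz-Lorentz functional; it is \<infinity> when f^* takes the value \<infinity> at some x > 0.\<close>
definition lorentz :: "(real \<Rightarrow> real) \<Rightarrow> (real \<Rightarrow> real) \<Rightarrow> (real \<Rightarrow> real) \<Rightarrow> ennreal" where
  "lorentz F G f = (if \<forall>x>0. bdd_above (level_set f x)
      then lux G (\<lambda>x. rearr f (tilde F (phi_inv (tilde G) x))) else \<infinity>)"

definition LFG :: "(real \<Rightarrow> real) \<Rightarrow> (real \<Rightarrow> real) \<Rightarrow> (real \<Rightarrow> real) set" where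
  "LFG F G = {f. f \<in> borel_measurable lborel \<and> lorentz F G f < \<infinity>}"

definition dil :: "real \<Rightarrow> (real \<Rightarrow> real) \<Rightarrow> real \<Rightarrow> real" where
  "dil a f x = f (a * x)"

definition dil_norm :: "(real \<Rightarrow> real) \<Rightarrow> (real \<Rightarrow> real) \<Rightarrow> real \<Rightarrow> ennreal" where
  "dil_norm F G a = (SUP f \<in> {f \<in> LFG F G. 0 < lorentz F G f}.
       lorentz F G (dil a f) / lorentz F G f)"

definition lower_boyd :: "(real \<Rightarrow> real) \<Rightarrow> (real \<Rightarrow> real) \<Rightarrow> ereal" where
  "lower_boyd F G = Sup {ereal q | q. q > 0 \<and>
      (\<exists>c. \<forall>a. 0 < a \<and> a < 1 \<longrightarrow> dil_norm F G a \<le> ennreal (c * a powr (-1 / q)))}"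

definition p_convex :: "(real \<Rightarrow> real) \<Rightarrow> (real \<Rightarrow> real) \<Rightarrow> real \<Rightarrow> bool" where
  "p_convex F G p \<longleftrightarrow> (\<exists>C. \<forall>n (fs :: nat \<Rightarrow> real \<Rightarrow> real). (\<forall>i<n. fs i \<in> LFG F G) \<longrightarrow>
      lorentz F G (\<lambda>x. (\<Sum>i<n. \<bar>fs i x\<bar> powr p) powr (1 / p))
        \<le> ennreal (C * (\<Sum>i<n. enn2real (lorentz F G (fs i)) powr p) powr (1 / p)))"

end

theory Submission
  imports Defs
begin

text \<open>
  Let \<open>G\<^sub>1(t) = G(t powr (1/p))\<close> and \<open>\<theta> = F~ o G~\<^sup>-\<^sup>1\<close>, so that the functional of
  \<open>f\<close> is governed by the \<open>G\<^sub>1\<close>-modular of the decreasing function \<open>(f\<^sup>* o \<theta>) powr p\<close>, and \<open>F\<close>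
  disappears: up to the averaging \<open>f \<mapsto> f\<^sup>*\<^sup>*\<close>, \<open>p\<close>-convexity means that the Luxemburg
  functional of \<open>G\<^sub>1\<close> is convex up to a constant on decreasing functions.

  If \<open>G\<^sub>1 o H\<close> is equivalent to a convex \<open>K\<close>, put \<open>\<rho> = (H\<^sup>*)\<^sup>-\<^sup>1\<close> and \<open>\<tau>(x) = G\<^sub>1\<^sup>-\<^sup>1(1/x)\<close>. For
  decreasing \<open>f\<close> the \<open>G\<^sub>1\<close>-functional is equivalent to the \<open>K\<close>-Luxemburg norm of the
  \<^emph>\<open>linear\<close> image \<open>f / (\<rho> o \<tau>)\<close>: a modular bound gives \<open>f \<le> \<tau>\<close>, hence one inequality, and the
  other fails only where \<open>f\<close> is below \<open>H\<^sup>*(\<rho>(\<tau>)/d)\<close>, whose modular is finite by (J). The Boyd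
  index hypothesis makes the dyadic decomposition of \<open>f\<^sup>*\<^sup>*\<close> summable.

  Conversely, \<open>p\<close>-convexity applied to indicator functions of intervals gives, for
  \<open>T\<^sub>k = G\<^sub>1\<^sup>-\<^sup>1(2 powr k)\<close>, that smallness of \<open>\<Sum> T (j k) / T k\<close> forces \<open>\<Sum> 2 powr (j k - k) \<le> 2\<close>.
  So \<open>T\<^sub>k / 2 powr k\<close> can rise by a fixed factor only over blocks of indices whose end points have
  summable ratios, and a function \<open>\<rho>\<close> growing by a fixed factor on every block yields \<open>H\<close>.
\<close>

section \<open>Phi-functions and modulars\<close>

text \<open>\<open>phi_inv H t\<close> is comparable to \<open>t / \<rho> t\<close>, so the
  hypothesis says that \<open>G\<^sub>1 t\<close> is comparable to \<open>K (t / \<rho> t)\<close>.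
  Only the factor \<open>\<rho> t\<close> spoils linearity; freezing it at the largest argument that
  the modular bound allows, namely \<open>\<tau> x\<close>, removes the dependence on the function.
  The obstacle is that a modular bound by a constant above 1 is useless without a growth condition
  on \<open>G\<^sub>1\<close>, and none is assumed. It is extracted from (J), which makes
  \<open>Hs (\<rho> t / d)\<close> small compared with \<open>t\<close> near 0 and near infinity. In
  the converse two opposite demands are made on \<open>\<rho>\<close>. It must grow fast enough to
  compensate every rise of \<open>V k = T k / 2 powr k\<close>, which gives convexity of
  \<open>G\<^sub>1 o H\<close> up to equivalence, and slowly enough for (J). One factor
  \<open>B\<close> per block meets both. Summability of the block ratios is a bootstrap: the bound 2
  is absolute while \<delta> depends on the constant of p-convexity, and choosing the rise
  \<open>A\<close> large compared with \<open>1 / \<delta>\<close> lets terms be added one at a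
  time.\<close>

lemma phi_less_iff:
  assumes "phi_function F" "0 \<le> x" "0 \<le> y"
  shows "F x < F y \<longleftrightarrow> x < y"
  using assms strict_mono_on_less[of "{0..}" F x y] by (auto simp: phi_function_def)

lemma phi_le_iff:
  assumes "phi_function F" "0 \<le> x" "0 \<le> y"
  shows "F x \<le> F y \<longleftrightarrow> x \<le> y"
  using phi_less_iff[OF assms(1,3,2)] by (simp add: linorder_not_less[symmetric])

lemma phi_eq_iff:
  assumes "phi_function F" "0 \<le> x" "0 \<le> y"
  shows "F x = F y \<longleftrightarrow> x = y"
  using phi_less_iff[OF assms] phi_less_iff[OF assms(1,3,2)] by (metis linorder_neq_iff)

lemma phi_nonneg: "phi_function F \<Longrightarrow> 0 \<le> x \<Longrightarrow> 0 \<le> F x"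
  by (simp add: phi_function_def)

lemma phi_zero: "phi_function F \<Longrightarrow> F 0 = 0"
  by (simp add: phi_function_def)

lemma phi_pos: "phi_function F \<Longrightarrow> 0 < x \<Longrightarrow> 0 < F x"
  using phi_less_iff[of F 0 x] by (simp add: phi_zero)

lemma phi_surj:
  assumes "phi_function F" "0 \<le> y"
  obtains x where "0 \<le> x" "F x = y"
proof -
  have "eventually (\<lambda>x. y \<le> F x \<and> 0 \<le> x) at_top"
    using assms(1) by (intro eventually_conj eventually_ge_at_top) (simp add: phi_function_def filterlim_at_top)
  then obtain b where b: "y \<le> F b" "0 \<le> b" unfolding eventually_at_top_linorder by auto
  have "continuous_on {0..b} F" using assms(1) unfolding phi_function_def
    by (metis atLeastAtMost_iff atLeast_iff continuous_on_subset subsetI)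
  then obtain x where "0 \<le> x" "F x = y"
    using IVT'[of F 0 y b] b assms phi_zero[of F] by auto
  then show thesis by (rule that)
qed

lemma phi_inv_props:
  assumes "phi_function F" "0 \<le> y"
  shows "0 \<le> phi_inv F y" "F (phi_inv F y) = y"
proof -
  have "\<exists>!x. 0 \<le> x \<and> F x = y"
    by (rule phi_surj[OF assms]) (auto simp: phi_eq_iff[OF assms(1)])
  from theI'[OF this] show "0 \<le> phi_inv F y" "F (phi_inv F y) = y"
    by (auto simp: phi_inv_def)
qed

lemma phi_inv_eqI:
  assumes "phi_function F" "0 \<le> x" "F x = y"
  shows "phi_inv F y = x"
  using phi_inv_props[OF assms(1), of y] phi_eq_iff[OF assms(1)] assms phi_nonneg by metis

lemma phi_inv_phi: "phi_function F \<Longrightarrow> 0 \<le> x \<Longrightarrow> phi_inv F (F x) = x"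
  by (rule phi_inv_eqI) auto

lemma phi_inv_less_iff:
  assumes "phi_function F" "0 \<le> x" "0 \<le> y"
  shows "phi_inv F x < phi_inv F y \<longleftrightarrow> x < y"
  using phi_less_iff[OF assms(1) phi_inv_props(1)[OF assms(1,2)] phi_inv_props(1)[OF assms(1,3)]]
  by (simp add: phi_inv_props assms)

lemma phi_inv_le_iff:
  assumes "phi_function F" "0 \<le> x" "0 \<le> y"
  shows "phi_inv F x \<le> phi_inv F y \<longleftrightarrow> x \<le> y"
  using phi_inv_less_iff[OF assms(1,3,2)] by (simp add: linorder_not_less[symmetric])

lemma le_phi_inv_iff:
  assumes "phi_function F" "0 \<le> x" "0 \<le> y"
  shows "x \<le> phi_inv F y \<longleftrightarrow> F x \<le> y"
  using phi_le_iff[OF assms(1,2) phi_inv_props(1)[OF assms(1,3)]] by (simp add: phi_inv_props assms)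

lemma phi_inv_le_iff':
  assumes "phi_function F" "0 \<le> x" "0 \<le> y"
  shows "phi_inv F y \<le> x \<longleftrightarrow> y \<le> F x"
  using phi_le_iff[OF assms(1) phi_inv_props(1)[OF assms(1,3)] assms(2)] by (simp add: phi_inv_props assms)

lemma phi_inv_zero: "phi_function F \<Longrightarrow> phi_inv F 0 = 0"
  by (rule phi_inv_eqI) (auto simp: phi_zero)

lemma phi_inv_pos: "phi_function F \<Longrightarrow> 0 < y \<Longrightarrow> 0 < phi_inv F y"
  using phi_inv_less_iff[of F 0 y] by (simp add: phi_inv_zero)

lemma phi_function_phi_inv:
  assumes "phi_function F"
  shows "phi_function (phi_inv F)"
  unfolding phi_function_def
proof (intro conjI)
  \<comment> \<open>Extending by the identity to negative arguments gives a monotone function whose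
    range is the whole line; a monotone function with open range is continuous.\<close>
  let ?f = "\<lambda>y. if y < 0 then y else phi_inv F y"
  have "range ?f = UNIV"
  proof -
    have "x \<in> range ?f" for x :: real
    proof (cases "x < 0")
      case False
      then have "?f (F x) = x" using phi_nonneg[OF assms, of x] phi_inv_phi[OF assms, of x] by auto
      then show ?thesis by (rule range_eqI[OF sym])
    qed (auto intro: image_eqI[of _ _ x])
    then show ?thesis by auto
  qed
  then have "continuous_on UNIV ?f"
    by (intro continuous_onI_mono)
       (auto simp: phi_inv_le_iff assms intro: order_trans[OF less_imp_le phi_inv_props(1)[OF assms]])
  then have "continuous_on {0..} ?f" by (rule continuous_on_subset) auto
  then show "continuous_on {0..} (phi_inv F)"
    by (rule continuous_on_cong[THEN iffD1, rotated 2]) auto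
  show "strict_mono_on {0..} (phi_inv F)"
    by (auto simp: strict_mono_on_def phi_inv_less_iff assms)
  show "filterlim (phi_inv F) at_top at_top"
    unfolding filterlim_at_top eventually_at_top_linorder
  proof
    fix Z :: real
    show "\<exists>N. \<forall>n\<ge>N. Z \<le> phi_inv F n"
    proof (intro exI allI impI)
      fix n assume n: "F (max Z 0) \<le> n"
      then have "0 \<le> n" using phi_nonneg[OF assms, of "max Z 0"] by simp
      then show "Z \<le> phi_inv F n" using n le_phi_inv_iff[OF assms, of "max Z 0" n] by simp
    qed
  qed
qed (use assms in \<open>auto simp: phi_inv_zero phi_inv_props\<close>)

lemma phi_inv_phi_inv:
  assumes "phi_function F" "0 \<le> x"
  shows "phi_inv (phi_inv F) x = F x"
  using assms by (intro phi_inv_eqI) (auto simp: phi_function_phi_inv phi_nonneg phi_inv_phi)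

lemma phi_inv_tilde:
  assumes "phi_function G" "0 < x"
  shows "phi_inv (tilde G) x = 1 / phi_inv G (1 / x)"
  unfolding phi_inv_def[of "tilde G"]
proof (rule the_equality)
  have pos: "0 < phi_inv G (1 / x)" using assms by (simp add: phi_inv_pos)
  then show "0 \<le> 1 / phi_inv G (1 / x) \<and> tilde G (1 / phi_inv G (1 / x)) = x"
    using assms by (simp add: tilde_def phi_inv_props)
  fix z assume z: "0 \<le> z \<and> tilde G z = x"
  then have "z > 0" "1 / G (1 / z) = x" using assms by (auto simp: tilde_def split: if_splits)
  then have "phi_inv G (1 / x) = 1 / z"
    using assms by (intro phi_inv_eqI) auto
  then show "z = 1 / phi_inv G (1 / x)" by simp
qed

text \<open>Closed form of \<open>tilde F o phi_inv (tilde G)\<close> at positive arguments, where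
  the inner reciprocals cancel.\<close>

definition reparam :: "(real \<Rightarrow> real) \<Rightarrow> (real \<Rightarrow> real) \<Rightarrow> real \<Rightarrow> real" where
  "reparam F G x = 1 / F (phi_inv G (1 / x))"

lemma tilde_phi_inv_tilde:
  assumes "phi_function G" "0 < x"
  shows "tilde F (phi_inv (tilde G) x) = reparam F G x"
  using phi_inv_pos[OF assms(1), of "1 / x"] assms
  by (simp add: phi_inv_tilde tilde_def reparam_def)

lemma reparam_pos:
  "phi_function F \<Longrightarrow> phi_function G \<Longrightarrow> 0 < x \<Longrightarrow> 0 < reparam F G x"
  by (simp add: reparam_def phi_pos phi_inv_pos)

lemma reparam_le_iff:
  assumes "phi_function F" "phi_function G" "0 < x" "0 < y"
  shows "reparam F G x \<le> reparam F G y \<longleftrightarrow> x \<le> y"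
proof -
  have *: "0 < phi_inv G (1 / x)" "0 < phi_inv G (1 / y)"
    using assms by (simp_all add: phi_inv_pos)
  have "reparam F G x \<le> reparam F G y \<longleftrightarrow> F (phi_inv G (1 / y)) \<le> F (phi_inv G (1 / x))"
    using phi_pos[OF assms(1) *(1)] phi_pos[OF assms(1) *(2)] by (simp add: reparam_def field_simps)
  also have "\<dots> \<longleftrightarrow> 1 / y \<le> 1 / x"
    using assms * by (simp add: phi_le_iff phi_inv_le_iff)
  finally show ?thesis using assms by (simp add: field_simps)
qed

definition root_scale :: "real \<Rightarrow> (real \<Rightarrow> real) \<Rightarrow> real \<Rightarrow> real" where
  "root_scale p G t = G (t powr (1 / p))"

lemma powr_powr_cancel: "0 \<le> t \<Longrightarrow> 0 < p \<Longrightarrow> ((t::real) powr p) powr (1 / p) = t"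
  "0 \<le> t \<Longrightarrow> 0 < p \<Longrightarrow> (t powr (1 / p)) powr p = t"
  by (auto simp: powr_powr)

lemma phi_function_powr:
  assumes "0 < a"
  shows "phi_function (\<lambda>t. t powr a)"
  unfolding phi_function_def
proof (intro conjI)
  show "continuous_on {0..} (\<lambda>t::real. t powr a)"
    by (rule continuous_on_powr') (use assms in \<open>auto intro: continuous_intros\<close>)
  show "filterlim (\<lambda>t::real. t powr a) at_top at_top"
    unfolding filterlim_at_top eventually_at_top_linorder
  proof (intro allI exI impI)
    fix Z x :: real assume "max Z 0 powr (1 / a) \<le> x"
    then have "(max Z 0 powr (1 / a)) powr a \<le> x powr a"
      using assms by (intro powr_mono2) auto
    then show "Z \<le> x powr a" using assms by (simp add: powr_powr)
  qed
qed (use assms in \<open>auto simp: strict_mono_on_def intro: powr_less_mono2\<close>)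

lemma phi_function_compose:
  assumes "phi_function F" "phi_function G"
  shows "phi_function (\<lambda>t. F (G t))"
  unfolding phi_function_def
proof (intro conjI)
  show "continuous_on {0..} (\<lambda>t. F (G t))"
    by (rule continuous_on_compose2[of "{0..}" F])
       (use assms in \<open>auto simp: phi_function_def\<close>)
  show "filterlim (\<lambda>t. F (G t)) at_top at_top"
    by (rule filterlim_compose[of F at_top at_top G]) (use assms in \<open>auto simp: phi_function_def\<close>)
  show "strict_mono_on {0..} (\<lambda>t. F (G t))"
    using assms by (auto simp: strict_mono_on_def phi_less_iff phi_nonneg)
qed (use assms in \<open>auto simp: phi_zero phi_nonneg\<close>)

lemma phi_function_root_scale:
  "phi_function G \<Longrightarrow> 0 < p \<Longrightarrow> phi_function (root_scale p G)"
  using phi_function_compose[of G "\<lambda>t. t powr (1 / p)"] phi_function_powr[of "1 / p"]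
  by (simp add: root_scale_def[abs_def])

lemma phi_inv_root_scale:
  assumes "phi_function G" "0 < p" "0 \<le> y"
  shows "phi_inv (root_scale p G) y = phi_inv G y powr p"
  using assms phi_inv_props[OF assms(1,3)]
  by (intro phi_inv_eqI) (auto simp: phi_function_root_scale root_scale_def powr_powr_cancel)

text \<open>Rewrites the relation of \<open>G\<close> to \<open>H^-1 o T^p\<close> as equivalence of
  \<open>root_scale p G o H\<close> with a convex function, so that the exponent is absorbed into
  \<open>G\<close>.\<close>

lemma phi_inv_inv_powr:
  assumes H: "phi_function H" and p: "0 < p" and u: "0 \<le> u"
  shows "G (phi_inv (\<lambda>t. phi_inv H (t powr p)) u) = root_scale p G (H u)"
proof -
  have "phi_function (\<lambda>t. phi_inv H (t powr p))"
    by (rule phi_function_compose[OF phi_function_phi_inv[OF H] phi_function_powr[OF p]])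
  note inv = phi_inv_eqI[OF this]
  have "phi_inv (\<lambda>t. phi_inv H (t powr p)) u = H u powr (1 / p)"
    using u p phi_nonneg[OF H u] by (intro inv) (auto simp: powr_powr phi_inv_phi H)
  then show ?thesis by (simp add: root_scale_def)
qed

lemma root_scale_powr_divide:
  assumes "0 \<le> y" "0 \<le> c" "0 < p"
  shows "root_scale p G (y powr p / c powr p) = G (y / c)"
  using assms by (simp add: root_scale_def powr_divide[symmetric] powr_powr)

section \<open>Modulars on the open half-line\<close>

definition modular :: "(real \<Rightarrow> real) \<Rightarrow> (real \<Rightarrow> real) \<Rightarrow> ennreal" where
  "modular G f = (\<integral>\<^sup>+ x\<in>{0<..}. ennreal (G (f x)) \<partial>lborel)"

lemma modular_mono:
  assumes "phi_function G" "\<And>x. 0 < x \<Longrightarrow> 0 \<le> f x" "\<And>x. 0 < x \<Longrightarrow> f x \<le> g x"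
  shows "modular G f \<le> modular G g"
  unfolding modular_def
proof (rule nn_integral_mono)
  fix x :: real
  show "ennreal (G (f x)) * indicator {0<..} x \<le> ennreal (G (g x)) * indicator {0<..} x"
    using assms(2,3)[of x] phi_le_iff[OF assms(1), of "f x" "g x"]
    by (cases "x > 0") (auto intro: ennreal_leI)
qed

lemma modular_cong:
  assumes "\<And>x. 0 < x \<Longrightarrow> f x = g x"
  shows "modular G f = modular G g"
  unfolding modular_def by (rule nn_integral_cong) (auto simp: assms indicator_def)

text \<open>The origin is a null set. Dropping it matters because the reparametrisation and the
  rearrangement are controlled only at positive arguments.\<close>

lemma lux_integral_eq_modular:
  "(\<integral>\<^sup>+ x. indicator {0..} x * ennreal (G (\<bar>f x\<bar> / c)) \<partial>lborel) = modular G (\<lambda>x. \<bar>f x\<bar> / c)"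
  unfolding modular_def
proof (rule nn_integral_cong_AE)
  have "AE x in lborel. x \<noteq> (0::real)" by (rule AE_lborel_singleton)
  then show "AE x in lborel. indicator {0..} x * ennreal (G (\<bar>f x\<bar> / c)) =
      ennreal (G (\<bar>f x\<bar> / c)) * indicator {0<..} x"
    by eventually_elim (auto simp: indicator_def)
qed

lemma lux_le:
  "0 < c \<Longrightarrow> modular G (\<lambda>x. \<bar>f x\<bar> / c) \<le> 1 \<Longrightarrow> lux G f \<le> ennreal c"
  unfolding lux_def lux_integral_eq_modular by (rule Inf_lower) auto

lemma lux_less_modular:
  assumes "phi_function G" "lux G f < ennreal c"
  shows "modular G (\<lambda>x. \<bar>f x\<bar> / c) \<le> 1"
proof -
  obtain d where d: "0 < d" "modular G (\<lambda>x. \<bar>f x\<bar> / d) \<le> 1" "ennreal d < ennreal c"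
    using assms(2) unfolding lux_def lux_integral_eq_modular Inf_less_iff by auto
  then have "d \<le> c" using ennreal_less_iff by force
  then have "modular G (\<lambda>x. \<bar>f x\<bar> / c) \<le> modular G (\<lambda>x. \<bar>f x\<bar> / d)"
    using d by (intro modular_mono assms) (auto intro!: divide_left_mono)
  with d show ?thesis by auto
qed

text \<open>The modular bound on a decreasing function is a pointwise bound: this is the inclusion
  into the weak space.\<close>

lemma decreasing_modular_le:
  assumes G: "phi_function G" and f0: "\<And>x. 0 < x \<Longrightarrow> 0 \<le> f x"
    and dec: "\<And>x y. 0 < x \<Longrightarrow> x \<le> y \<Longrightarrow> f y \<le> f x"
    and m: "modular G f \<le> 1" and x: "0 < x"
  shows "f x \<le> phi_inv G (1 / x)"
proof -
  have "ennreal (G (f x)) * ennreal x = (\<integral>\<^sup>+ y\<in>{0<..x}. ennreal (G (f x)) \<partial>lborel)"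
    using x by (simp add: nn_integral_cmult)
  also have "\<dots> \<le> modular G f"
    unfolding modular_def
    by (rule nn_integral_mono)
       (use dec f0 x G in \<open>auto simp: indicator_def phi_le_iff intro!: ennreal_leI\<close>)
  finally have "ennreal (G (f x) * x) \<le> 1"
    using m phi_nonneg[OF G f0[OF x]] x by (simp add: ennreal_mult)
  then have "G (f x) \<le> 1 / x" using x by (simp add: field_simps)
  then show ?thesis using le_phi_inv_iff[OF G f0[OF x], of "1 / x"] x by simp
qed

text \<open>Nothing is known about \<open>f\<close> outside the open half-line, hence the
  indicator.\<close>

lemma decreasing_measurable:
  fixes f :: "real \<Rightarrow> real"
  assumes dec: "\<And>x y. 0 < x \<Longrightarrow> x \<le> y \<Longrightarrow> f y \<le> f x"
  shows "(\<lambda>x. f x * indicator {0<..} x) \<in> borel_measurable borel"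
proof -
  have "mono_on {0<..} (\<lambda>x. - f x)" using dec by (auto simp: mono_on_def)
  then have "(\<lambda>x. - f x) \<in> borel_measurable (restrict_space borel {0<..})"
    by (rule borel_measurable_mono_on_fnc)
  then have "f \<in> borel_measurable (restrict_space borel {0<..})"
    by simp
  then show ?thesis
    by (subst (asm) borel_measurable_restrict_space_iff) (auto simp: mult.commute)
qed

lemma decreasing_ennreal_measurable:
  fixes f :: "real \<Rightarrow> real"
  assumes dec: "\<And>x y. 0 < x \<Longrightarrow> x \<le> y \<Longrightarrow> f y \<le> f x"
  shows "(\<lambda>x. ennreal (f x) * indicator {0<..} x) \<in> borel_measurable borel"
proof -
  have "(\<lambda>x. ennreal (f x * indicator {0<..} x)) \<in> borel_measurable borel"
    using decreasing_measurable[of f] dec by simp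
  moreover have "ennreal (f x * indicator {0<..} x) = ennreal (f x) * indicator {0<..} x" for x
    by (auto simp: indicator_def)
  ultimately show ?thesis by simp
qed

section \<open>Decreasing rearrangements\<close>

text \<open>At a nonpositive height the superlevel set is the whole half-line, of infinite measure.
  So a level set is never empty, and its supremum is a nonnegative number as soon as it is bounded
  above.\<close>

lemma level_set_nonpos: "t \<le> 0 \<Longrightarrow> t \<in> level_set f x"
proof -
  assume "t \<le> 0"
  then have "{y \<in> {0..}. t \<le> \<bar>f y\<bar>} = {0::real..}" by auto
  moreover have "emeasure lborel {0::real..} = \<infinity>"
  proof -
    have "ennreal n \<le> emeasure lborel {0::real..}" for n :: nat
      using emeasure_mono[of "{0..real n}" "{0..}" lborel] by simp
    note le = this
    show ?thesis
    proof (cases "emeasure lborel {0::real..}")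
      case (real r)
      obtain n where "r < real n" using reals_Archimedean2 by blast
      then show ?thesis using le[of n] real by (simp add: ennreal_le_iff)
    qed simp
  qed
  ultimately show ?thesis by (simp add: level_set_def)
qed

lemma level_set_antimono: "x \<le> y \<Longrightarrow> level_set f y \<subseteq> level_set f x"
  by (auto simp: level_set_def intro: order_trans[OF ennreal_leI])

lemma le_rearr: "bdd_above (level_set f x) \<Longrightarrow> t \<in> level_set f x \<Longrightarrow> t \<le> rearr f x"
  unfolding rearr_def by (rule cSup_upper)

lemma rearr_nonneg: "bdd_above (level_set f x) \<Longrightarrow> 0 \<le> rearr f x"
  by (rule le_rearr) (auto intro: level_set_nonpos)

lemma rearr_le:
  "(\<And>t. t \<in> level_set f x \<Longrightarrow> t \<le> c) \<Longrightarrow> rearr f x \<le> c"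
  unfolding rearr_def using level_set_nonpos[of 0 f x] by (intro cSup_least) auto

lemma rearr_mono:
  assumes "bdd_above (level_set g y)" "level_set f x \<subseteq> level_set g y"
  shows "rearr f x \<le> rearr g y"
  using assms by (intro rearr_le) (auto intro: le_rearr)

lemma rearr_antimono:
  "bdd_above (level_set f x) \<Longrightarrow> x \<le> y \<Longrightarrow> rearr f y \<le> rearr f x"
  by (intro rearr_mono level_set_antimono)

lemma level_set_mono:
  assumes "\<And>t. 0 < t \<Longrightarrow> emeasure lborel {y \<in> {0..}. t \<le> \<bar>f y\<bar>} \<le> emeasure lborel {y \<in> {0..}. t \<le> \<bar>g y\<bar>}"
  shows "level_set f x \<subseteq> level_set g x"
proof
  fix t assume "t \<in> level_set f x"
  then show "t \<in> level_set g x"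
    using assms[of t] level_set_nonpos[of t g x]
    by (cases "t > 0") (auto simp: level_set_def intro: order_trans)
qed

text \<open>Continuity from below: the heights \<open>rearr f x + inverse (Suc n)\<close> lie
  outside the level set, so their superlevel sets have measure less than \<open>x\<close>, and these
  sets increase to the strict superlevel set.\<close>

lemma emeasure_above_rearr:
  assumes f: "f \<in> borel_measurable lborel" and b: "bdd_above (level_set f x)"
  shows "emeasure lborel {y \<in> {0..}. rearr f x < \<bar>f y\<bar>} \<le> ennreal x"
proof -
  let ?A = "\<lambda>n. {y \<in> {0..}. rearr f x + inverse (Suc n) \<le> \<bar>f y\<bar>}"
  have eq: "{y \<in> {0..}. rearr f x < \<bar>f y\<bar>} = (\<Union>n. ?A n)"
  proof (intro equalityI subsetI)
    fix y assume y: "y \<in> {y \<in> {0..}. rearr f x < \<bar>f y\<bar>}"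
    then obtain n where "inverse (real (Suc n)) < \<bar>f y\<bar> - rearr f x"
      using reals_Archimedean[of "\<bar>f y\<bar> - rearr f x"] by auto
    with y have "y \<in> ?A n" by simp
    then show "y \<in> (\<Union>n. ?A n)" by blast
  next
    fix y assume "y \<in> (\<Union>n. ?A n)"
    then obtain n where "y \<in> ?A n" by blast
    moreover have "0 < inverse (real (Suc n))" by simp
    ultimately show "y \<in> {y \<in> {0..}. rearr f x < \<bar>f y\<bar>}" by (smt (verit) mem_Collect_eq)
  qed
  have inc: "incseq ?A"
  proof (rule monoI, rule subsetI)
    fix m n :: nat and y assume mn: "m \<le> n" and y: "y \<in> ?A m"
    have "inverse (real (Suc n)) \<le> inverse (real (Suc m))" using mn
      by (intro le_imp_inverse_le) auto
    with y show "y \<in> ?A n" by (smt (verit) mem_Collect_eq)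
  qed
  have meas: "?A n \<in> sets lborel" for n using f by measurable
  have "emeasure lborel (?A n) \<le> ennreal x" for n
  proof -
    have "rearr f x + inverse (Suc n) \<notin> level_set f x"
      using le_rearr[OF b] by force
    then show ?thesis by (simp add: level_set_def)
  qed
  then have "(SUP n. emeasure lborel (?A n)) \<le> ennreal x" by (auto intro: SUP_least)
  moreover have "(SUP n. emeasure lborel (?A n)) = emeasure lborel (\<Union>n. ?A n)"
    by (rule SUP_emeasure_incseq[OF _ inc]) (use meas in blast)
  ultimately show ?thesis unfolding eq by simp
qed

lemma emeasure_scale:
  fixes a :: real
  assumes "0 < a" "A \<in> sets borel"
  shows "ennreal a * emeasure lborel {y. a * y \<in> A} = emeasure lborel A"
proof -
  have "emeasure lborel A = emeasure (density (distr lborel borel (\<lambda>x. 0 + a * x)) (\<lambda>_. ennreal \<bar>a\<bar>)) A"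
    using lborel_real_affine[of a 0] assms by simp
  also have "\<dots> = ennreal a * emeasure (distr lborel borel (\<lambda>x. a * x)) A"
    using assms by (subst emeasure_density) (auto simp: nn_integral_cmult_indicator)
  also have "emeasure (distr lborel borel (\<lambda>x. a * x)) A = emeasure lborel {y. a * y \<in> A}"
    using assms by (subst emeasure_distr) (auto simp: vimage_def)
  finally show ?thesis by simp
qed

lemma level_set_dil:
  assumes a: "0 < a" and f: "f \<in> borel_measurable lborel"
  shows "level_set (dil a f) x = level_set f (a * x)"
proof -
  have "ennreal x \<le> emeasure lborel {y \<in> {0..}. t \<le> \<bar>f (a * y)\<bar>} \<longleftrightarrow>
      ennreal (a * x) \<le> emeasure lborel {y \<in> {0..}. t \<le> \<bar>f y\<bar>}" for t
  proof -
    have "{y \<in> {0..}. t \<le> \<bar>f y\<bar>} \<in> sets borel" using f by measurable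
    from emeasure_scale[OF a this]
    have "emeasure lborel {y \<in> {0..}. t \<le> \<bar>f y\<bar>}
        = ennreal a * emeasure lborel {y \<in> {0..}. t \<le> \<bar>f (a * y)\<bar>}"
      using a by (simp add: zero_le_mult_iff)
    moreover have "ennreal (a * x) = ennreal a * ennreal x" using a
      by (simp add: ennreal_mult' )
    ultimately show ?thesis using a by (simp add: ennreal_mult_le_mult_iff)
  qed
  then show ?thesis by (auto simp: level_set_def dil_def)
qed

section \<open>The Orlicz-Lorentz functional as a modular of the reparametrised
  rearrangement\<close>

lemma reparam_surj:
  assumes "phi_function F" "phi_function G" "0 < z"
  obtains x where "0 < x" "reparam F G x = z"
proof
  show "0 < 1 / G (phi_inv F (1 / z))" using assms by (simp add: phi_pos phi_inv_pos)
  show "reparam F G (1 / G (phi_inv F (1 / z))) = z"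
    using assms by (simp add: reparam_def phi_inv_phi phi_inv_props)
qed

lemma lorentz_le:
  assumes "phi_function G" "\<And>x. 0 < x \<Longrightarrow> bdd_above (level_set f x)" "phi_function F" "0 < c"
    and "modular G (\<lambda>x. rearr f (reparam F G x) / c) \<le> 1"
  shows "lorentz F G f \<le> ennreal c"
proof -
  have "modular G (\<lambda>x. \<bar>rearr f (tilde F (phi_inv (tilde G) x))\<bar> / c) = modular G (\<lambda>x. rearr f (reparam F G x) / c)"
    using assms rearr_nonneg[of f] by (intro modular_cong) (simp add: tilde_phi_inv_tilde reparam_pos)
  then show ?thesis using assms lux_le[of c G] by (simp add: lorentz_def)
qed

lemma lorentz_less:
  assumes "phi_function F" "phi_function G" "lorentz F G f < ennreal c"
  shows "modular G (\<lambda>x. rearr f (reparam F G x) / c) \<le> 1"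
proof -
  have b: "\<forall>x>0. bdd_above (level_set f x)" using assms(3) by (auto simp: lorentz_def split: if_splits)
  have "modular G (\<lambda>x. \<bar>rearr f (tilde F (phi_inv (tilde G) x))\<bar> / c) = modular G (\<lambda>x. rearr f (reparam F G x) / c)"
    using assms b rearr_nonneg[of f] by (intro modular_cong) (simp add: tilde_phi_inv_tilde reparam_pos)
  moreover have "lux G (\<lambda>x. rearr f (tilde F (phi_inv (tilde G) x))) < ennreal c"
    using assms(3) b by (simp add: lorentz_def)
  ultimately show ?thesis using lux_less_modular[OF assms(2)] by metis
qed

lemma LFG_bdd: "f \<in> LFG F G \<Longrightarrow> 0 < x \<Longrightarrow> bdd_above (level_set f x)"
  by (auto simp: LFG_def lorentz_def split: if_splits)

lemma LFG_measurable: "f \<in> LFG F G \<Longrightarrow> f \<in> borel_measurable lborel"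
  by (simp add: LFG_def)

lemma LFG_modular:
  assumes "phi_function F" "phi_function G" "f \<in> LFG F G" "enn2real (lorentz F G f) < c"
  shows "modular G (\<lambda>x. rearr f (reparam F G x) / c) \<le> 1"
proof (rule lorentz_less[OF assms(1,2)])
  have "lorentz F G f = ennreal (enn2real (lorentz F G f))" using assms(3) by (simp add: LFG_def)
  also have "\<dots> < ennreal c" using assms(4) by (intro ennreal_lessI) (auto intro: le_less_trans[OF enn2real_nonneg])
  finally show "lorentz F G f < ennreal c" .
qed

lemma rearr_reparam_decreasing:
  assumes "phi_function F" "phi_function G" "\<And>x. 0 < x \<Longrightarrow> bdd_above (level_set f x)"
    and "0 < a" "0 < x" "x \<le> y"
  shows "rearr f (a * reparam F G y) \<le> rearr f (a * reparam F G x)"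
  using assms reparam_le_iff[OF assms(1,2), of x y]
  by (intro rearr_antimono) (auto simp: reparam_pos intro!: mult_left_mono)

text \<open>If the functional vanishes, the modular of the rearrangement divided by any
  \<open>c > 0\<close> is at most 1, so the pointwise bound \<open>c * phi_inv G (1 / z)\<close>
  holds for every \<open>c > 0\<close>.\<close>

lemma LFG_zero_rearr:
  assumes F: "phi_function F" and G: "phi_function G" and f: "f \<in> LFG F G"
    and 0: "enn2real (lorentz F G f) = 0" and x: "0 < x"
  shows "rearr f x = 0"
proof -
  note b = LFG_bdd[OF f]
  obtain z where z: "0 < z" "reparam F G z = x" using reparam_surj[OF F G x] by blast
  have "rearr f x \<le> phi_inv G (1 / z) * c" if c: "0 < c" for c
  proof -
    have "rearr f (reparam F G z) / c \<le> phi_inv G (1 / z)"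
    proof (rule decreasing_modular_le[OF G, where f = "\<lambda>x. rearr f (reparam F G x) / c"])
      show "modular G (\<lambda>x. rearr f (reparam F G x) / c) \<le> 1"
        by (rule LFG_modular[OF F G f]) (use 0 c in simp)
      fix x y :: real assume "0 < x" "x \<le> y"
      then show "rearr f (reparam F G y) / c \<le> rearr f (reparam F G x) / c"
        using rearr_reparam_decreasing[OF F G b, of 1] c by (simp add: divide_right_mono)
    qed (use z c F G in \<open>auto simp: rearr_nonneg b reparam_pos\<close>)
    then show ?thesis using z c by (simp add: field_simps)
  qed
  note le = this
  have pos: "0 < phi_inv G (1 / z)" using phi_inv_pos[OF G, of "1 / z"] z by simp
  have "rearr f x \<le> 0"
  proof (rule ccontr)
    assume "\<not> rearr f x \<le> 0"
    then show False
      using le[of "rearr f x / (2 * phi_inv G (1 / z))"] pos by (simp add: field_simps)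
  qed
  then show ?thesis using rearr_nonneg[OF b[OF x]] by simp
qed

text \<open>A bound on the functional gives back a modular bound only if it is strict; the factor 2
  provides this. Functions with functional 0 do not enter the supremum in \<open>dil_norm\<close>,
  but their rearrangements vanish.\<close>

lemma dil_norm_modular:
  assumes F: "phi_function F" and G: "phi_function G" and f: "f \<in> LFG F G"
    and a: "0 < a" and d: "dil_norm F G a \<le> ennreal d" "0 < d"
  shows "modular G (\<lambda>x. rearr f (a * reparam F G x) / (2 * d * enn2real (lorentz F G f))) \<le> 1"
proof -
  define N where "N = enn2real (lorentz F G f)"
  have lN: "lorentz F G f = ennreal N" using f by (simp add: LFG_def N_def)
  have r: "rearr (dil a f) x = rearr f (a * x)" for x
    using level_set_dil[OF a LFG_measurable[OF f]] by (simp add: rearr_def)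
  show ?thesis
  proof (cases "N = 0")
    case True
    have "modular G (\<lambda>x. rearr f (a * reparam F G x) / (2 * d * N)) = modular G (\<lambda>x. 0)"
      using LFG_zero_rearr[OF F G f] True by (intro modular_cong) (simp)
    then show ?thesis unfolding N_def using phi_zero[OF G] by (simp add: modular_def)
  next
    case False
    then have N: "0 < N" using enn2real_nonneg[of "lorentz F G f"] unfolding N_def by linarith
    have "lorentz F G (dil a f) / lorentz F G f \<le> dil_norm F G a"
      unfolding dil_norm_def using f N lN by (intro SUP_upper) auto
    then have "lorentz F G (dil a f) / ennreal N \<le> ennreal d" using d lN by simp
    then have "lorentz F G (dil a f) \<le> ennreal d * ennreal N"
      using mult_right_mono[of "lorentz F G (dil a f) / ennreal N" "ennreal d" "ennreal N"] N
      by (simp add: ennreal_divide_times mult_divide_eq_ennreal)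
    also have "\<dots> < ennreal (2 * d * N)" using N d by (simp add: ennreal_mult[symmetric] ennreal_less_iff)
    finally show ?thesis using lorentz_less[OF F G, of "dil a f"] r by (simp add: N_def)
  qed
qed

section \<open>The Luxemburg functional on decreasing functions\<close>

lemma convex_scale_le:
  fixes K :: "real \<Rightarrow> real"
  assumes "convex_on {0..} K" "K 0 = 0" "0 \<le> a" "a \<le> 1" "0 \<le> u"
  shows "K (a * u) \<le> a * K u"
proof -
  have "K ((1 - a) *\<^sub>R 0 + a *\<^sub>R u) \<le> (1 - a) * K 0 + a * K u"
    using assms by (intro convex_onD) auto
  then show ?thesis using assms by simp
qed

lemma convex_pos_mono:
  fixes K :: "real \<Rightarrow> real"
  assumes "convex_on {0..} K" "K 0 = 0" "\<And>u. 0 < u \<Longrightarrow> 0 < K u" "0 \<le> u" "u \<le> v"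
  shows "K u \<le> K v"
proof (cases "v = 0")
  case False
  then have v: "0 < v" using assms by simp
  have "K (u / v * v) \<le> u / v * K v" using assms v by (intro convex_scale_le) auto
  also have "\<dots> \<le> 1 * K v" using assms(3)[OF v] assms(5) v by (intro mult_right_mono) auto
  finally show ?thesis using v by simp
qed (use assms in simp)

text \<open>In the application \<open>G\<close> is the rescaled function,
  \<open>t / \<rho> t\<close> stands in for \<open>phi_inv H t\<close>, and \<open>c\<close>
  collects all equivalence constants. The modular bound in \<open>J\<close> survives an increase of
  \<open>d\<close>, so \<open>2 * c \<le> d\<close> can be arranged; it yields
  \<open>M t \<le> t / 2\<close> below.\<close>

locale J_setting =
  fixes G K Hs \<rho> :: "real \<Rightarrow> real" and c d :: real
  assumes G: "phi_function G" and Hs: "phi_function Hs" and \<rho>: "\<rho> = phi_inv Hs"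
    and K: "convex_on {0..} K" "K 0 = 0" "\<And>u. 0 < u \<Longrightarrow> 0 < K u"
    and c: "1 \<le> c" and d: "2 * c \<le> d"
    and K_le_G: "\<And>t. 0 < t \<Longrightarrow> K (t / \<rho> t / c) \<le> G t"
    and G_le_K: "\<And>t. 0 < t \<Longrightarrow> G t \<le> K (c * (t / \<rho> t))"
    and quasi_mono: "\<And>s t. 0 < s \<Longrightarrow> s \<le> t \<Longrightarrow> s / \<rho> s \<le> c * (t / \<rho> t)"
    and unbounded: "\<And>L. \<exists>t>0. L \<le> t / \<rho> t"
    and J: "modular Hs (\<lambda>x. \<rho> (1 / x) / d) \<le> 1"
begin

lemma rho_pos: "0 < t \<Longrightarrow> 0 < \<rho> t"
  by (simp add: \<rho> phi_inv_pos Hs)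

lemma rho_nonneg: "0 \<le> t \<Longrightarrow> 0 \<le> \<rho> t"
  by (simp add: \<rho> phi_inv_props Hs)

lemma rho_le_iff: "0 \<le> s \<Longrightarrow> 0 \<le> t \<Longrightarrow> \<rho> s \<le> \<rho> t \<longleftrightarrow> s \<le> t"
  by (simp add: \<rho> phi_inv_le_iff Hs)

lemma K_scale: "0 \<le> a \<Longrightarrow> a \<le> 1 \<Longrightarrow> 0 \<le> u \<Longrightarrow> K (a * u) \<le> a * K u"
  by (rule convex_scale_le[OF K(1,2)])

lemma K_nonneg: "0 \<le> u \<Longrightarrow> 0 \<le> K u"
  using K(2) K(3)[of u] by (cases "u = 0") auto

lemma K_mono: "0 \<le> u \<Longrightarrow> u \<le> v \<Longrightarrow> K u \<le> K v"
  by (rule convex_pos_mono[OF K])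

lemma K_scale_ge: "1 \<le> a \<Longrightarrow> 0 \<le> u \<Longrightarrow> a * K u \<le> K (a * u)"
  using K_scale[of "1 / a" "a * u"] by (simp add: field_simps)

text \<open>Total weight below 1 is admissible because \<open>K 0 = 0\<close>: the missing mass sits
  at the origin.\<close>

lemma K_jensen:
  assumes "\<And>k. k < n \<Longrightarrow> 0 \<le> w k" "\<And>k. k < n \<Longrightarrow> 0 \<le> u k" "(\<Sum>k<n::nat. w k) \<le> 1"
  shows "K (\<Sum>k<n. w k * u k) \<le> (\<Sum>k<n. w k * K (u k))"
proof (cases "(\<Sum>k<n. w k) = 0")
  case True
  then have "\<forall>k<n. w k = 0" using assms(1) by (subst (asm) sum_nonneg_eq_0_iff) auto
  then show ?thesis using K(2) by simp
next
  case False
  define W where "W = (\<Sum>k<n. w k)"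
  have W: "0 < W" "W \<le> 1" using False assms by (auto simp: W_def less_le intro: sum_nonneg)
  have n: "n > 0" using False by (cases n) auto
  have "K (\<Sum>k<n. w k * u k) = K (W * (\<Sum>k<n. (w k / W) * u k))"
    using W by (simp add: sum_distrib_left)
  also have "\<dots> \<le> W * K (\<Sum>k<n. (w k / W) * u k)"
    using W assms by (intro K_scale sum_nonneg) auto
  also have "K (\<Sum>k<n. (w k / W) * u k) \<le> (\<Sum>k<n. (w k / W) * K (u k))"
    using convex_on_sum[of "{..<n}" "{0..}" K "\<lambda>k. w k / W" u] assms W n K(1)
    by (auto simp: sum_divide_distrib[symmetric] W_def[symmetric])
  finally show ?thesis using W by (simp add: sum_distrib_left)
qed

text \<open>The height below which \<open>\<rho>\<close> is smaller than
  \<open>\<rho> t / d\<close>. Condition (J) is integrability of \<open>M (1 / x)\<close>.\<close>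

definition M :: "real \<Rightarrow> real" where "M t = Hs (\<rho> t / d)"

lemma d_pos: "0 < d" using c d by simp

lemma M_pos: "0 < t \<Longrightarrow> 0 < M t"
  using d_pos by (simp add: M_def phi_pos Hs rho_pos)

lemma rho_M: "0 < t \<Longrightarrow> \<rho> (M t) = \<rho> t / d"
  unfolding M_def using d_pos rho_pos[of t] by (simp add: \<rho> phi_inv_phi Hs)

lemma M_mono: "0 < s \<Longrightarrow> s \<le> t \<Longrightarrow> M s \<le> M t"
  using d_pos rho_le_iff[of s t] by (simp add: M_def phi_le_iff Hs rho_nonneg divide_right_mono)

text \<open>Quasi-monotonicity of \<open>t / \<rho> t\<close> is a doubling condition on
  \<open>\<rho>\<close> with constant \<open>2 * c\<close>, and \<open>d\<close> is at least this
  constant.\<close>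

lemma M_le: "0 < t \<Longrightarrow> M t \<le> t / 2"
proof -
  assume t: "0 < t"
  have "(t / 2) / \<rho> (t / 2) \<le> c * (t / \<rho> t)" using t by (intro quasi_mono) auto
  then have "\<rho> t \<le> 2 * c * \<rho> (t / 2)" using t rho_pos[of t] rho_pos[of "t / 2"] by (simp add: field_simps)
  also have "\<dots> \<le> d * \<rho> (t / 2)" using d rho_pos[of "t / 2"] t by (intro mult_right_mono) auto
  finally have "\<rho> (M t) \<le> \<rho> (t / 2)" using t d_pos by (simp add: rho_M field_simps)
  then show ?thesis using t M_pos[of t] by (simp add: rho_le_iff)
qed

lemma M_measurable: "(\<lambda>x. M (1 / x) * indicator {0<..} x) \<in> borel_measurable borel"
  by (rule decreasing_measurable, rule M_mono) (auto simp: field_simps)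

lemma J_M: "(\<integral>\<^sup>+ x\<in>{0<..}. ennreal (M (1 / x)) \<partial>lborel) \<le> 1"
  using J by (simp add: modular_def M_def)

text \<open>The decreasing function \<open>M (1 / x)\<close> is integrable and is at least
  \<open>M t\<close> up to the point \<open>1 / t\<close>. So \<open>M t\<close> times the length of
  a window ending at \<open>1 / t\<close> is bounded by a part of the integral that is small when
  the window lies near 0 or far out.\<close>

lemma M_small:
  assumes "0 < \<delta>"
  obtains \<alpha> \<beta> where "0 < \<alpha>" "0 < \<beta>" "\<And>t. 0 < t \<Longrightarrow> t \<le> \<alpha> \<or> \<beta> \<le> t \<Longrightarrow> M t \<le> \<delta> * t"
proof -
  define \<mu> where "\<mu> = density lborel (\<lambda>x. ennreal (M (1 / x) * indicator {0<..} x))"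
  have meas[measurable]: "(\<lambda>x. ennreal (M (1 / x) * indicator {0<..} x)) \<in> borel_measurable borel"
    using M_measurable by measurable
  have eq: "emeasure \<mu> A = (\<integral>\<^sup>+ x\<in>A. ennreal (M (1 / x) * indicator {0<..} x) \<partial>lborel)"
    if "A \<in> sets borel" for A
    using that unfolding \<mu>_def by (intro emeasure_density) auto
  have fin: "emeasure \<mu> A \<noteq> \<infinity>" if "A \<in> sets borel" for A
  proof -
    have "emeasure \<mu> A \<le> (\<integral>\<^sup>+ x\<in>{0<..}. ennreal (M (1 / x)) \<partial>lborel)"
      unfolding eq[OF that] by (intro nn_integral_mono) (auto simp: indicator_def)
    also have "\<dots> \<le> 1" by (rule J_M)
    finally show ?thesis by (auto simp: top_unique)
  qed
  have low: "ennreal (M t * (b - a)) \<le> emeasure \<mu> A"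
    if "0 \<le> a" "a \<le> b" "b = 1 / t" "0 < t" "{a<..b} \<subseteq> A" "A \<in> sets borel" for a b t A
  proof -
    have "ennreal (M t * (b - a)) = (\<integral>\<^sup>+ x. ennreal (M t) * indicator {a<..b} x \<partial>lborel)"
      using that M_pos[of t] by (simp add: nn_integral_cmult ennreal_mult)
    also have "\<dots> \<le> emeasure \<mu> A"
      unfolding eq[OF that(6)]
    proof (intro nn_integral_mono)
      fix x
      show "ennreal (M t) * indicator {a<..b} x \<le> ennreal (M (1 / x) * indicator {0<..} x) * indicator A x"
      proof (cases "x \<in> {a<..b}")
        case True
        then have "t \<le> 1 / x" "0 < x" "x \<in> A" using that True by (auto simp: field_simps intro: subsetD[OF that(5) True])
        then show ?thesis using True M_mono[of t "1 / x"] that by (auto intro: ennreal_leI)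
      qed simp
    qed
    finally show ?thesis .
  qed
  have "(\<lambda>n. emeasure \<mu> {0<..1 / real (Suc n)}) \<longlonglongrightarrow> emeasure \<mu> (\<Inter>n. {0<..1 / real (Suc n)})"
    using fin by (intro Lim_emeasure_decseq)
      (auto simp: \<mu>_def decseq_def elim!: order_trans intro!: divide_left_mono)
  moreover have "(\<Inter>n. {0<..1 / real (Suc n)}) = {}"
  proof -
    have "\<exists>n. \<not> x \<le> 1 / real (Suc n)" if "x > 0" for x :: real
      using reals_Archimedean[OF that] by (auto simp: not_le inverse_eq_divide)
    then show ?thesis by fastforce
  qed
  ultimately have "(\<lambda>n. emeasure \<mu> {0<..1 / real (Suc n)}) \<longlonglongrightarrow> 0" by simp
  then have "eventually (\<lambda>n. emeasure \<mu> {0<..1 / real (Suc n)} < ennreal \<delta>) sequentially"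
    using assms by (intro order_tendstoD) auto
  then obtain m where m: "emeasure \<mu> {0<..1 / real (Suc m)} < ennreal \<delta>"
    unfolding eventually_sequentially by blast
  have "(\<lambda>n. emeasure \<mu> {real n..}) \<longlonglongrightarrow> emeasure \<mu> (\<Inter>n. {real n..})"
    using fin by (intro Lim_emeasure_decseq) (auto simp: \<mu>_def decseq_def)
  moreover have "(\<Inter>n. {real n..}) = {}"
    using reals_Archimedean2 by (fastforce simp: not_le[symmetric])
  ultimately have "(\<lambda>n. emeasure \<mu> {real n..}) \<longlonglongrightarrow> 0" by simp
  then have "eventually (\<lambda>n. emeasure \<mu> {real n..} < ennreal (\<delta> / 2)) sequentially"
    using assms by (intro order_tendstoD) auto
  then obtain k where k: "emeasure \<mu> {real k..} < ennreal (\<delta> / 2)"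
    unfolding eventually_sequentially by blast
  show thesis
  proof
    show "0 < 1 / (2 * real (Suc k))" "0 < real (Suc m)" by auto
    fix t :: real assume t: "0 < t" "t \<le> 1 / (2 * real (Suc k)) \<or> real (Suc m) \<le> t"
    from t(2) show "M t \<le> \<delta> * t"
    proof
      assume t1: "t \<le> 1 / (2 * real (Suc k))"
      have "t * (2 * real (Suc k)) \<le> 1" using t1 by (simp add: field_simps)
      then have k': "real k \<le> 1 / (2 * t)" using t by (simp add: field_simps)
      \<comment> \<open>The interval from 0 to \<open>1 / t\<close> does not move out to infinity,
        so only its right half is used; this accounts for \<open>\<delta> / 2\<close> in the choice
        of \<open>k\<close>.\<close>
      have "ennreal (M t * (1 / t - 1 / (2 * t))) \<le> emeasure \<mu> {real k..}"
      proof (rule low)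
        show "{1 / (2 * t)<..1 / t} \<subseteq> {real k..}" using k' by auto
      qed (use t in \<open>auto simp: field_simps\<close>)
      also note k
      finally have "M t * (1 / t - 1 / (2 * t)) < \<delta> / 2"
        using ennreal_less_iff[of "M t * (1 / t - 1 / (2 * t))"] M_pos[OF t(1)] t assms by (simp add: field_simps)
      then show ?thesis using t by (simp add: field_simps)
    next
      assume t1: "real (Suc m) \<le> t"
      have "ennreal (M t * (1 / t - 0)) \<le> emeasure \<mu> {0<..1 / real (Suc m)}"
      proof (rule low)
        have "1 / t \<le> 1 / real (Suc m)" using t t1 by (intro divide_left_mono) auto
        then show "{0<..1 / t} \<subseteq> {0<..1 / real (Suc m)}" by auto
      qed (use t in auto)
      also note m
      finally have "M t * (1 / t - 0) < \<delta>"
        using ennreal_less_iff[of "M t * (1 / t - 0)"] M_pos[OF t(1)] t assms by (simp add: field_simps)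
      then show ?thesis using t by (simp add: field_simps)
    qed
  qed
qed

text \<open>Write \<open>s = M t\<close>, that is \<open>\<rho> t = d * \<rho> s\<close>. If
  \<open>C0 * s \<le> t\<close>, multiplying \<open>s\<close> by \<open>C0 = l * c * d\<close>
  raises \<open>\<rho>\<close> by at most the factor \<open>d\<close>, which leaves the gain
  \<open>l * c\<close>. Otherwise \<open>M t / t\<close> exceeds \<open>1 / C0\<close>, so
  \<open>t\<close> lies between the bounds of \<open>M_small\<close>, and on such a range
  unboundedness of \<open>t / \<rho> t\<close> suffices.\<close>

lemma growth_ratio:
  assumes l: "1 \<le> l"
  obtains C where "1 \<le> C" "\<And>t. 0 < t \<Longrightarrow> l * (t / \<rho> t) \<le> C * t / \<rho> (C * t)"
proof -
  define C0 where "C0 = l * c * d"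
  have "1 \<le> l * c" using mult_mono[OF l c] l c by simp
  then have C0: "1 \<le> C0" using mult_mono[of 1 "l * c" 1 d] c d by (simp add: C0_def)
  obtain \<alpha> \<beta> where ab: "0 < \<alpha>" "0 < \<beta>" "\<And>t. 0 < t \<Longrightarrow> t \<le> \<alpha> \<or> \<beta> \<le> t \<Longrightarrow> M t \<le> 1 / C0 * t"
    using M_small[of "1 / C0"] C0 by auto
  obtain T where T: "0 < T" "l * c * c * (\<beta> / \<rho> \<beta>) \<le> T / \<rho> T" using unbounded by blast
  define C where "C = max C0 (T * C0 / \<alpha>)"
  have C: "C0 \<le> C" "1 \<le> C" "T * C0 / \<alpha> \<le> C" using C0 by (auto simp: C_def)
  show thesis
  proof
    show "1 \<le> C" by fact
    fix s :: real assume s: "0 < s"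
    define t where "t = Hs (d * \<rho> s)"
    have t: "0 < t" "\<rho> t = d * \<rho> s" using d_pos rho_pos[OF s] Hs
      by (auto simp: t_def phi_pos \<rho> phi_inv_phi)
    have Mt: "M t = s" unfolding M_def using d_pos t s Hs by (simp add: \<rho> phi_inv_props)
    show "l * (s / \<rho> s) \<le> C * s / \<rho> (C * s)"
    proof (cases "C0 * s \<le> t")
      case True
      have "\<rho> (C0 * s) \<le> d * \<rho> s" using True t C0 s by (metis rho_le_iff less_imp_le mult_pos_pos order.strict_trans2 zero_less_one)
      then have "C0 * s / (d * \<rho> s) \<le> C0 * s / \<rho> (C0 * s)"
        using C0 s rho_pos[OF s] rho_pos[of "C0 * s"] d_pos by (intro divide_left_mono) auto
      also have "\<dots> \<le> c * (C * s / \<rho> (C * s))"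
        using C C0 s by (intro quasi_mono) auto
      finally have "c * (l * (s / \<rho> s)) \<le> c * (C * s / \<rho> (C * s))"
        using d_pos by (simp add: C0_def field_simps)
      then show ?thesis using c by (subst (asm) mult_le_cancel_left_pos) auto
    next
      case False
      then have "1 / C0 * t < M t" using Mt C0 s by (simp add: field_simps)
      then have "\<alpha> < t" "t < \<beta>" using ab(3)[OF t(1)] by force+
      moreover have "s \<le> t" using M_le[OF t(1)] Mt t by simp
      ultimately have s2: "s \<le> \<beta>" "\<alpha> \<le> C0 * s" using False by auto
      have "T \<le> (T * C0 / \<alpha>) * s" using T s2 ab by (simp add: field_simps)
      also have "\<dots> \<le> C * s" using C s by (intro mult_right_mono) auto
      finally have "T \<le> C * s" .
      then have "T / \<rho> T \<le> c * (C * s / \<rho> (C * s))" using T by (intro quasi_mono) auto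
      moreover have "s / \<rho> s \<le> c * (\<beta> / \<rho> \<beta>)" using s s2 by (intro quasi_mono)
      then have "l * c * (s / \<rho> s) \<le> l * c * (c * (\<beta> / \<rho> \<beta>))" using l c by (intro mult_left_mono) auto
      ultimately have "c * (l * (s / \<rho> s)) \<le> c * (C * s / \<rho> (C * s))" using T by (simp add: mult_ac)
      then show ?thesis using c by (subst (asm) mult_le_cancel_left_pos) auto
    qed
  qed
qed

text \<open>This is the growth condition that turns a modular bound by \<open>l\<close> into a bound
  by 1 after rescaling the function. The ratio is taken with \<open>l * (c * c)\<close> because one
  factor \<open>c\<close> is lost on passing from \<open>G\<close> to \<open>K\<close> and another
  on passing back.\<close>

lemma growth:
  assumes l: "1 \<le> l"
  obtains C where "1 \<le> C" "\<And>t. 0 \<le> t \<Longrightarrow> l * G t \<le> G (C * t)"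
proof -
  have "1 \<le> c * c" using mult_mono[OF c c] c by simp
  then have "1 \<le> l * (c * c)" using mult_mono[OF l, of 1 "c * c"] l by simp
  then obtain C where C: "1 \<le> C" "\<And>t. 0 < t \<Longrightarrow> l * (c * c) * (t / \<rho> t) \<le> C * t / \<rho> (C * t)"
    using growth_ratio by blast
  show thesis
  proof
    show "1 \<le> C" by fact
    fix t :: real assume "0 \<le> t"
    show "l * G t \<le> G (C * t)"
    proof (cases "t = 0")
      case False
      then have t: "0 < t" "0 < C * t" using \<open>0 \<le> t\<close> C by auto
      have p: "0 < t / \<rho> t" using t rho_pos by simp
      have "l * G t \<le> l * K (c * (t / \<rho> t))" using G_le_K[OF t(1)] l by simp
      also have "\<dots> \<le> K (l * (c * (t / \<rho> t)))" using l c p by (intro K_scale_ge mult_nonneg_nonneg) auto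
      also have "\<dots> \<le> K (C * t / \<rho> (C * t) / c)"
      proof (rule K_mono)
        show "0 \<le> l * (c * (t / \<rho> t))" using l c p by (intro mult_nonneg_nonneg) auto
        have "c * (l * (c * (t / \<rho> t))) \<le> C * t / \<rho> (C * t)" using C(2)[OF t(1)] by (simp add: mult_ac)
        then show "l * (c * (t / \<rho> t)) \<le> C * t / \<rho> (C * t) / c"
          using c by (subst pos_le_divide_eq) (auto simp: mult_ac)
      qed
      also have "\<dots> \<le> G (C * t)" by (rule K_le_G[OF t(2)])
      finally show ?thesis .
    qed (simp add: phi_zero G)
  qed
qed

text \<open>By \<open>rho_M\<close>, \<open>M t / \<rho> (M t)\<close> equals
  \<open>t / \<rho> t\<close> multiplied by \<open>d * M t / t\<close>, and a convex function
  vanishing at 0 shrinks at least linearly. If the factor \<open>a\<close> is not below 1,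
  \<open>M_le\<close> already suffices. The argument \<open>t / 2\<close> on the right is dictated
  by the averaging window used next, whose end points differ by a factor 2.\<close>

lemma G_M_ratio:
  assumes t: "0 < t"
  shows "G (M t) \<le> 2 * c\<^sup>2 * d * (M t / t) * G (t / 2)"
proof -
  define a where "a = 2 * c\<^sup>2 * d * (M t / t)"
  have a0: "0 \<le> a" using c d_pos M_pos[OF t] t by (simp add: a_def)
  have p: "0 < t / \<rho> t" using t rho_pos by simp
  have "G (M t) \<le> a * G (t / 2)"
  proof (cases "1 \<le> a")
    case True
    have "G (M t) \<le> G (t / 2)" using t M_le[OF t] M_pos[OF t] by (simp add: phi_le_iff G)
    also have "\<dots> \<le> a * G (t / 2)" using mult_right_mono[OF True, of "G (t / 2)"] t by (simp add: phi_nonneg G)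
    finally show ?thesis .
  next
    case False
    have "G (M t) \<le> K (c * (M t / \<rho> (M t)))" by (rule G_le_K[OF M_pos[OF t]])
    also have "c * (M t / \<rho> (M t)) = a * (t / \<rho> t / (2 * c))"
      using t c d_pos rho_pos[OF t] by (simp add: rho_M a_def field_simps power2_eq_square)
    also have "K \<dots> \<le> a * K (t / \<rho> t / (2 * c))"
      using False a0 t rho_pos[OF t] c by (intro K_scale) auto
    also have "K (t / \<rho> t / (2 * c)) \<le> K ((t / 2) / \<rho> (t / 2) / c)"
    proof (rule K_mono)
      show "0 \<le> t / \<rho> t / (2 * c)" using t rho_pos[OF t] c by simp
      have "\<rho> (t / 2) \<le> \<rho> t" using t by (simp add: rho_le_iff)
      then show "t / \<rho> t / (2 * c) \<le> (t / 2) / \<rho> (t / 2) / c"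
        using t c rho_pos[of t] rho_pos[of "t / 2"] by (simp add: field_simps)
    qed
    then have "a * K (t / \<rho> t / (2 * c)) \<le> a * G (t / 2)"
      using K_le_G[of "t / 2"] t a0 by (intro mult_left_mono) auto
    finally show ?thesis .
  qed
  then show ?thesis by (simp add: a_def)
qed

section \<open>The weak-space envelope and the linearised functional\<close>

definition \<tau> :: "real \<Rightarrow> real" where "\<tau> x = phi_inv G (1 / x)"

lemma tau_pos: "0 < x \<Longrightarrow> 0 < \<tau> x"
  by (simp add: \<tau>_def phi_inv_pos G)

lemma tau_antimono: "0 < x \<Longrightarrow> x \<le> y \<Longrightarrow> \<tau> y \<le> \<tau> x"
  by (simp add: \<tau>_def phi_inv_le_iff G frac_le)

lemma G_tau: "0 < x \<Longrightarrow> G (\<tau> x) = 1 / x"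
  by (simp add: \<tau>_def phi_inv_props G)

text \<open>Fubini for the kernel \<open>w\<close>. Its integral in \<open>y\<close> dominates half
  of the integrand. In \<open>x\<close> it is supported where
  \<open>1 / (2 * y) \<le> \<tau> x\<close>, an interval of length at most
  \<open>1 / G (1 / (2 * y))\<close>; \<open>G_M_ratio\<close> bounds the resulting quotient by a
  multiple of \<open>M (1 / y)\<close>, whose integral is at most 1.\<close>

lemma modular_M_tau: "modular G (\<lambda>x. M (\<tau> x)) \<le> ennreal (4 * c\<^sup>2 * d)"
proof -
  define g where "g y = G (M (1 / y)) * indicator {0<..} y" for y
  have g_meas[measurable]: "g \<in> borel_measurable borel"
    unfolding g_def
    by (rule decreasing_measurable) (auto simp: phi_le_iff G M_mono frac_le M_pos less_imp_le)
  define \<tau>' where "\<tau>' x = \<tau> x * indicator {0<..} x" for x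
  have tau_meas[measurable]: "\<tau>' \<in> borel_measurable borel"
    unfolding \<tau>'_def by (rule decreasing_measurable) (rule tau_antimono)
  have g0: "0 \<le> g y" for y by (simp add: g_def phi_nonneg G M_pos less_imp_le indicator_def)
  define w :: "real \<Rightarrow> real \<Rightarrow> ennreal" where
    "w x y = (if 0 < x \<and> 1 \<le> 2 * \<tau>' x * y \<and> \<tau>' x * y \<le> 1 then ennreal (g y / y) else 0)" for x y
  have w_meas: "case_prod w \<in> borel_measurable (lborel \<Otimes>\<^sub>M lborel)"
    unfolding w_def by measurable
  text \<open>Averaging over a window of length comparable to \<open>1 / \<tau> x\<close> transfers the integral to the variable of J.\<close>
  have le: "ennreal (G (M (\<tau> x))) * indicator {0<..} x \<le> 2 * (\<integral>\<^sup>+ y. w x y \<partial>lborel)" for x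
  proof (cases "0 < x")
    case True
    define t where "t = \<tau> x"
    have t: "0 < t" "\<tau>' x = t" using True by (auto simp: t_def tau_pos \<tau>'_def)
    have "ennreal (G (M t)) = 2 * ennreal (G (M t) * t * (1 / t - 1 / (2 * t)))"
      using t phi_nonneg[OF G, of "M t"] M_pos[of t]
      by (simp add: ennreal_numeral[symmetric] ennreal_mult[symmetric] field_simps del: ennreal_numeral)
    also have "ennreal (G (M t) * t * (1 / t - 1 / (2 * t))) =
        (\<integral>\<^sup>+ y. ennreal (G (M t) * t) * indicator {1 / (2 * t)..1 / t} y \<partial>lborel)"
    proof -
      have le: "1 / (2 * t) \<le> 1 / t" using t by (simp add: field_simps)
      have "0 \<le> G (M t) * t" using t phi_nonneg[OF G, of "M t"] M_pos[of t] by simp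
      then have "ennreal (G (M t) * t * (1 / t - 1 / (2 * t))) = ennreal (G (M t) * t) * ennreal (1 / t - 1 / (2 * t))"
        using le by (intro ennreal_mult) linarith+
      then show ?thesis using le by (simp add: nn_integral_cmult_indicator)
    qed
    also have "\<dots> \<le> (\<integral>\<^sup>+ y. w x y \<partial>lborel)"
    proof (rule nn_integral_mono)
      fix y
      show "ennreal (G (M t) * t) * indicator {1 / (2 * t)..1 / t} y \<le> w x y"
      proof (cases "y \<in> {1 / (2 * t)..1 / t}")
        case y: True
        then have "0 < 1 / (2 * t)" "1 / (2 * t) \<le> y" using t by auto
        then have y0: "0 < y" by linarith
        then have ty: "t \<le> 1 / y" "1 \<le> 2 * t * y" "t * y \<le> 1" using y t by (auto simp: field_simps)
        have "G (M t) \<le> G (M (1 / y))"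
          using ty t y0 by (simp add: phi_le_iff G M_mono M_pos less_imp_le)
        then have "G (M t) * t \<le> G (M (1 / y)) * (1 / y)"
          using ty t y0 by (intro mult_mono) (auto simp: phi_nonneg G M_pos less_imp_le)
        then show ?thesis using True y t ty y0 by (simp add: w_def g_def ennreal_leI)
      qed simp
    qed
    finally show ?thesis using True by (simp add: t_def mult_left_mono)
  qed simp
  have inner: "(\<integral>\<^sup>+ x. w x y \<partial>lborel) \<le> ennreal (2 * c\<^sup>2 * d) * (ennreal (M (1 / y)) * indicator {0<..} y)" for y
  proof (cases "0 < y")
    case True
    define s where "s = G (1 / (2 * y))"
    have s: "0 < s" using True by (simp add: s_def phi_pos G)
    have gy: "0 \<le> g y / y" using g0[of y] True by simp
    have "(\<integral>\<^sup>+ x. w x y \<partial>lborel) \<le> (\<integral>\<^sup>+ x. ennreal (g y / y) * indicator {0..1 / s} x \<partial>lborel)"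
    proof (rule nn_integral_mono)
      fix x
      show "w x y \<le> ennreal (g y / y) * indicator {0..1 / s} x"
      proof (cases "0 < x \<and> 1 \<le> 2 * \<tau>' x * y")
        case x: True
        then have "1 \<le> 2 * \<tau> x * y" by (auto simp: \<tau>'_def)
        then have "1 / (2 * y) \<le> \<tau> x" using True by (simp add: field_simps)
        then have "s \<le> 1 / x" using x True G_tau[of x] phi_le_iff[OF G, of "1 / (2 * y)" "\<tau> x"] tau_pos[of x]
          by (simp add: s_def)
        then have "x \<in> {0..1 / s}" using x s by (simp add: field_simps)
        then show ?thesis by (simp add: w_def)
      qed (auto simp: w_def)
    qed
    also have "\<dots> = ennreal (g y / y * (1 / s))" using s
      by (subst ennreal_mult[OF gy]) (simp_all add: nn_integral_cmult)
    also have "\<dots> \<le> ennreal (2 * c\<^sup>2 * d * M (1 / y))"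
    proof (rule ennreal_leI)
      have "g y \<le> 2 * c\<^sup>2 * d * (M (1 / y) / (1 / y)) * s"
        using G_M_ratio[of "1 / y"] True by (simp add: g_def s_def field_simps)
      then show "g y / y * (1 / s) \<le> 2 * c\<^sup>2 * d * M (1 / y)" using True s by (simp add: field_simps)
    qed
    also have "\<dots> = ennreal (2 * c\<^sup>2 * d) * ennreal (M (1 / y))"
      using d_pos M_pos[of "1 / y"] True by (intro ennreal_mult) auto
    finally show ?thesis using True by simp
  next
    case False
    have "w x y = 0" for x
    proof (cases "0 < x")
      case True
      have "2 * \<tau>' x * y \<le> 0" using False tau_pos[of x] True
        by (simp add: \<tau>'_def mult_le_0_iff)
      then have "\<not> 1 \<le> 2 * \<tau>' x * y" by linarith
      then show ?thesis by (simp add: w_def)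
    qed (simp add: w_def)
    then show ?thesis by simp
  qed
  have "modular G (\<lambda>x. M (\<tau> x)) \<le> (\<integral>\<^sup>+ x. 2 * (\<integral>\<^sup>+ y. w x y \<partial>lborel) \<partial>lborel)"
    unfolding modular_def by (rule nn_integral_mono) (rule le)
  also have "\<dots> = 2 * (\<integral>\<^sup>+ x. (\<integral>\<^sup>+ y. w x y \<partial>lborel) \<partial>lborel)"
    using lborel.borel_measurable_nn_integral[OF w_meas] by (intro nn_integral_cmult) simp
  also have "(\<integral>\<^sup>+ x. (\<integral>\<^sup>+ y. w x y \<partial>lborel) \<partial>lborel) = (\<integral>\<^sup>+ y. (\<integral>\<^sup>+ x. w x y \<partial>lborel) \<partial>lborel)"
    by (rule lborel_pair.Fubini'[OF w_meas, symmetric])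
  also have "\<dots> \<le> (\<integral>\<^sup>+ y. ennreal (2 * c\<^sup>2 * d) * (ennreal (M (1 / y)) * indicator {0<..} y) \<partial>lborel)"
    by (rule nn_integral_mono) (rule inner)
  also have "\<dots> = ennreal (2 * c\<^sup>2 * d) * (\<integral>\<^sup>+ y\<in>{0<..}. ennreal (M (1 / y)) \<partial>lborel)"
    using decreasing_ennreal_measurable[of "\<lambda>y. M (1 / y)"] M_mono
    by (intro nn_integral_cmult) (simp add: frac_le)
  also have "\<dots> \<le> ennreal (2 * c\<^sup>2 * d) * 1" by (intro mult_left_mono J_M) auto
  finally have "modular G (\<lambda>x. M (\<tau> x)) \<le> 2 * ennreal (2 * c\<^sup>2 * d)" by (simp add: mult_left_mono)
  also have "\<dots> = ennreal (4 * c\<^sup>2 * d)"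
    using d_pos by (simp add: ennreal_numeral[symmetric] ennreal_mult[symmetric] del: ennreal_numeral)
  finally show ?thesis .
qed

text \<open>Since \<open>f x \<le> \<tau> x\<close>, the denominator \<open>\<rho> (f x)\<close> may
  be enlarged to \<open>\<rho> (\<tau> x)\<close>, which does not depend on
  \<open>f\<close>.\<close>

lemma K_le_modular:
  assumes f0: "\<And>x. 0 < x \<Longrightarrow> 0 \<le> f x"
    and dec: "\<And>x y. 0 < x \<Longrightarrow> x \<le> y \<Longrightarrow> f y \<le> f x"
    and m: "modular G f \<le> 1" and x: "0 < x"
  shows "K (f x / (c * \<rho> (\<tau> x))) \<le> G (f x)"
proof (cases "f x = 0")
  case True
  then show ?thesis using K(2) by (simp add: phi_zero G)
next
  case False
  then have f: "0 < f x" using f0[OF x] by simp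
  have "f x \<le> \<tau> x" unfolding \<tau>_def by (rule decreasing_modular_le[OF G f0 dec m x])
  then have "\<rho> (f x) \<le> \<rho> (\<tau> x)" using f by (simp add: rho_le_iff)
  then have "f x / (c * \<rho> (\<tau> x)) \<le> f x / \<rho> (f x) / c"
    using f c rho_pos[OF f] by (simp add: frac_le)
  then have "K (f x / (c * \<rho> (\<tau> x))) \<le> K (f x / \<rho> (f x) / c)"
    using f c rho_pos[OF tau_pos[OF x]] by (intro K_mono) auto
  also have "\<dots> \<le> G (f x)" by (rule K_le_G[OF f])
  finally show ?thesis .
qed

text \<open>The two regions contribute modulars of at most 1 and \<open>4 * c\<^sup>2 * d\<close>;
  their total \<open>L\<close> is brought down to 1 by \<open>growth\<close>, at the price of the
  scale \<open>C1\<close>. The scale \<open>C2 = c\<^sup>2 * d\<close> cancels the factors lost when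
  \<open>c * (y / \<rho> y)\<close> is bounded by
  \<open>f x / (c * \<rho> (\<tau> x))\<close>.\<close>

lemma modular_le_of_K:
  obtains C where "1 \<le> C" "\<And>f. (\<And>x. 0 < x \<Longrightarrow> 0 \<le> f x) \<Longrightarrow>
      (\<And>x y. 0 < x \<Longrightarrow> x \<le> y \<Longrightarrow> f y \<le> f x) \<Longrightarrow>
      (\<integral>\<^sup>+ x\<in>{0<..}. ennreal (K (f x / (c * \<rho> (\<tau> x)))) \<partial>lborel) \<le> 1 \<Longrightarrow>
      modular G (\<lambda>x. f x / C) \<le> 1"
proof -
  define L where "L = 1 + 4 * c\<^sup>2 * d"
  have L: "1 \<le> L" using d_pos by (simp add: L_def)
  obtain C1 where C1: "1 \<le> C1" "\<And>t. 0 \<le> t \<Longrightarrow> L * G t \<le> G (C1 * t)" using growth[OF L] by blast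
  define C2 where "C2 = c\<^sup>2 * d"
  have "1 \<le> c\<^sup>2" using c by simp
  then have C2: "1 \<le> C2" using mult_mono[of 1 "c\<^sup>2" 1 d] c d by (simp add: C2_def)
  have C12: "1 \<le> C1 * C2" using mult_mono[OF C1(1) C2] C1 C2 by simp
  show thesis
  proof
    show "1 \<le> C1 * C2" by (rule C12)
    fix f :: "real \<Rightarrow> real"
    assume f0: "\<And>x. 0 < x \<Longrightarrow> 0 \<le> f x"
      and dec: "\<And>x y. 0 < x \<Longrightarrow> x \<le> y \<Longrightarrow> f y \<le> f x"
      and int: "(\<integral>\<^sup>+ x\<in>{0<..}. ennreal (K (f x / (c * \<rho> (\<tau> x)))) \<partial>lborel) \<le> 1"
    have split: "G (f x / C2) \<le> K (f x / (c * \<rho> (\<tau> x))) + G (M (\<tau> x))" if x: "0 < x" for x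
    proof -
      define y t where "y = f x / C2" and "t = \<tau> x"
      have t: "0 < t" using x by (simp add: t_def tau_pos)
      have K0: "0 \<le> K (f x / (c * \<rho> (\<tau> x)))"
        using f0[OF x] c rho_pos[OF tau_pos[OF x]] by (intro K_nonneg) auto
      have G0: "0 \<le> G (M (\<tau> x))" using M_pos[OF t] by (simp add: t_def phi_nonneg G)
      have y0: "0 \<le> y" using f0[OF x] C2 by (simp add: y_def)
      show ?thesis
      proof (cases "\<rho> t / d \<le> \<rho> y")
        case True
        then have "0 < \<rho> y" using rho_pos[OF t] d_pos by (smt (verit) divide_pos_pos)
        then have y: "0 < y" using y0 by (cases "y = 0") (auto simp: \<rho> phi_inv_zero Hs)
        have "G y \<le> K (c * (y / \<rho> y))" by (rule G_le_K[OF y])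
        also have "\<dots> \<le> K (f x / (c * \<rho> t))"
        proof (rule K_mono)
          show "0 \<le> c * (y / \<rho> y)" using y c \<open>0 < \<rho> y\<close> by simp
          have "y / \<rho> y \<le> y / (\<rho> t / d)"
            using True y rho_pos[OF t] d_pos \<open>0 < \<rho> y\<close> by (intro divide_left_mono mult_pos_pos) auto
          then have "c * (y / \<rho> y) \<le> c * (y / (\<rho> t / d))" using c by (intro mult_left_mono) auto
          also have "\<dots> = f x / (c * \<rho> t)" using c d_pos
            by (simp add: y_def C2_def field_simps power2_eq_square)
          finally show "c * (y / \<rho> y) \<le> f x / (c * \<rho> t)" .
        qed
        finally show ?thesis using G0 by (simp add: y_def t_def)
      next
        case False
        then have "\<rho> y \<le> \<rho> (M t)" using t by (simp add: rho_M)
        then have "y \<le> M t" using y0 M_pos[OF t] by (simp add: rho_le_iff)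
        then have "G y \<le> G (M t)" using y0 M_pos[OF t] by (simp add: phi_le_iff G)
        then show ?thesis using K0 by (simp add: y_def t_def)
      qed
    qed
    define k where "k x = K (max 0 (f x * indicator {0<..} x / (c * (\<rho> (\<tau> x) * indicator {0<..} x))))" for x
    have k_meas[measurable]: "k \<in> borel_measurable borel"
    proof -
      have "mono (\<lambda>u. K (max 0 u))" by (auto simp: mono_def intro!: K_mono)
      then have 1: "(\<lambda>u. K (max 0 u)) \<in> borel_measurable borel" by (rule borel_measurable_mono)
      have [measurable]: "(\<lambda>x. f x * indicator {0<..} x) \<in> borel_measurable borel"
        by (rule decreasing_measurable) (rule dec)
      have [measurable]: "(\<lambda>x. \<rho> (\<tau> x) * indicator {0<..} x) \<in> borel_measurable borel"
        by (rule decreasing_measurable) (simp add: rho_le_iff tau_antimono tau_pos less_imp_le)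
      show ?thesis unfolding k_def by (rule measurable_compose[OF _ 1]) measurable
    qed
    have k: "k x = K (f x / (c * \<rho> (\<tau> x)))" if "0 < x" for x
      using that f0[OF that] c rho_pos[OF tau_pos[OF that]] by (simp add: k_def)
    define m where "m x = G (M (\<tau> x)) * indicator {0<..} x" for x
    have m_meas[measurable]: "m \<in> borel_measurable borel"
      unfolding m_def
      by (rule decreasing_measurable) (simp add: phi_le_iff G M_mono M_pos tau_pos tau_antimono less_imp_le)
    have "modular G (\<lambda>x. f x / (C1 * C2)) \<le>
        (\<integral>\<^sup>+ x. ennreal (1 / L) * ((ennreal (k x) + ennreal (m x)) * indicator {0<..} x) \<partial>lborel)"
      unfolding modular_def
    proof (rule nn_integral_mono)
      fix x :: real
      show "ennreal (G (f x / (C1 * C2))) * indicator {0<..} x \<le>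
          ennreal (1 / L) * ((ennreal (k x) + ennreal (m x)) * indicator {0<..} x)"
      proof (cases "0 < x")
        case True
        have "L * G (f x / (C1 * C2)) \<le> G (f x / C2)"
          using C1(2)[of "f x / (C1 * C2)"] C1(1) C12 f0[OF True] by simp
        also have "\<dots> \<le> k x + m x" using split[OF True] True by (simp add: k m_def)
        finally have "G (f x / (C1 * C2)) \<le> 1 / L * (k x + m x)" using L by (simp add: field_simps)
        moreover have "0 \<le> k x" "0 \<le> m x"
          using True f0[OF True] c rho_pos[OF tau_pos[OF True]] M_pos[OF tau_pos[OF True]]
          by (auto simp: k m_def phi_nonneg G intro!: K_nonneg)
        ultimately show ?thesis using True L by (simp add: ennreal_mult[symmetric] ennreal_plus[symmetric] ennreal_leI del: ennreal_plus)
      qed simp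
    qed
    also have "\<dots> = ennreal (1 / L) * ((\<integral>\<^sup>+ x\<in>{0<..}. ennreal (k x) \<partial>lborel) + (\<integral>\<^sup>+ x\<in>{0<..}. ennreal (m x) \<partial>lborel))"
      by (simp add: nn_integral_cmult nn_integral_add distrib_right)
    also have "(\<integral>\<^sup>+ x\<in>{0<..}. ennreal (k x) \<partial>lborel) = (\<integral>\<^sup>+ x\<in>{0<..}. ennreal (K (f x / (c * \<rho> (\<tau> x)))) \<partial>lborel)"
      by (rule nn_integral_cong) (auto simp: k indicator_def)
    also have "(\<integral>\<^sup>+ x\<in>{0<..}. ennreal (m x) \<partial>lborel) = modular G (\<lambda>x. M (\<tau> x))"
      unfolding modular_def by (rule nn_integral_cong) (auto simp: m_def indicator_def)
    also have "ennreal (1 / L) * ((\<integral>\<^sup>+ x\<in>{0<..}. ennreal (K (f x / (c * \<rho> (\<tau> x)))) \<partial>lborel) + modular G (\<lambda>x. M (\<tau> x)))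
        \<le> ennreal (1 / L) * (1 + ennreal (4 * c\<^sup>2 * d))"
      by (intro mult_left_mono add_mono int modular_M_tau) auto
    also have "\<dots> = ennreal (1 / L * L)"
      using L d_pos by (simp add: L_def ennreal_mult[symmetric] ennreal_1[symmetric] ennreal_plus[symmetric] del: ennreal_plus ennreal_1)
    also have "\<dots> = 1" using L by simp
    finally show "modular G (\<lambda>x. f x / (C1 * C2)) \<le> 1" .
  qed
qed

text \<open>A countable triangle inequality up to the constant \<open>C\<close>: the argument of
  \<open>K\<close> is linear in the function, so Jensen's inequality with weights
  \<open>b k / B\<close> applies. The condition for \<open>b k = 0\<close> excludes functions hidden
  by the convention that division by zero gives zero. Infinite sums are allowed because dyadic
  series have to be summed.\<close>

lemma modular_series:
  obtains C where "1 \<le> C" "\<And>(f :: nat \<Rightarrow> real \<Rightarrow> real) b.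
      (\<And>k x. 0 < x \<Longrightarrow> 0 \<le> f k x) \<Longrightarrow>
      (\<And>k x y. 0 < x \<Longrightarrow> x \<le> y \<Longrightarrow> f k y \<le> f k x) \<Longrightarrow>
      (\<And>k. 0 \<le> b k) \<Longrightarrow> (\<And>k x. b k = 0 \<Longrightarrow> 0 < x \<Longrightarrow> f k x = 0) \<Longrightarrow>
      (\<And>k. modular G (\<lambda>x. f k x / b k) \<le> 1) \<Longrightarrow> summable b \<Longrightarrow>
      (\<forall>x>0. summable (\<lambda>k. f k x)) \<and> modular G (\<lambda>x. (\<Sum>k. f k x) / (C * suminf b)) \<le> 1"
proof -
  obtain C where C: "1 \<le> C" "\<And>f. (\<And>x. 0 < x \<Longrightarrow> 0 \<le> f x) \<Longrightarrow>
      (\<And>x y. 0 < x \<Longrightarrow> x \<le> y \<Longrightarrow> f y \<le> f x) \<Longrightarrow>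
      (\<integral>\<^sup>+ x\<in>{0<..}. ennreal (K (f x / (c * \<rho> (\<tau> x)))) \<partial>lborel) \<le> 1 \<Longrightarrow>
      modular G (\<lambda>x. f x / C) \<le> 1"
    using modular_le_of_K by blast
  show thesis
  proof (rule that[OF C(1)])
    fix f :: "nat \<Rightarrow> real \<Rightarrow> real" and b :: "nat \<Rightarrow> real"
    assume f0: "\<And>k x. 0 < x \<Longrightarrow> 0 \<le> f k x"
      and dec: "\<And>k x y. 0 < x \<Longrightarrow> x \<le> y \<Longrightarrow> f k y \<le> f k x"
      and b0: "\<And>k. 0 \<le> b k" and bz: "\<And>k x. b k = 0 \<Longrightarrow> 0 < x \<Longrightarrow> f k x = 0"
      and m: "\<And>k. modular G (\<lambda>x. f k x / b k) \<le> 1" and b: "summable b"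
    define B where "B = suminf b"
    have B0: "0 \<le> B" unfolding B_def using b b0 by (rule suminf_nonneg)
    show "(\<forall>x>0. summable (\<lambda>k. f k x)) \<and> modular G (\<lambda>x. (\<Sum>k. f k x) / (C * suminf b)) \<le> 1"
    proof (cases "B = 0")
      case True
      then have "b k = 0" for k using suminf_eq_zero_iff[OF b b0] by (simp add: B_def)
      then have z: "f k x = 0" if "0 < x" for k x using bz that by blast
      have "modular G (\<lambda>x. (\<Sum>k. f k x) / (C * suminf b)) = modular G (\<lambda>x. 0)"
        using True by (intro modular_cong) (simp add: B_def)
      then show ?thesis using z by (simp add: modular_def phi_zero G)
    next
      case False
      then have B: "0 < B" using B0 by simp
      define S where "S n x = (\<Sum>k<n. f k x) / B" for n x
      have S0: "0 \<le> S n x" if "0 < x" for n x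
        unfolding S_def using f0[OF that] B by (intro divide_nonneg_pos sum_nonneg) auto
      have Sdec: "S n y \<le> S n x" if "0 < x" "x \<le> y" for n x y
        unfolding S_def using dec[OF that] B by (intro divide_right_mono sum_mono) auto
      have gm: "(\<lambda>x. ennreal (G (f k x / b k)) * indicator {0<..} x) \<in> borel_measurable lborel" for k
        using decreasing_ennreal_measurable[of "\<lambda>x. G (f k x / b k)"]
        by (simp add: phi_le_iff G f0 b0 dec divide_right_mono)
      have Sm: "modular G (\<lambda>x. S n x / C) \<le> 1" for n
      proof (rule C(2)[OF S0 Sdec])
        have sum_le: "(\<Sum>k<n. b k) \<le> B" unfolding B_def by (rule sum_le_suminf[OF b]) (auto simp: b0)
        have "(\<integral>\<^sup>+ x\<in>{0<..}. ennreal (K (S n x / (c * \<rho> (\<tau> x)))) \<partial>lborel) \<le>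
          (\<integral>\<^sup>+ x. (\<Sum>k<n. ennreal (b k / B) * (ennreal (G (f k x / b k)) * indicator {0<..} x)) \<partial>lborel)"
        proof (rule nn_integral_mono)
          fix x :: real
          show "ennreal (K (S n x / (c * \<rho> (\<tau> x)))) * indicator {0<..} x \<le>
             (\<Sum>k<n. ennreal (b k / B) * (ennreal (G (f k x / b k)) * indicator {0<..} x))"
          proof (cases "0 < x")
            case True
            define q where "q = c * \<rho> (\<tau> x)"
            have q: "0 < q" using c rho_pos[OF tau_pos[OF True]] by (simp add: q_def)
            have "f k x = b k * (f k x / b k)" for k using bz[OF _ True, of k] by (cases "b k = 0") auto
            then have "S n x / q = (\<Sum>k<n. (b k / B) * (f k x / b k / q))"
              unfolding S_def sum_divide_distrib by (intro sum.cong refl) (metis divide_divide_eq_left times_divide_eq_left times_divide_eq_right mult.commute)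
            then have "K (S n x / q) \<le> (\<Sum>k<n. (b k / B) * K (f k x / b k / q))"
              using K_jensen[of n "\<lambda>k. b k / B" "\<lambda>k. f k x / b k / q"] b0 f0[OF True] q B sum_le
              by (simp add: sum_divide_distrib[symmetric])
            also have "\<dots> \<le> (\<Sum>k<n. (b k / B) * G (f k x / b k))"
              using b0 B f0 dec m True unfolding q_def
              by (intro sum_mono mult_left_mono K_le_modular) (auto intro: divide_right_mono)
            finally have "ennreal (K (S n x / q)) \<le> ennreal (\<Sum>k<n. (b k / B) * G (f k x / b k))"
              by (rule ennreal_leI)
            also have "\<dots> = (\<Sum>k<n. ennreal ((b k / B) * G (f k x / b k)))"
              using b0 B f0[OF True] by (intro sum_ennreal[symmetric] mult_nonneg_nonneg) (auto simp: phi_nonneg G)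
            also have "\<dots> = (\<Sum>k<n. ennreal (b k / B) * ennreal (G (f k x / b k)))"
              using b0 B f0[OF True] by (intro sum.cong refl ennreal_mult) (auto simp: phi_nonneg G)
            finally show ?thesis using True by (simp add: q_def)
          qed simp
        qed
        also have "\<dots> = (\<Sum>k<n. ennreal (b k / B) * modular G (\<lambda>x. f k x / b k))"
          using gm by (simp add: nn_integral_sum nn_integral_cmult modular_def)
        also have "\<dots> \<le> (\<Sum>k<n. ennreal (b k / B) * 1)"
          using m by (intro sum_mono mult_left_mono) auto
        also have "\<dots> = ennreal (\<Sum>k<n. b k / B)" using b0 B by (simp add: sum_ennreal)
        also have "\<dots> \<le> 1" using sum_le B by (simp add: sum_divide_distrib[symmetric] ennreal_le_1)
        finally show "(\<integral>\<^sup>+ x\<in>{0<..}. ennreal (K (S n x / (c * \<rho> (\<tau> x)))) \<partial>lborel) \<le> 1" .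
      qed auto
      have SC0: "0 \<le> S n x / C" if "0 < x" for n x using S0[OF that] C(1) by simp
      \<comment> \<open>The weak-space bound, uniform in \<open>n\<close>, gives pointwise
        convergence of the series; Fatou's lemma then carries the modular bound to the
        limit.\<close>
      have Sb: "S n x / C \<le> \<tau> x" if "0 < x" for n x
        unfolding \<tau>_def using that C(1)
        by (intro decreasing_modular_le[OF G _ _ Sm, of n]) (auto simp: SC0 Sdec divide_right_mono)
      have sf: "summable (\<lambda>k. f k x)" if "0 < x" for x
      proof (rule summableI_nonneg_bounded)
        show "0 \<le> f k x" for k using f0[OF that] .
        show "(\<Sum>k<n. f k x) \<le> \<tau> x * C * B" for n using Sb[OF that, of n] B C(1) by (simp add: S_def field_simps)
      qed
      have lim: "(\<lambda>n. S n x / C) \<longlonglongrightarrow> (\<Sum>k. f k x) / (C * B)" if "0 < x" for x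
      proof -
        have "(\<lambda>n. (\<Sum>k<n. f k x) / B / C) \<longlonglongrightarrow> (\<Sum>k. f k x) / B / C"
          using summable_LIMSEQ[OF sf[OF that]] B C(1) by (intro tendsto_divide tendsto_const) auto
        then show ?thesis by (simp add: S_def mult.commute)
      qed
      have "modular G (\<lambda>x. (\<Sum>k. f k x) / (C * B)) \<le>
          (\<integral>\<^sup>+ x. liminf (\<lambda>n. ennreal (G (S n x / C)) * indicator {0<..} x) \<partial>lborel)"
        unfolding modular_def
      proof (rule nn_integral_mono)
        fix x :: real
        show "ennreal (G ((\<Sum>k. f k x) / (C * B))) * indicator {0<..} x
            \<le> liminf (\<lambda>n. ennreal (G (S n x / C)) * indicator {0<..} x)"
        proof (cases "0 < x")
          case True
          have Gc: "continuous_on {0..} G" using G by (simp add: phi_function_def)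
          have "(\<lambda>n. G (S n x / C)) \<longlonglongrightarrow> G ((\<Sum>k. f k x) / (C * B))"
            by (rule continuous_on_tendsto_compose[OF Gc lim[OF True]])
              (use True f0[OF True] B C(1) SC0[OF True] sf[OF True] in \<open>auto intro!: divide_nonneg_nonneg suminf_nonneg\<close>)
          then have "(\<lambda>n. ennreal (G (S n x / C))) \<longlonglongrightarrow> ennreal (G ((\<Sum>k. f k x) / (C * B)))"
            by (rule tendsto_ennrealI)
          then show ?thesis using lim_imp_Liminf[of sequentially] True by fastforce
        qed simp
      qed
      also have "\<dots> \<le> liminf (\<lambda>n. (\<integral>\<^sup>+ x. ennreal (G (S n x / C)) * indicator {0<..} x \<partial>lborel))"
      proof (rule nn_integral_liminf)
        fix n
        show "(\<lambda>x. ennreal (G (S n x / C)) * indicator {0<..} x) \<in> borel_measurable lborel"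
          using decreasing_ennreal_measurable[of "\<lambda>x. G (S n x / C)"] C(1)
          by (simp add: phi_le_iff G SC0 Sdec divide_right_mono)
      qed
      also have "\<dots> \<le> liminf (\<lambda>n. 1)"
        using Sm by (intro Liminf_mono) (auto simp: modular_def)
      also have "\<dots> = 1" by (simp add: Liminf_const)
      finally show ?thesis using sf by (simp add: B_def)
    qed
  qed
qed

end

lemma J_setting_of_condJ:
  assumes G: "phi_function G" and p: "0 < p" and N: "phi_function H" and J: "condJ H"
    and s: "phi_succ G (\<lambda>t. phi_inv H (t powr p))"
  obtains K Hs c d where "J_setting (root_scale p G) K Hs (phi_inv Hs) c d"
proof -
  obtain Hs where Hs: "complementary H Hs" "lux Hs (\<lambda>x. 1 / phi_inv (tilde Hs) x) < \<infinity>"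
    using J by (auto simp: condJ_def)
  have Hsp: "phi_function Hs" using Hs(1) by (simp add: complementary_def)
  obtain a where a: "0 < a" "\<And>t. 0 \<le> t \<Longrightarrow> t / a \<le> phi_inv H t * phi_inv Hs t"
      "\<And>t. 0 \<le> t \<Longrightarrow> phi_inv H t * phi_inv Hs t \<le> a * t"
    using Hs(1) by (auto simp: complementary_def)
  obtain K where K: "convex_on {0..} K" and e: "phi_equiv (\<lambda>t. G (phi_inv (\<lambda>t. phi_inv H (t powr p)) t)) K"
    using s by (auto simp: phi_succ_def)
  note inv = phi_inv_inv_powr[OF N p]
  define G1 where "G1 = root_scale p G"
  have G1: "phi_function G1" unfolding G1_def by (rule phi_function_root_scale[OF G p])
  obtain b where b: "0 < b" "\<And>u. 0 \<le> u \<Longrightarrow> G1 (H (u / b)) \<le> K u" "\<And>u. 0 \<le> u \<Longrightarrow> K u \<le> G1 (H (b * u))"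
    using e inv unfolding phi_equiv_def G1_def by (metis divide_nonneg_pos mult_nonneg_nonneg less_imp_le)
  define \<rho> h where "\<rho> = phi_inv Hs" and "h = phi_inv H"
  have pos: "0 < \<rho> t" "0 < h t" if "0 < t" for t
    using that by (auto simp: \<rho>_def h_def phi_inv_pos Hsp N)
  have h1: "h t \<le> a * (t / \<rho> t)" "t / \<rho> t \<le> a * h t" if "0 < t" for t
    using a(1) a(2,3)[of t] pos[OF that] that by (auto simp: \<rho>_def[symmetric] h_def[symmetric] field_simps)
  have K0: "K 0 = 0" using b(2,3)[of 0] by (simp add: phi_zero G1 N)
  have Kpos: "0 < K u" if "0 < u" for u
    using b(1) b(2)[of u] phi_pos[OF G1, of "H (u / b)"] phi_pos[OF N, of "u / b"] that by simp
  \<comment> \<open>\<open>a * b\<close> pays for replacing \<open>h t\<close> by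
    \<open>t / \<rho> t\<close> inside the equivalence with \<open>K\<close>, and
    \<open>a * a\<close> for transferring the monotonicity of \<open>h\<close> to
    \<open>t / \<rho> t\<close>.\<close>
  define c where "c = max 1 (max (a * b) (a * a))"
  have c: "1 \<le> c" "a * b \<le> c" "a * a \<le> c" by (auto simp: c_def)
  obtain d0 where d0: "0 < d0" "lux Hs (\<lambda>x. 1 / phi_inv (tilde Hs) x) < ennreal d0"
  proof -
    from Hs(2) obtain r where "lux Hs (\<lambda>x. 1 / phi_inv (tilde Hs) x) = ennreal r" "0 \<le> r"
      by (cases "lux Hs (\<lambda>x. 1 / phi_inv (tilde Hs) x)") auto
    then show thesis using that[of "r + 1"] by (simp add: ennreal_less_iff)
  qed
  define d where "d = max d0 (2 * c)"
  note Kmono = convex_pos_mono[OF K K0 Kpos]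
  have "J_setting G1 K Hs \<rho> c d"
  proof
    show "2 * c \<le> d" by (simp add: d_def)
    show "K (t / \<rho> t / c) \<le> G1 t" if t: "0 < t" for t
    proof -
      have "t / \<rho> t \<le> a * h t" by (rule h1[OF t])
      also have "\<dots> \<le> (c / b) * h t" using c b(1) pos[OF t] by (intro mult_right_mono) (auto simp: field_simps)
      finally have "t / \<rho> t \<le> (h t / b) * c" by (simp add: mult.commute)
      then have "t / \<rho> t / c \<le> h t / b" using c by (subst pos_divide_le_eq) auto
      then have "K (t / \<rho> t / c) \<le> K (h t / b)" using c t pos[OF t] by (intro Kmono) auto
      also have "\<dots> \<le> G1 (H (b * (h t / b)))" using b(1) pos[OF t] by (intro b(3)) auto
      also have "\<dots> = G1 t" using b(1) t by (simp add: h_def phi_inv_props N)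
      finally show ?thesis .
    qed
    show "G1 t \<le> K (c * (t / \<rho> t))" if t: "0 < t" for t
    proof -
      have "G1 t = G1 (H (b * h t / b))" using b(1) t by (simp add: h_def phi_inv_props N)
      also have "\<dots> \<le> K (b * h t)" using b(1) pos[OF t] by (intro b(2)) auto
      also have "\<dots> \<le> K (c * (t / \<rho> t))"
      proof (rule Kmono)
        show "0 \<le> b * h t" using b(1) pos[OF t] by simp
        have "b * h t \<le> b * (a * (t / \<rho> t))" using h1[OF t] b(1) by (intro mult_left_mono) auto
        also have "\<dots> = (a * b) * (t / \<rho> t)" by simp
        also have "\<dots> \<le> c * (t / \<rho> t)" using c t pos[OF t] by (intro mult_right_mono) auto
        finally show "b * h t \<le> c * (t / \<rho> t)" .
      qed
      finally show ?thesis .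
    qed
    show "s / \<rho> s \<le> c * (t / \<rho> t)" if "0 < s" "s \<le> t" for s t
    proof -
      have t: "0 < t" using that by simp
      have "s / \<rho> s \<le> a * h s" by (rule h1[OF that(1)])
      also have "\<dots> \<le> a * h t" using that a(1) t by (intro mult_left_mono) (auto simp: h_def phi_inv_le_iff N)
      also have "\<dots> \<le> a * (a * (t / \<rho> t))" using a(1) h1[OF t] by (intro mult_left_mono) auto
      also have "\<dots> = (a * a) * (t / \<rho> t)" by simp
      also have "\<dots> \<le> c * (t / \<rho> t)" using c t pos[OF t] by (intro mult_right_mono) auto
      finally show ?thesis .
    qed
    show "\<exists>t>0. L \<le> t / \<rho> t" for L
    proof (intro exI conjI)
      let ?t = "H (max 1 (a * L))"
      show t: "0 < ?t" by (simp add: phi_pos N)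
      have "a * L \<le> h ?t" by (simp add: h_def phi_inv_phi N)
      also have "\<dots> \<le> a * (?t / \<rho> ?t)" by (rule h1[OF t])
      finally show "L \<le> ?t / \<rho> ?t" using a(1) by (subst (asm) mult_le_cancel_left_pos) auto
    qed
    have dd: "lux Hs (\<lambda>x. 1 / phi_inv (tilde Hs) x) < ennreal d"
      using d0 by (auto simp: d_def intro: order.strict_trans2 ennreal_leI)
    have "modular Hs (\<lambda>x. \<rho> (1 / x) / d) = modular Hs (\<lambda>x. \<bar>1 / phi_inv (tilde Hs) x\<bar> / d)"
      using pos by (intro modular_cong) (simp add: phi_inv_tilde Hsp \<rho>_def phi_inv_props)
    also have "\<dots> \<le> 1" by (rule lux_less_modular[OF Hsp dd])
    finally show "modular Hs (\<lambda>x. \<rho> (1 / x) / d) \<le> 1" .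
  qed (use G1 Hsp K K0 Kpos c in \<open>auto simp: \<rho>_def\<close>)
  then show thesis using that unfolding G1_def \<rho>_def by blast
qed

section \<open>Sufficiency\<close>

text \<open>With \<open>r k\<close> the rearrangement of \<open>u\<close> at
  \<open>x / 2 ^ k\<close>, the series is a dyadic form of the averaged rearrangement at
  \<open>x\<close>. The layer where \<open>u\<close> lies between \<open>r k\<close> and
  \<open>r (Suc k)\<close> has measure at most \<open>x / 2 ^ k\<close>; the shift between the index
  of the value and that of the measure is the source of the factor 2. The set where \<open>u\<close>
  exceeds every \<open>r k\<close> is null.\<close>

lemma integral_le_layers:
  fixes u :: "real \<Rightarrow> real" and r :: "nat \<Rightarrow> real"
  assumes u[measurable]: "u \<in> borel_measurable borel" and r0: "\<And>k. 0 \<le> r k" and x: "0 < x"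
    and lev: "\<And>k. emeasure lborel {y \<in> {0..}. r k < u y} \<le> ennreal (x / 2 ^ k)"
    and s: "summable (\<lambda>k. r k / 2 ^ k)"
    and E[measurable]: "E \<in> sets borel" "E \<subseteq> {0..}" and \<mu>: "emeasure lborel E = ennreal \<mu>" "x \<le> \<mu>"
  shows "(\<integral>\<^sup>+ y\<in>E. ennreal (u y) \<partial>lborel) \<le> ennreal (2 * (\<Sum>k. r k / 2 ^ k) * \<mu>)"
proof -
  let ?A = "\<lambda>k. {y \<in> {0..}. r k < u y}"
  have AE: "AE y in lborel. y \<notin> (\<Inter>k. ?A k)"
  proof (rule AE_I'[of "\<Inter>k. ?A k"])
    have "emeasure lborel (\<Inter>k. ?A k) \<le> ennreal (x / 2 ^ k)" for k
      by (rule order_trans[OF emeasure_mono lev[of k]]) auto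
    moreover have "(\<lambda>k. ennreal (x / 2 ^ k)) \<longlonglongrightarrow> ennreal 0"
      by (intro tendsto_ennrealI LIMSEQ_divide_realpow_zero) auto
    ultimately have "emeasure lborel (\<Inter>k. ?A k) \<le> ennreal 0"
      by (intro LIMSEQ_le_const[of "\<lambda>k. ennreal (x / 2 ^ k)"]) auto
    moreover have "(\<Inter>k. ?A k) \<in> sets lborel" by measurable
    ultimately show "(\<Inter>k. ?A k) \<in> null_sets lborel" by (auto simp: null_sets_def)
  qed auto
  have pt: "ennreal (u y) \<le> ennreal (r 0) + (\<Sum>k. ennreal (r (Suc k)) * indicator (?A k) y)"
    if "y \<in> E" "y \<notin> (\<Inter>k. ?A k)" for y
  proof -
    have ex: "\<exists>k. u y \<le> r k" using that E(2) by (auto simp: not_less)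
    define k where "k = (LEAST k. u y \<le> r k)"
    have k: "u y \<le> r k" unfolding k_def by (rule LeastI_ex[OF ex])
    show ?thesis
    proof (cases k)
      case 0
      then show ?thesis using k by (auto intro: order_trans[OF ennreal_leI] )
    next
      case (Suc j)
      then have "r j < u y" using not_less_Least[of j "\<lambda>k. u y \<le> r k"] by (simp add: k_def not_le)
      then have "ennreal (u y) \<le> ennreal (r (Suc j)) * indicator (?A j) y"
        using that E(2) k Suc by (auto simp: indicator_def intro: ennreal_leI)
      also have "\<dots> \<le> (\<Sum>k. ennreal (r (Suc k)) * indicator (?A k) y)"
      proof -
        have "(\<Sum>k\<in>{j}. ennreal (r (Suc k)) * indicator (?A k) y) \<le> (\<Sum>k. ennreal (r (Suc k)) * indicator (?A k) y)"
          by (rule sum_le_suminf) auto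
        then show ?thesis by (simp only: sum.insert finite.emptyI empty_iff not_False_eq_True sum.empty add_0_right)
      qed
      finally show ?thesis by (simp add: add_increasing)
    qed
  qed
  have \<mu>0: "0 < \<mu>" using x \<mu> by simp
  have sS: "summable (\<lambda>k. r (Suc k) / 2 ^ Suc k)" using s by (subst summable_Suc_iff)
  have sm: "summable (\<lambda>k. r (Suc k) * (x / 2 ^ k))"
    using summable_mult[OF sS, of "2 * x"] by (simp add: field_simps)
  have val: "(\<Sum>k. r (Suc k) * (x / 2 ^ k)) = 2 * x * (\<Sum>k. r (Suc k) / 2 ^ Suc k)"
    using suminf_mult[OF sS, of "2 * x"] by (simp add: field_simps)
  have "(\<integral>\<^sup>+ y\<in>E. ennreal (u y) \<partial>lborel) \<le>
      (\<integral>\<^sup>+ y. ennreal (r 0) * indicator E y + (\<Sum>k. ennreal (r (Suc k)) * indicator (?A k) y) \<partial>lborel)"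
  proof (rule nn_integral_mono_AE, use AE in eventually_elim)
    case (elim y)
    then show ?case using pt[of y] by (auto simp: indicator_def split: if_splits)
  qed
  also have "\<dots> = ennreal (r 0) * emeasure lborel E + (\<Sum>k. ennreal (r (Suc k)) * emeasure lborel (?A k))"
    by (simp add: nn_integral_add nn_integral_suminf nn_integral_cmult)
  also have "\<dots> \<le> ennreal (r 0) * ennreal \<mu> + (\<Sum>k. ennreal (r (Suc k)) * ennreal (x / 2 ^ k))"
    using \<mu>(1) lev by (intro add_mono suminf_le mult_left_mono) auto
  also have "(\<Sum>k. ennreal (r (Suc k)) * ennreal (x / 2 ^ k)) = (\<Sum>k. ennreal (r (Suc k) * (x / 2 ^ k)))"
    using r0 x by (simp add: ennreal_mult[symmetric])
  also have "\<dots> = ennreal (\<Sum>k. r (Suc k) * (x / 2 ^ k))"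
    using sm r0 x by (intro suminf_ennreal2) auto
  also have "ennreal (r 0) * ennreal \<mu> + \<dots> = ennreal (r 0 * \<mu> + (\<Sum>k. r (Suc k) * (x / 2 ^ k)))"
    using r0 \<mu>0 sm x by (simp add: ennreal_mult[symmetric] suminf_nonneg)
  also have "\<dots> \<le> ennreal (2 * (\<Sum>k. r k / 2 ^ k) * \<mu>)"
  proof (rule ennreal_leI)
    have "(\<Sum>k. r k / 2 ^ k) = (\<Sum>k. r (Suc k) / 2 ^ Suc k) + r 0"
      using suminf_split_head[OF s] by simp
    moreover have "0 \<le> (\<Sum>k. r (Suc k) / 2 ^ Suc k)" using sS r0 by (intro suminf_nonneg) auto
    then have "x * (\<Sum>k. r (Suc k) / 2 ^ Suc k) \<le> \<mu> * (\<Sum>k. r (Suc k) / 2 ^ Suc k)"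
      using \<mu> by (intro mult_right_mono) auto
    moreover have "0 \<le> r 0 * \<mu>" using r0[of 0] \<mu>0 by simp
    ultimately show "r 0 * \<mu> + (\<Sum>k. r (Suc k) * (x / 2 ^ k)) \<le> 2 * (\<Sum>k. r k / 2 ^ k) * \<mu>"
      unfolding val by (simp add: algebra_simps)
  qed
  finally show ?thesis .
qed

text \<open>Rearrangements are not subadditive, but integrals over a common set are additive.
  Integrating over a part of the superlevel set of the sum and applying the layer bound to each
  summand bounds the rearrangement of the sum by the dyadic series.\<close>

lemma level_of_sum_le:
  fixes u :: "nat \<Rightarrow> real \<Rightarrow> real" and r :: "nat \<Rightarrow> nat \<Rightarrow> real"
  assumes u[measurable]: "\<And>i. i < n \<Longrightarrow> u i \<in> borel_measurable borel" and u0: "\<And>i y. 0 \<le> u i y"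
    and r0: "\<And>i k. i < n \<Longrightarrow> 0 \<le> r i k" and x: "0 < x"
    and lev: "\<And>i k. i < n \<Longrightarrow> emeasure lborel {y \<in> {0..}. r i k < u i y} \<le> ennreal (x / 2 ^ k)"
    and s: "\<And>i. i < n \<Longrightarrow> summable (\<lambda>k. r i k / 2 ^ k)"
    and S: "ennreal x \<le> emeasure lborel {y \<in> {0..}. t \<le> (\<Sum>i<n. u i y)}"
  shows "t \<le> (\<Sum>i<n. 2 * (\<Sum>k. r i k / 2 ^ k))"
proof (cases "0 < t")
  case False
  have "0 \<le> (\<Sum>i<n. 2 * (\<Sum>k. r i k / 2 ^ k))"
    using s r0 by (intro sum_nonneg mult_nonneg_nonneg suminf_nonneg) auto
  with False show ?thesis by simp
next
  case t: True
  let ?S = "{y \<in> {0..}. t \<le> (\<Sum>i<n. u i y)}"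
  have sum_meas[measurable]: "(\<lambda>y. \<Sum>i<n. u i y) \<in> borel_measurable borel"
    by (rule borel_measurable_sum) (auto intro: u)
  have Sm[measurable]: "?S \<in> sets borel" by measurable
  \<comment> \<open>The superlevel set may have infinite measure; a piece of finite measure at least
    \<open>x\<close> allows division by \<open>\<mu>\<close> at the end.\<close>
  obtain E \<mu> where E: "E \<in> sets borel" "E \<subseteq> ?S" "emeasure lborel E = ennreal \<mu>" "x \<le> \<mu>"
  proof (cases "emeasure lborel ?S")
    case (real m)
    then show ?thesis using that[of ?S m] S x by (simp add: ennreal_le_iff)
  next
    case top
    let ?B = "\<lambda>n::nat. ?S \<inter> {..real n}"
    have "(SUP n. emeasure lborel (?B n)) = emeasure lborel (\<Union>n. ?B n)"
      by (rule SUP_emeasure_incseq) (auto simp: incseq_def)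
    also have "(\<Union>n. ?B n) = ?S" using real_arch_simple by auto
    finally have eq: "(SUP n. emeasure lborel (?B n)) = emeasure lborel ?S" .
    have "ennreal x < (SUP n. emeasure lborel (?B n))" unfolding eq top by simp
    then obtain n where n: "ennreal x < emeasure lborel (?B n)" by (auto simp: less_SUP_iff)
    have "emeasure lborel (?B n) \<le> emeasure lborel {0..real n}" by (intro emeasure_mono) auto
    also have "\<dots> < \<infinity>" by simp
    finally obtain m where "emeasure lborel (?B n) = ennreal m" "0 \<le> m"
      by (cases "emeasure lborel (?B n)") auto
    then show ?thesis using that[of "?B n" m] n x by (auto simp: ennreal_less_iff)
  qed
  have \<mu>: "0 < \<mu>" using E x by simp
  have "ennreal (t * \<mu>) = (\<integral>\<^sup>+ y. ennreal t * indicator E y \<partial>lborel)"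
    using E t \<mu> by (simp add: nn_integral_cmult_indicator ennreal_mult)
  also have "\<dots> \<le> (\<integral>\<^sup>+ y. (\<Sum>i<n. ennreal (u i y) * indicator E y) \<partial>lborel)"
  proof (rule nn_integral_mono)
    fix y
    show "ennreal t * indicator E y \<le> (\<Sum>i<n. ennreal (u i y) * indicator E y)"
      using E(2) u0 by (auto simp: indicator_def sum_ennreal intro!: ennreal_leI)
  qed
  also have "\<dots> = (\<Sum>i<n. \<integral>\<^sup>+ y\<in>E. ennreal (u i y) \<partial>lborel)"
  proof (rule nn_integral_sum)
    fix i assume "i \<in> {..<n}"
    then have [measurable]: "u i \<in> borel_measurable borel" by (simp add: u)
    note [measurable] = E(1)
    show "(\<lambda>y. ennreal (u i y) * indicator E y) \<in> borel_measurable lborel" by measurable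
  qed
  also have "\<dots> \<le> (\<Sum>i<n. ennreal (2 * (\<Sum>k. r i k / 2 ^ k) * \<mu>))"
    using E by (intro sum_mono integral_le_layers[OF u r0 x lev s]) auto
  also have "\<dots> = ennreal (\<Sum>i<n. 2 * (\<Sum>k. r i k / 2 ^ k) * \<mu>)"
    using s r0 \<mu> by (intro sum_ennreal mult_nonneg_nonneg suminf_nonneg) auto
  finally have "t * \<mu> \<le> (\<Sum>i<n. 2 * (\<Sum>k. r i k / 2 ^ k) * \<mu>)"
    using s r0 \<mu> by (subst (asm) ennreal_le_iff) (auto intro!: sum_nonneg mult_nonneg_nonneg suminf_nonneg)
  also have "\<dots> = (\<Sum>i<n. 2 * (\<Sum>k. r i k / 2 ^ k)) * \<mu>" by (simp add: sum_distrib_right)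
  finally show ?thesis using \<mu> by simp
qed


text \<open>The \<open>k\<close>-th dyadic term comes from the dilation by \<open>2 ^ k\<close>,
  whose norm is at most \<open>D * 2 powr (k / q)\<close>. Its \<open>p\<close>-th power divided by
  \<open>2 ^ k\<close> is a geometric term of ratio \<open>2 powr (p / q - 1)\<close>, which is
  below 1 since \<open>q > p\<close>. The series inequality is used twice: over \<open>k\<close> for
  a single function, then over the functions.\<close>

lemma p_convex_of_J_setting:
  assumes F: "phi_function F" and G: "phi_function G" and p: "0 < p"
    and boyd: "ereal p < lower_boyd F G" and J: "J_setting (root_scale p G) K Hs \<rho> c d"
  shows "p_convex F G p"
proof -
  obtain q D0 where q: "p < q"
    and D0: "\<And>a. 0 < a \<Longrightarrow> a < 1 \<Longrightarrow> dil_norm F G a \<le> ennreal (D0 * a powr (-1 / q))"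
  proof -
    from boyd obtain q D0 where "p < q"
      "\<forall>a. 0 < a \<and> a < 1 \<longrightarrow> dil_norm F G a \<le> ennreal (D0 * a powr (-1 / q))"
      unfolding lower_boyd_def less_Sup_iff by auto
    then show thesis by (intro that[of q D0]) blast+
  qed
  define D where "D = max D0 1"
  define Dk where "Dk k = D * 2 powr (real k / q)" for k :: nat
  have D: "1 \<le> D" "D0 \<le> D" by (auto simp: D_def)
  have Dk: "1 \<le> Dk k" for k
    using mult_mono[OF D(1), of 1 "2 powr (real k / q)"] D q p by (simp add: Dk_def ge_one_powr_ge_zero)
  define G1 where "G1 = root_scale p G"
  have G1: "phi_function G1" unfolding G1_def by (rule phi_function_root_scale[OF G p])
  define \<theta> where "\<theta> = reparam F G"
  have \<theta>: "0 < \<theta> x" if "0 < x" for x using that by (simp add: \<theta>_def reparam_pos F G)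
  have dilm: "modular G (\<lambda>x. rearr f (\<theta> x / 2 ^ k) / (2 * Dk k * enn2real (lorentz F G f))) \<le> 1"
    if f: "f \<in> LFG F G" for f and k :: nat
  \<comment> \<open>The Boyd bound concerns only \<open>a < 1\<close>, so the undilated term is
    treated directly; \<open>Dk k \<ge> 1\<close> is arranged for this purpose.\<close>
  proof (cases "k = 0")
    case True
    define N where "N = enn2real (lorentz F G f)"
    have N: "0 \<le> N" by (simp add: N_def)
    show ?thesis
    proof (cases "N = 0")
      case z: True
      have "modular G (\<lambda>x. rearr f (\<theta> x / 2 ^ k) / (2 * Dk k * N)) = modular G (\<lambda>x. 0)"
        using z by (intro modular_cong) simp
      then show ?thesis unfolding N_def by (simp add: modular_def phi_zero G)
    next
      case False
      have "N < 2 * Dk k * N" using N False mult_right_mono[OF Dk[of k] N] by (simp add: less_le) 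
      then show ?thesis using LFG_modular[OF F G f, of "2 * Dk k * N"] True by (simp add: N_def \<theta>_def)
    qed
  next
    case False
    define a where "a = (1 / 2 :: real) ^ k"
    have a: "0 < a" "a < 1" using False by (auto simp: a_def power_less_one_iff)
    have "a = 2 powr (- real k)" by (simp add: a_def powr_minus powr_realpow power_one_over divide_simps)
    then have ap: "a powr (-1 / q) = 2 powr (real k / q)" by (simp add: powr_powr)
    have "dil_norm F G a \<le> ennreal (D0 * a powr (-1 / q))" by (rule D0[OF a])
    also have "\<dots> \<le> ennreal (Dk k)" unfolding ap Dk_def using D by (intro ennreal_leI mult_right_mono) auto
    finally have "modular G (\<lambda>x. rearr f (a * reparam F G x) / (2 * Dk k * enn2real (lorentz F G f))) \<le> 1"
      using Dk[of k] by (intro dil_norm_modular[OF F G f a(1)]) auto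
    then show ?thesis by (simp add: a_def \<theta>_def power_one_over)
  qed
  define \<beta>k where "\<beta>k k = (2 * Dk k) powr p / 2 ^ k" for k
  have \<beta>k0: "0 \<le> \<beta>k k" for k by (simp add: \<beta>k_def)
  have \<beta>s: "summable \<beta>k"
  proof -
    have eq: "\<beta>k = (\<lambda>k. (2 * D) powr p * (2 powr (p / q - 1)) ^ k)"
    proof
      fix k
      have "(2 * Dk k) powr p = (2 * D) powr p * 2 powr (real k * (p / q))"
        using D by (simp add: Dk_def powr_mult powr_powr mult_ac)
      moreover have "(2 powr (p / q - 1)) ^ k = 2 powr (real k * (p / q)) / 2 ^ k"
        by (simp add: powr_realpow[symmetric] powr_powr powr_diff[symmetric] algebra_simps)
      ultimately show "\<beta>k k = (2 * D) powr p * (2 powr (p / q - 1)) ^ k" by (simp add: \<beta>k_def)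
    qed
    have "2 powr (p / q - 1) < (1::real)" using q p powr_less_mono[of "p / q - 1" 0 2] by simp
    then show ?thesis unfolding eq by (intro summable_mult summable_geometric) simp
  qed
  obtain C where C: "1 \<le> C" and ser: "\<And>(f :: nat \<Rightarrow> real \<Rightarrow> real) b.
      (\<And>k x. 0 < x \<Longrightarrow> 0 \<le> f k x) \<Longrightarrow>
      (\<And>k x y. 0 < x \<Longrightarrow> x \<le> y \<Longrightarrow> f k y \<le> f k x) \<Longrightarrow>
      (\<And>k. 0 \<le> b k) \<Longrightarrow> (\<And>k x. b k = 0 \<Longrightarrow> 0 < x \<Longrightarrow> f k x = 0) \<Longrightarrow>
      (\<And>k. modular G1 (\<lambda>x. f k x / b k) \<le> 1) \<Longrightarrow> summable b \<Longrightarrow>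
      (\<forall>x>0. summable (\<lambda>k. f k x)) \<and> modular G1 (\<lambda>x. (\<Sum>k. f k x) / (C * suminf b)) \<le> 1"
    by (rule J_setting.modular_series[OF J, folded G1_def]) blast
  define \<beta> where "\<beta> = suminf \<beta>k"
  have \<beta>: "0 < \<beta>" unfolding \<beta>_def using Dk[of 0] by (intro suminf_pos2[OF \<beta>s \<beta>k0, of 0]) (simp add: \<beta>k_def)
  show ?thesis
    unfolding p_convex_def
  proof (intro exI allI impI)
    fix n :: nat and fs :: "nat \<Rightarrow> real \<Rightarrow> real" assume fs: "\<forall>i<n. fs i \<in> LFG F G"
    define N where "N i = enn2real (lorentz F G (fs i))" for i
    have N0: "0 \<le> N i" for i by (simp add: N_def)
    define \<phi> where "\<phi> i k x = rearr (fs i) (\<theta> x / 2 ^ k) powr p / 2 ^ k" for i k x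
    have bdd: "bdd_above (level_set (fs i) x)" if "i < n" "0 < x" for i x
      using LFG_bdd[of "fs i" F G x] fs that by simp
    have \<phi>0: "0 \<le> \<phi> i k x" for i k x by (simp add: \<phi>_def)
    have \<phi>dec: "\<phi> i k y \<le> \<phi> i k x" if "i < n" "0 < x" "x \<le> y" for i k x y
      unfolding \<phi>_def using rearr_reparam_decreasing[OF F G bdd[OF that(1)], of "1 / 2 ^ k" x y] that p \<theta>[of y]
      by (intro divide_right_mono powr_mono2) (auto simp: \<theta>_def intro!: rearr_nonneg bdd)
    have \<phi>z: "\<phi> i k x = 0" if "i < n" "N i = 0" "0 < x" for i k x
      using LFG_zero_rearr[OF F G, of "fs i" "\<theta> x / 2 ^ k"] fs that \<theta>[of x] by (simp add: \<phi>_def N_def)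
    have \<phi>m: "modular G1 (\<lambda>x. \<phi> i k x / (\<beta>k k * N i powr p)) \<le> 1" if "i < n" for i k
    proof -
      have "modular G1 (\<lambda>x. \<phi> i k x / (\<beta>k k * N i powr p)) = modular G (\<lambda>x. rearr (fs i) (\<theta> x / 2 ^ k) / (2 * Dk k * N i))"
        unfolding modular_def
      proof (rule nn_integral_cong)
        fix x :: real
        show "ennreal (G1 (\<phi> i k x / (\<beta>k k * N i powr p))) * indicator {0<..} x =
            ennreal (G (rearr (fs i) (\<theta> x / 2 ^ k) / (2 * Dk k * N i))) * indicator {0<..} x"
        proof (cases "0 < x")
          case True
          have "\<phi> i k x / (\<beta>k k * N i powr p) = rearr (fs i) (\<theta> x / 2 ^ k) powr p / (2 * Dk k * N i) powr p"
            using Dk[of k] N0 by (simp add: \<phi>_def \<beta>k_def powr_mult)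
          moreover have "0 \<le> 2 * Dk k * N i" using Dk[of k] N0 by simp
          ultimately show ?thesis
            using root_scale_powr_divide[of "rearr (fs i) (\<theta> x / 2 ^ k)" "2 * Dk k * N i" p G]
              rearr_nonneg[OF bdd[OF that]] \<theta>[OF True] p by (simp add: G1_def)
        qed simp
      qed
      then show ?thesis using dilm[of "fs i" k] fs that by (simp add: N_def)
    qed
    \<comment> \<open>Padding with zeros turns the finite family into a series, so that
      \<open>ser\<close> applies a second time.\<close>
    define \<Phi> where "\<Phi> i x = (if i < n then \<Sum>k. \<phi> i k x else 0)" for i x
    define B where "B i = (if i < n then C * (\<beta> * N i powr p) else 0)" for i
    have ser1: "(\<forall>x>0. summable (\<lambda>k. \<phi> i k x)) \<and> modular G1 (\<lambda>x. (\<Sum>k. \<phi> i k x) / (C * (\<beta> * N i powr p))) \<le> 1"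
      if i: "i < n" for i
    proof -
      have sb: "suminf (\<lambda>k. \<beta>k k * N i powr p) = \<beta> * N i powr p"
        unfolding \<beta>_def by (rule suminf_mult2[OF \<beta>s, symmetric])
      show ?thesis unfolding sb[symmetric]
      proof (rule ser)
        show "\<phi> i k x = 0" if "\<beta>k k * N i powr p = 0" "0 < x" for k x
        proof -
          have "\<beta>k k \<noteq> 0" using Dk[of k] by (simp add: \<beta>k_def)
          then show ?thesis using that \<phi>z[OF i] by simp
        qed
      qed (use i \<phi>0 \<phi>dec \<phi>m \<beta>k0 \<beta>s in \<open>auto intro: summable_mult2\<close>)
    qed
    have \<phi>s: "summable (\<lambda>k. \<phi> i k x)" if "i < n" "0 < x" for i x using ser1 that by blast
    have \<Phi>0: "0 \<le> \<Phi> i x" if "0 < x" for i x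
      using \<phi>s \<phi>0 that by (auto simp: \<Phi>_def intro!: suminf_nonneg)
    have Bsum: "suminf B = C * \<beta> * (\<Sum>i<n. N i powr p)" "summable B"
      using suminf_finite[of "{..<n}" B] summable_finite[of "{..<n}" B]
      by (auto simp: B_def sum_distrib_left mult_ac)
    have "modular G1 (\<lambda>x. (\<Sum>i. \<Phi> i x) / (C * suminf B)) \<le> 1"
    proof (rule conjunct2[OF ser])
      show "\<Phi> i y \<le> \<Phi> i x" if "0 < x" "x \<le> y" for i x y
        using \<phi>s \<phi>dec that by (auto simp: \<Phi>_def intro!: suminf_le)
      show "0 \<le> B i" for i using C \<beta> by (simp add: B_def)
      show "\<Phi> i x = 0" if "B i = 0" "0 < x" for i x
        using that C \<beta> \<phi>z[of i x] by (auto simp: B_def \<Phi>_def split: if_splits)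
      show "modular G1 (\<lambda>x. \<Phi> i x / B i) \<le> 1" for i
        using ser1[of i] by (cases "i < n") (auto simp: \<Phi>_def B_def modular_def phi_zero G1)
    qed (use \<Phi>0 Bsum in auto)
    moreover have "(\<Sum>i. \<Phi> i x) = (\<Sum>i<n. \<Phi> i x)" for x
      by (rule suminf_finite) (auto simp: \<Phi>_def)
    ultimately have m: "modular G1 (\<lambda>x. (\<Sum>i<n. \<Phi> i x) / (C * suminf B)) \<le> 1" by simp
    define f where "f x = (\<Sum>i<n. \<bar>fs i x\<bar> powr p) powr (1 / p)" for x
    have lev: "t \<le> (2 * (\<Sum>i<n. \<Phi> i x)) powr (1 / p)" if t: "t \<in> level_set f (\<theta> x)" and x: "0 < x" for t x
    proof (cases "0 < t")
      case True
      have "t powr p \<le> (\<Sum>i<n. 2 * (\<Sum>k. rearr (fs i) (\<theta> x / 2 ^ k) powr p / 2 ^ k))"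
      proof (rule level_of_sum_le[where u = "\<lambda>i y. \<bar>fs i y\<bar> powr p" and x = "\<theta> x"])
        fix i assume i: "i < n"
        have [measurable]: "fs i \<in> borel_measurable borel"
          using LFG_measurable[of "fs i" F G] fs i by simp
        show "(\<lambda>y. \<bar>fs i y\<bar> powr p) \<in> borel_measurable borel" by measurable
        show "summable (\<lambda>k. rearr (fs i) (\<theta> x / 2 ^ k) powr p / 2 ^ k)"
          using \<phi>s[OF i x] by (simp add: \<phi>_def)
        fix k
        have rb: "bdd_above (level_set (fs i) (\<theta> x / 2 ^ k))" using bdd[OF i] \<theta>[OF x] by simp
        have "{y \<in> {0..}. rearr (fs i) (\<theta> x / 2 ^ k) powr p < \<bar>fs i y\<bar> powr p} =
          {y \<in> {0..}. rearr (fs i) (\<theta> x / 2 ^ k) < \<bar>fs i y\<bar>}"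
          using rearr_nonneg[OF rb] p phi_less_iff[OF phi_function_powr[OF p]] by auto
        then show "emeasure lborel {y \<in> {0..}. rearr (fs i) (\<theta> x / 2 ^ k) powr p < \<bar>fs i y\<bar> powr p} \<le> ennreal (\<theta> x / 2 ^ k)"
          using emeasure_above_rearr[OF _ rb] LFG_measurable[of "fs i" F G] fs i by simp
      next
        have "t powr p \<le> s \<longleftrightarrow> t \<le> \<bar>s powr (1 / p)\<bar>" if "0 \<le> s" for s
          using phi_le_iff[OF phi_function_powr[OF p], of t "s powr (1 / p)"] True that p by (simp add: powr_powr)
        then have "{y \<in> {0..}. t powr p \<le> (\<Sum>i<n. \<bar>fs i y\<bar> powr p)} = {y \<in> {0..}. t \<le> \<bar>f y\<bar>}"
          by (auto simp: f_def sum_nonneg)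
        then show "ennreal (\<theta> x) \<le> emeasure lborel {y \<in> {0..}. t powr p \<le> (\<Sum>i<n. \<bar>fs i y\<bar> powr p)}"
          using t by (simp add: level_set_def)
      qed (use \<theta>[OF x] in auto)
      also have "\<dots> = 2 * (\<Sum>i<n. \<Phi> i x)" by (simp add: \<Phi>_def \<phi>_def sum_distrib_left)
      finally have "(t powr p) powr (1 / p) \<le> (2 * (\<Sum>i<n. \<Phi> i x)) powr (1 / p)"
        using p by (intro powr_mono2) auto
      then show ?thesis using True p by (simp add: powr_powr)
    next
      case False
      then show ?thesis by (metis linorder_not_less order_trans powr_ge_zero)
    qed
    have fb: "bdd_above (level_set f z)" if z: "0 < z" for z
    proof -
      obtain x where "0 < x" "\<theta> x = z" using reparam_surj[OF F G z] unfolding \<theta>_def by blast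
      then show ?thesis using lev[of _ x] by (auto simp: bdd_above_def)
    qed
    have rf: "rearr f (\<theta> x) \<le> (2 * (\<Sum>i<n. \<Phi> i x)) powr (1 / p)" if "0 < x" for x
      by (rule rearr_le) (rule lev[OF _ that])
    \<comment> \<open>The 2 is the factor of the layer bound in \<open>lev\<close>; the rest is the
      scale delivered by \<open>ser\<close>.\<close>
    define A where "A = 2 * (C * suminf B)"
    have A: "A = (2 * C * C * \<beta>) * (\<Sum>i<n. N i powr p)" by (simp add: A_def Bsum)
    have "lorentz F G f \<le> ennreal (A powr (1 / p))"
    proof (cases "A = 0")
      case True
      then have "(\<Sum>i<n. N i powr p) = 0" using A C \<beta> by simp
      then have "\<forall>i<n. N i = 0" by (subst (asm) sum_nonneg_eq_0_iff) auto
      then have "\<Phi> i x = 0" if "0 < x" for i x using \<phi>z that by (simp add: \<Phi>_def)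
      then have r0: "rearr f (\<theta> x) = 0" if "0 < x" for x
        using rf[OF that] rearr_nonneg[OF fb[OF \<theta>[OF that]]] that by simp
      have "lorentz F G f \<le> ennreal e" if "0 < e" for e
      proof (rule lorentz_le[OF G fb F that])
        have "modular G (\<lambda>x. rearr f (reparam F G x) / e) = modular G (\<lambda>x. 0)"
          using r0 by (intro modular_cong) (simp add: \<theta>_def)
        then show "modular G (\<lambda>x. rearr f (reparam F G x) / e) \<le> 1" by (simp add: modular_def phi_zero G)
      qed
      then have "lorentz F G f \<le> 0 + ennreal e" if "0 < e" for e using that by simp
      then have "lorentz F G f \<le> 0" by (rule ennreal_le_epsilon) auto
      then show ?thesis by simp
    next
      case False
      have A0: "0 < A" using False C \<beta> unfolding A by (simp add: less_le sum_nonneg)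
      show ?thesis
      proof (rule lorentz_le[OF G fb F])
        show "0 < A powr (1 / p)" using A0 by simp
        have "modular G (\<lambda>x. rearr f (reparam F G x) / A powr (1 / p)) \<le> modular G (\<lambda>x. ((\<Sum>i<n. \<Phi> i x) / (C * suminf B)) powr (1 / p))"
        proof (rule modular_mono[OF G])
          fix x :: real assume x: "0 < x"
          show "0 \<le> rearr f (reparam F G x) / A powr (1 / p)"
            using rearr_nonneg[OF fb[OF \<theta>[OF x]]] by (simp add: \<theta>_def)
          have "rearr f (\<theta> x) / A powr (1 / p) \<le> (2 * (\<Sum>i<n. \<Phi> i x)) powr (1 / p) / A powr (1 / p)"
            by (intro divide_right_mono rf[OF x]) auto
          also have "\<dots> = (2 * (\<Sum>i<n. \<Phi> i x) / A) powr (1 / p)"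
            by (simp add: powr_divide)
          also have "2 * (\<Sum>i<n. \<Phi> i x) / A = (\<Sum>i<n. \<Phi> i x) / (C * suminf B)" by (simp add: A_def)
          finally show "rearr f (reparam F G x) / A powr (1 / p) \<le> ((\<Sum>i<n. \<Phi> i x) / (C * suminf B)) powr (1 / p)"
            by (simp add: \<theta>_def)
        qed
        also have "\<dots> = modular G1 (\<lambda>x. (\<Sum>i<n. \<Phi> i x) / (C * suminf B))"
          by (simp add: modular_def G1_def root_scale_def)
        finally show "modular G (\<lambda>x. rearr f (reparam F G x) / A powr (1 / p)) \<le> 1" using m by simp
      qed
    qed
    also have "A powr (1 / p) = (2 * C * C * \<beta>) powr (1 / p) * (\<Sum>i<n. N i powr p) powr (1 / p)"
      unfolding A by (simp add: powr_mult)
    finally show "lorentz F G (\<lambda>x. (\<Sum>i<n. \<bar>fs i x\<bar> powr p) powr (1 / p))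
        \<le> ennreal ((2 * C * C * \<beta>) powr (1 / p) * (\<Sum>i<n. enn2real (lorentz F G (fs i)) powr p) powr (1 / p))"
      by (simp add: f_def[abs_def] N_def)
  qed
qed

section \<open>Disjoint equimeasurable copies and the Boyd index\<close>

lemma lux_mono:
  assumes "phi_function G" "\<And>x. 0 < x \<Longrightarrow> \<bar>f x\<bar> \<le> \<bar>g x\<bar>"
  shows "lux G f \<le> lux G g"
  unfolding lux_def lux_integral_eq_modular
proof (rule Inf_superset_mono, safe)
  fix c :: real assume c: "0 < c" "modular G (\<lambda>x. \<bar>g x\<bar> / c) \<le> 1"
  have "modular G (\<lambda>x. \<bar>f x\<bar> / c) \<le> modular G (\<lambda>x. \<bar>g x\<bar> / c)"
    using assms c by (intro modular_mono) (auto intro: divide_right_mono)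
  then show "\<exists>ca. ennreal c = ennreal ca \<and> 0 < ca \<and> modular G (\<lambda>x. \<bar>f x\<bar> / ca) \<le> 1"
    using c by auto
qed

lemma lorentz_mono:
  assumes "phi_function F" "phi_function G" "\<And>x. 0 < x \<Longrightarrow> level_set f x \<subseteq> level_set g x"
  shows "lorentz F G f \<le> lorentz F G g"
proof (cases "\<forall>x>0. bdd_above (level_set g x)")
  case True
  then have f: "\<forall>x>0. bdd_above (level_set f x)" using assms(3) by (meson bdd_above_mono)
  have "lux G (\<lambda>x. rearr f (tilde F (phi_inv (tilde G) x))) \<le> lux G (\<lambda>x. rearr g (tilde F (phi_inv (tilde G) x)))"
  proof (rule lux_mono[OF assms(2)])
    fix x :: real assume x: "0 < x"
    then have "0 < tilde F (phi_inv (tilde G) x)" using assms by (simp add: tilde_phi_inv_tilde reparam_pos)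
    then show "\<bar>rearr f (tilde F (phi_inv (tilde G) x))\<bar> \<le> \<bar>rearr g (tilde F (phi_inv (tilde G) x))\<bar>"
      using True f assms(3) rearr_mono[of g _ f] by (auto simp: rearr_nonneg)
  qed
  then show ?thesis using True f by (simp add: lorentz_def)
next
  case False
  then have "lorentz F G g = \<infinity>" unfolding lorentz_def by (rule if_not_P)
  then show ?thesis by simp
qed

lemma emeasure_translate:
  fixes b :: real
  assumes "B \<in> sets borel"
  shows "emeasure lborel {x. b + x \<in> B} = emeasure lborel B"
proof -
  have "emeasure lborel B = emeasure (distr lborel borel ((+) b)) B"
    by (simp add: lborel_distr_plus)
  also have "\<dots> = emeasure lborel {x. b + x \<in> B}"
    using assms by (subst emeasure_distr) (auto simp: vimage_def)
  finally show ?thesis by simp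
qed

text \<open>Cutting the half-line into unit intervals and spreading every \<open>n\<close>-th of them out
  produces \<open>n\<close> disjoint equimeasurable copies of a function.\<close>

definition unit_spread :: "nat \<Rightarrow> real \<Rightarrow> real" where
  "unit_spread n x = of_int (\<lfloor>x\<rfloor> div int n) + frac x"

definition spread_copy :: "nat \<Rightarrow> (real \<Rightarrow> real) \<Rightarrow> nat \<Rightarrow> real \<Rightarrow> real" where
  "spread_copy n f i x = (if 0 \<le> x \<and> \<lfloor>x\<rfloor> mod int n = int i then f (unit_spread n x) else 0)"

lemma unit_spread_measurable[measurable]: "unit_spread n \<in> borel_measurable borel"
proof -
  have [measurable]: "(\<lambda>x::real. \<lfloor>x\<rfloor>) \<in> borel \<rightarrow>\<^sub>M count_space UNIV" by measurable
  have "(\<lambda>x::real. real_of_int (\<lfloor>x\<rfloor> div int n)) \<in> borel_measurable borel"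
    by (rule measurable_compose[where N = "count_space UNIV"]) measurable
  then show ?thesis unfolding unit_spread_def[abs_def] frac_def by measurable
qed

lemma spread_copy_measurable:
  assumes [measurable]: "f \<in> borel_measurable borel"
  shows "spread_copy n f i \<in> borel_measurable borel"
proof -
  have [measurable]: "(\<lambda>x::real. \<lfloor>x\<rfloor>) \<in> borel \<rightarrow>\<^sub>M count_space UNIV" by measurable
  have [measurable]: "Measurable.pred borel (\<lambda>x::real. \<lfloor>x\<rfloor> mod int n = int i)"
    by (rule measurable_compose[where N = "count_space UNIV"]) measurable
  show ?thesis unfolding spread_copy_def[abs_def] by measurable
qed

text \<open>On the unit cell starting at \<open>n * m + i\<close> the map is a translation onto the
  cell starting at \<open>m\<close>, so the set is a disjoint union of translated pieces of
  \<open>A\<close>.\<close>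

lemma emeasure_unit_spread:
  assumes A[measurable]: "A \<in> sets borel" and A0: "A \<subseteq> {0..}" and i: "i < n"
  shows "emeasure lborel {x. 0 \<le> x \<and> \<lfloor>x\<rfloor> mod int n = int i \<and> unit_spread n x \<in> A} = emeasure lborel A"
proof -
  define B where "B m = A \<inter> {real m..<real m + 1}" for m
  define S where "S m = {x. (real m - real (n * m + i)) + x \<in> B m}" for m
  have Bm[measurable]: "B m \<in> sets borel" for m by (simp add: B_def)
  have Sm[measurable]: "S m \<in> sets borel" for m unfolding S_def by measurable
  have fl: "\<lfloor>x\<rfloor> = int (n * m + i)" if "x \<in> S m" for m x
    using that by (auto simp: S_def B_def floor_eq_iff)
  have dS: "disjoint_family S"
    unfolding disjoint_family_on_def
  proof (intro ballI impI)
    fix m m' :: nat assume "m \<noteq> m'"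
    then have "int (n * m + i) \<noteq> int (n * m' + i)" using i by auto
    then show "S m \<inter> S m' = {}" using fl[of _ m] fl[of _ m'] by (metis disjoint_iff)
  qed
  have dB: "disjoint_family B"
    unfolding disjoint_family_on_def
  proof (intro ballI impI)
    fix m m' :: nat assume mm: "m \<noteq> m'"
    show "B m \<inter> B m' = {}"
    proof (rule ccontr)
      assume "B m \<inter> B m' \<noteq> {}"
      then obtain x where "real m \<le> x" "x < real m + 1" "real m' \<le> x" "x < real m' + 1"
        by (auto simp: B_def)
      then have "real m < real m' + 1" "real m' < real m + 1" by linarith+
      then show False using mm by linarith
    qed
  qed
  have UB: "(\<Union>m. B m) = A"
  proof
    show "A \<subseteq> (\<Union>m. B m)"
    proof
      fix x assume x: "x \<in> A"
      then have "0 \<le> x" using A0 by auto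
      then have "x \<in> B (nat \<lfloor>x\<rfloor>)" using x by (simp add: B_def)
      then show "x \<in> (\<Union>m. B m)" by blast
    qed
  qed (auto simp: B_def)
  have US: "(\<Union>m. S m) = {x. 0 \<le> x \<and> \<lfloor>x\<rfloor> mod int n = int i \<and> unit_spread n x \<in> A}"
  proof (intro equalityI subsetI)
    fix x assume "x \<in> (\<Union>m. S m)"
    then obtain m where m: "x \<in> S m" by blast
    have dm: "\<lfloor>x\<rfloor> div int n = int m" "\<lfloor>x\<rfloor> mod int n = int i"
      using fl[OF m] i by (auto simp flip: zdiv_int zmod_int of_nat_mult of_nat_add)
    have "unit_spread n x = (real m - real (n * m + i)) + x"
      by (simp only: unit_spread_def dm(1) frac_def) (simp add: fl[OF m])
    moreover have "0 \<le> \<lfloor>x\<rfloor>" using fl[OF m] by simp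
    ultimately show "x \<in> {x. 0 \<le> x \<and> \<lfloor>x\<rfloor> mod int n = int i \<and> unit_spread n x \<in> A}"
      using m dm by (simp add: S_def B_def)
  next
    fix x assume x: "x \<in> {x. 0 \<le> x \<and> \<lfloor>x\<rfloor> mod int n = int i \<and> unit_spread n x \<in> A}"
    define m where "m = nat (\<lfloor>x\<rfloor> div int n)"
    have m: "\<lfloor>x\<rfloor> div int n = int m" using x i by (simp add: m_def pos_imp_zdiv_nonneg_iff)
    have "\<lfloor>x\<rfloor> = int n * (\<lfloor>x\<rfloor> div int n) + \<lfloor>x\<rfloor> mod int n" by simp
    then have fx: "\<lfloor>x\<rfloor> = int (n * m + i)" using x m by simp
    have us: "unit_spread n x = (real m - real (n * m + i)) + x"
      by (simp only: unit_spread_def m frac_def) (simp add: fx)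
    have "unit_spread n x \<in> B m"
      using x frac_ge_0[of x] frac_lt_1[of x] by (simp add: B_def unit_spread_def m)
    then have "x \<in> S m" unfolding us by (simp add: S_def)
    then show "x \<in> (\<Union>m. S m)" by blast
  qed
  have "emeasure lborel (\<Union>m. S m) = (\<Sum>m. emeasure lborel (S m))"
    using dS by (intro suminf_emeasure[symmetric]) auto
  also have "\<dots> = (\<Sum>m. emeasure lborel (B m))"
    by (simp add: S_def emeasure_translate)
  also have "\<dots> = emeasure lborel (\<Union>m. B m)"
    using dB by (intro suminf_emeasure) auto
  finally show ?thesis by (simp add: UB US)
qed

text \<open>The \<open>p\<close>-sum of \<open>n\<close> disjoint copies of \<open>f\<close> has
  superlevel sets \<open>n\<close> times as large as those of \<open>f\<close>, so for
  \<open>n \<ge> 1 / a\<close> its rearrangement dominates that of \<open>dil a f\<close>. By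
  p-convexity its functional exceeds that of \<open>f\<close> at most by a constant times
  \<open>n powr (1 / p)\<close>, and \<open>n \<le> 2 / a\<close>.\<close>

lemma lower_boyd_ge_of_p_convex:
  assumes F: "phi_function F" and G: "phi_function G" and p: "0 < p" and pc: "p_convex F G p"
  shows "ereal p \<le> lower_boyd F G"
proof -
  obtain C0 where C0: "\<And>n (fs :: nat \<Rightarrow> real \<Rightarrow> real). (\<forall>i<n. fs i \<in> LFG F G) \<Longrightarrow>
      lorentz F G (\<lambda>x. (\<Sum>i<n. \<bar>fs i x\<bar> powr p) powr (1 / p))
        \<le> ennreal (C0 * (\<Sum>i<n. enn2real (lorentz F G (fs i)) powr p) powr (1 / p))"
    using pc unfolding p_convex_def by blast
  define C where "C = max C0 0"
  have C: "C0 \<le> C" "0 \<le> C" by (auto simp: C_def)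
  have "dil_norm F G a \<le> ennreal (C * 2 powr (1 / p) * a powr (-1 / p))" if a: "0 < a" "a < 1" for a
    unfolding dil_norm_def
  proof (rule SUP_least, safe)
    fix f assume f: "f \<in> LFG F G" and f0: "0 < lorentz F G f"
    have fm[measurable]: "f \<in> borel_measurable borel" using LFG_measurable[OF f] by simp
    define N where "N = enn2real (lorentz F G f)"
    have lN: "lorentz F G f = ennreal N" using f by (simp add: LFG_def N_def)
    have N: "0 < N" using f0 lN by simp
    define n where "n = nat \<lceil>1 / a\<rceil>"
    have n1: "1 / a \<le> real n" by (simp add: n_def real_nat_ceiling_ge)
    have "1 < 1 / a" using a by simp
    then have n2: "real n \<le> 2 / a" and n0: "0 < n" using n1 unfolding n_def by linarith+
    let ?A = "\<lambda>t. {y \<in> {0..}. t \<le> \<bar>f y\<bar>}"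
    have Am: "?A t \<in> sets borel" for t by measurable
    define fs where "fs = spread_copy n f"
    have copy: "emeasure lborel {y \<in> {0..}. t \<le> \<bar>fs i y\<bar>} = emeasure lborel (?A t)" if "i < n" "0 < t" for i t
    proof -
      have us0: "0 \<le> unit_spread n x" if "0 \<le> x" for x
        using that by (simp add: unit_spread_def pos_imp_zdiv_nonneg_iff n0)
      have "{y \<in> {0..}. t \<le> \<bar>fs i y\<bar>} = {x. 0 \<le> x \<and> \<lfloor>x\<rfloor> mod int n = int i \<and> unit_spread n x \<in> ?A t}"
        using that us0 by (auto simp: fs_def spread_copy_def)
      then show ?thesis using emeasure_unit_spread[OF Am _ that(1), of t] by auto
    qed
    have le: "lorentz F G (fs i) \<le> lorentz F G f" if "i < n" for i
      using copy[OF that] by (intro lorentz_mono[OF F G] level_set_mono) simp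
    have LFG: "fs i \<in> LFG F G" if "i < n" for i
      using le[OF that] f spread_copy_measurable[OF fm, of n i]
      by (auto simp: LFG_def fs_def intro: le_less_trans)
    define S where "S x = (\<Sum>i<n. \<bar>fs i x\<bar> powr p) powr (1 / p)" for x
    have S: "S x = \<bar>f (unit_spread n x)\<bar>" if x: "0 \<le> x" for x
    proof -
      define j where "j = nat (\<lfloor>x\<rfloor> mod int n)"
      have j: "j < n" "\<lfloor>x\<rfloor> mod int n = int j"
        using n0 by (auto simp: j_def nat_less_iff)
      have "(\<Sum>i<n. \<bar>fs i x\<bar> powr p) = (\<Sum>i<n. if i = j then \<bar>f (unit_spread n x)\<bar> powr p else 0)"
        using x j by (intro sum.cong) (auto simp: fs_def spread_copy_def)
      also have "\<dots> = \<bar>f (unit_spread n x)\<bar> powr p" using j by simp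
      finally show ?thesis using p by (simp add: S_def powr_powr)
    qed
    have "level_set (dil a f) x \<subseteq> level_set S x" if x: "0 < x" for x
    proof
      fix t assume "t \<in> level_set (dil a f) x"
      then have t: "t \<in> level_set f (a * x)" using level_set_dil[OF a(1) LFG_measurable[OF f]] by simp
      show "t \<in> level_set S x"
      proof (cases "0 < t")
        case True
        let ?D = "\<lambda>i. {x. 0 \<le> x \<and> \<lfloor>x\<rfloor> mod int n = int i \<and> unit_spread n x \<in> ?A t}"
        have eq: "{y \<in> {0..}. t \<le> \<bar>fs i y\<bar>} = ?D i" for i
          using True by (auto simp: fs_def spread_copy_def unit_spread_def pos_imp_zdiv_nonneg_iff n0)
        have Dm: "?D i \<in> sets borel" for i
        proof -
          have [measurable]: "fs i \<in> borel_measurable borel" unfolding fs_def by (rule spread_copy_measurable[OF fm])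
          show ?thesis unfolding eq[symmetric] by measurable
        qed
        have "ennreal x \<le> ennreal (real n * (a * x))"
          using n1 a x mult_right_mono[of 1 "real n * a" x] by (intro ennreal_leI) (simp add: field_simps)
        also have "\<dots> = real n * ennreal (a * x)" using a x by (simp add: ennreal_mult)
        also have "\<dots> \<le> real n * emeasure lborel (?A t)" using t by (intro mult_left_mono) (auto simp: level_set_def)
        also have "\<dots> = (\<Sum>i<n. emeasure lborel (?D i))"
        proof -
          have "(\<Sum>i<n. emeasure lborel (?D i)) = (\<Sum>i<n. emeasure lborel (?A t))"
            unfolding eq[symmetric] using copy True by (intro sum.cong) auto
          then show ?thesis by (simp add: ennreal_of_nat_eq_real_of_nat)
        qed
        also have "\<dots> = emeasure lborel (\<Union>i<n. ?D i)"
          using Dm by (intro sum_emeasure) (auto simp: disjoint_family_on_def)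
        also have "\<dots> \<le> emeasure lborel {y \<in> {0..}. t \<le> \<bar>S y\<bar>}"
        proof (rule emeasure_mono)
          show "(\<Union>i<n. ?D i) \<subseteq> {y \<in> {0..}. t \<le> \<bar>S y\<bar>}" using S by auto
          have [measurable]: "fs i \<in> borel_measurable borel" for i unfolding fs_def by (rule spread_copy_measurable[OF fm])
          have "S \<in> borel_measurable borel" unfolding S_def[abs_def] by measurable
          then show "{y \<in> {0..}. t \<le> \<bar>S y\<bar>} \<in> sets lborel" by measurable
        qed
        finally show ?thesis by (simp add: level_set_def)
      qed (auto intro: level_set_nonpos)
    qed
    then have "lorentz F G (dil a f) \<le> lorentz F G S" by (intro lorentz_mono[OF F G])
    also have "\<dots> \<le> ennreal (C0 * (\<Sum>i<n. enn2real (lorentz F G (fs i)) powr p) powr (1 / p))"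
      unfolding S_def[abs_def] using LFG by (intro C0) auto
    also have "\<dots> \<le> ennreal (C * (2 / a * N powr p) powr (1 / p))"
    proof (intro ennreal_leI mult_mono powr_mono2)
      have "(\<Sum>i<n. enn2real (lorentz F G (fs i)) powr p) \<le> (\<Sum>i<n. N powr p)"
      proof (intro sum_mono powr_mono2)
        fix i assume "i \<in> {..<n}"
        then have "lorentz F G (fs i) \<le> ennreal N" using le lN by simp
        then show "enn2real (lorentz F G (fs i)) \<le> N" using N by (simp add: enn2real_leI)
      qed (use p in auto)
      also have "\<dots> = real n * N powr p" by simp
      also have "\<dots> \<le> 2 / a * N powr p" using n2 by (intro mult_right_mono) auto
      finally show "(\<Sum>i<n. enn2real (lorentz F G (fs i)) powr p) \<le> 2 / a * N powr p" .
    qed (use C p in \<open>auto intro: sum_nonneg\<close>)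
    also have "C * (2 / a * N powr p) powr (1 / p) = C * 2 powr (1 / p) * a powr (-1 / p) * N"
      using p N a by (simp add: powr_mult powr_divide powr_powr powr_minus divide_inverse inverse_powr)
    also have "ennreal (C * 2 powr (1 / p) * a powr (-1 / p) * N) = ennreal (C * 2 powr (1 / p) * a powr (-1 / p)) * ennreal N"
      using C N by (intro ennreal_mult) auto
    finally show "lorentz F G (dil a f) / lorentz F G f \<le> ennreal (C * 2 powr (1 / p) * a powr (-1 / p))"
      unfolding lN using N by (intro divide_le_posI_ennreal) (auto simp: mult.commute)
  qed
  then show ?thesis
    unfolding lower_boyd_def using p by (intro Sup_upper) auto
qed

section \<open>Testing p-convexity on indicator functions\<close>

lemma dyadic_interval_iff:
  assumes "0 < (x::real)"
  shows "x \<in> {2 powr (- of_int k - 1)<..2 powr (- of_int k)} \<longleftrightarrow> k = \<lfloor>- log 2 x\<rfloor>"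
proof -
  have "x \<le> 2 powr (- of_int k) \<longleftrightarrow> log 2 x \<le> - of_int k" using assms by (simp add: log_le_iff)
  moreover have "2 powr (- of_int k - 1) < x \<longleftrightarrow> - of_int k - 1 < log 2 x" using assms by (simp add: less_log_iff)
  ultimately show ?thesis by (auto simp: eq_commute[of k] floor_eq_iff)
qed

text \<open>The test functions have height \<open>t (j k)\<close> on \<open>{0..w k}\<close>.
  Reparametrised, they live up to \<open>2 powr (- k)\<close>, so their functionals are at most
  \<open>t (j k) / t k\<close>. If the sum of the \<open>p\<close>-th powers is small, the combined
  function has modular at most 1, yet it is at least \<open>t (j k)\<close> on the dyadic interval
  ending at \<open>2 powr (- k)\<close>. These intervals are disjoint although the supports are
  nested, and their length is half of \<open>2 powr (- k)\<close>; hence the bound 2.\<close>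

lemma p_convex_levels:
  assumes F: "phi_function F" and G: "phi_function G" and p: "0 < p" and pc: "p_convex F G p"
  defines "T \<equiv> \<lambda>k::int. phi_inv (root_scale p G) (2 powr of_int k)"
  obtains \<delta> where "0 < \<delta>" "\<And>S j. finite S \<Longrightarrow> (\<Sum>k\<in>S. T (j k) / T k) < \<delta> \<Longrightarrow>
    (\<Sum>k\<in>S. 2 powr of_int (j k - k)) \<le> (2::real)"
proof -
  obtain C0 where C0: "\<And>n (fs :: nat \<Rightarrow> real \<Rightarrow> real). (\<forall>i<n. fs i \<in> LFG F G) \<Longrightarrow>
      lorentz F G (\<lambda>x. (\<Sum>i<n. \<bar>fs i x\<bar> powr p) powr (1 / p))
        \<le> ennreal (C0 * (\<Sum>i<n. enn2real (lorentz F G (fs i)) powr p) powr (1 / p))"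
    using pc unfolding p_convex_def by blast
  define C where "C = max C0 1"
  have C: "C0 \<le> C" "1 \<le> C" by (auto simp: C_def)
  define t where "t k = phi_inv G (2 powr of_int k)" for k :: int
  have t: "0 < t k" "G (t k) = 2 powr of_int k" for k by (auto simp: t_def phi_inv_pos phi_inv_props G)
  have Tt: "T k = t k powr p" for k by (simp add: T_def t_def phi_inv_root_scale G p)
  define \<theta> where "\<theta> = reparam F G"
  have \<theta>: "0 < \<theta> x" if "0 < x" for x using that by (simp add: \<theta>_def reparam_pos F G)
  define w where "w k = \<theta> (2 powr (- of_int k))" for k :: int
  have w: "0 < w k" for k by (simp add: w_def \<theta>)
  define g where "g b k x = (if x \<in> {0..w k} then b else 0)" for b x :: real and k
  have lev: "s \<le> b \<and> x \<le> w k" if "s \<in> level_set (g b k) x" "0 < s" "0 < b" "0 < x" for s b k x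
  proof -
    have "{y \<in> {0..}. s \<le> \<bar>g b k y\<bar>} = (if s \<le> b then {0..w k} else {})"
      using that w[of k] by (auto simp: g_def split: if_splits)
    then show ?thesis using that w[of k] unfolding level_set_def
      by (auto split: if_splits simp: ennreal_le_iff)
  qed
  have gb: "bdd_above (level_set (g b k) x)" if "0 < b" "0 < x" for b k x
    using lev[of _ b k x] that by (intro bdd_aboveI[of _ b]) (metis less_imp_le linorder_not_less order_trans)
  have gr: "rearr (g b k) x \<le> (if x \<le> w k then b else 0)" if "0 < b" "0 < x" for b k x
  proof (rule rearr_le)
    fix s assume "s \<in> level_set (g b k) x"
    then show "s \<le> (if x \<le> w k then b else 0)" using lev[of s b k x] that by (cases "0 < s") auto
  qed
  have gl: "lorentz F G (g b k) \<le> ennreal (b / t k)" if b: "0 < b" for b k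
  proof (rule lorentz_le[OF G gb[OF b] F])
    show "0 < b / t k" using b t by simp
    have "modular G (\<lambda>x. rearr (g b k) (reparam F G x) / (b / t k)) \<le>
        (\<integral>\<^sup>+ x. ennreal (2 powr of_int k) * indicator {0..2 powr (- of_int k)} x \<partial>(lborel :: real measure))"
      unfolding modular_def
    proof (rule nn_integral_mono)
      fix x :: real
      show "ennreal (G (rearr (g b k) (reparam F G x) / (b / t k))) * indicator {0<..} x
        \<le> ennreal (2 powr of_int k) * indicator {0..2 powr (- of_int k)} x"
      proof (cases "0 < x")
        case True
        have iff: "\<theta> x \<le> w k \<longleftrightarrow> x \<le> 2 powr (- of_int k)"
          unfolding w_def \<theta>_def using True by (intro reparam_le_iff F G) auto
        have r0: "0 \<le> rearr (g b k) (\<theta> x)" using gb[OF b \<theta>[OF True]] by (rule rearr_nonneg)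
        have r1: "rearr (g b k) (\<theta> x) \<le> (if x \<le> 2 powr (- of_int k) then b else 0)"
          using gr[OF b \<theta>[OF True], of k] iff by simp
        show ?thesis
        proof (cases "x \<le> 2 powr (- of_int k)")
          case x: True
          have "rearr (g b k) (\<theta> x) / (b / t k) \<le> t k" using r1 x b t[of k] by (simp add: field_simps)
          then have "G (rearr (g b k) (\<theta> x) / (b / t k)) \<le> 2 powr of_int k"
            using phi_le_iff[OF G, of "rearr (g b k) (\<theta> x) / (b / t k)" "t k"] r0 b t[of k] by simp
          then show ?thesis using x True by (simp add: \<theta>_def ennreal_leI)
        next
          case False
          then show ?thesis using r0 r1 by (simp add: \<theta>_def phi_zero G)
        qed
      qed simp
    qed
    also have "\<dots> = ennreal (2 powr of_int k * 2 powr (- of_int k))"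
      by (simp add: nn_integral_cmult_indicator ennreal_mult)
    also have "\<dots> = 1" by (simp add: powr_add[symmetric])
    finally show "modular G (\<lambda>x. rearr (g b k) (reparam F G x) / (b / t k)) \<le> 1" .
  qed
  have gL: "g b k \<in> LFG F G" if "0 < b" for b k
    using gl[OF that, of k] unfolding LFG_def g_def by (auto intro: le_less_trans)
  show thesis
  proof
    show "0 < (1 / C) powr p" using C by simp
    fix S :: "int set" and j :: "int \<Rightarrow> int"
    assume S: "finite S" and sm: "(\<Sum>k\<in>S. T (j k) / T k) < (1 / C) powr p"
    obtain e where e: "bij_betw e {0..<card S} S" using ex_bij_betw_nat_finite[OF S] by blast
    define n where "n = card S"
    have e: "bij_betw e {..<n} S" using e by (simp add: n_def atLeast0LessThan)
    define fs where "fs i = g (t (j (e i))) (e i)" for i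
    define f where "f x = (\<Sum>k\<in>S. \<bar>g (t (j k)) k x\<bar> powr p) powr (1 / p)" for x
    have f: "f x = (\<Sum>i<n. \<bar>fs i x\<bar> powr p) powr (1 / p)" for x
      using sum.reindex_bij_betw[OF e, of "\<lambda>k. \<bar>g (t (j k)) k x\<bar> powr p"] by (simp add: f_def fs_def)
    have "lorentz F G f \<le> ennreal (C0 * (\<Sum>i<n. enn2real (lorentz F G (fs i)) powr p) powr (1 / p))"
      unfolding f[abs_def] using t gL by (intro C0) (auto simp: fs_def)
    also have "\<dots> \<le> ennreal (C * (\<Sum>k\<in>S. T (j k) / T k) powr (1 / p))"
    proof (intro ennreal_leI mult_mono powr_mono2)
      have "(\<Sum>i<n. enn2real (lorentz F G (fs i)) powr p) \<le> (\<Sum>i<n. (t (j (e i)) / t (e i)) powr p)"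
      proof (intro sum_mono powr_mono2)
        fix i
        show "enn2real (lorentz F G (fs i)) \<le> t (j (e i)) / t (e i)"
          using gl[OF t(1)] t(1) by (intro enn2real_leI) (auto simp: fs_def less_imp_le)
      qed (use p in auto)
      also have "\<dots> = (\<Sum>k\<in>S. (t (j k) / t k) powr p)"
        by (rule sum.reindex_bij_betw[OF e])
      also have "\<dots> = (\<Sum>k\<in>S. T (j k) / T k)" by (simp add: Tt powr_divide)
      finally show "(\<Sum>i<n. enn2real (lorentz F G (fs i)) powr p) \<le> (\<Sum>k\<in>S. T (j k) / T k)" .
    qed (use C p in \<open>auto intro: sum_nonneg\<close>)
    also have "\<dots> < ennreal 1"
    proof (rule ennreal_lessI)
      have "(\<Sum>k\<in>S. T (j k) / T k) powr (1 / p) < ((1 / C) powr p) powr (1 / p)"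
        using sm p t by (intro powr_less_mono2) (auto simp: Tt intro!: sum_nonneg)
      also have "\<dots> = 1 / C" using C p by (simp add: powr_powr)
      finally show "C * (\<Sum>k\<in>S. T (j k) / T k) powr (1 / p) < 1" using C by (simp add: field_simps)
    qed simp
    finally have l1: "lorentz F G f < ennreal 1" .
    have fb: "bdd_above (level_set f x)" if "0 < x" for x
      using l1 that by (auto simp: lorentz_def split: if_splits)
    have m: "modular G (\<lambda>x. rearr f (\<theta> x)) \<le> 1" using lorentz_less[OF F G l1] by (simp add: \<theta>_def)
    have fg: "t (j k) \<le> f y" if "k \<in> S" "y \<in> {0..w k}" for k y
    proof -
      have "t (j k) powr p = \<bar>g (t (j k)) k y\<bar> powr p" using that t(1)[of "j k"] by (simp add: g_def)
      also have "\<dots> \<le> (\<Sum>k\<in>S. \<bar>g (t (j k)) k y\<bar> powr p)"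
        using S that by (intro member_le_sum) auto
      finally have "(t (j k) powr p) powr (1 / p) \<le> f y" unfolding f_def using p by (intro powr_mono2) auto
      then show ?thesis using p t(1)[of "j k"] by (simp add: powr_powr)
    qed
    have fm: "f \<in> borel_measurable borel" unfolding f_def[abs_def] g_def by measurable
    have rf: "t (j k) \<le> rearr f (\<theta> x)" if k: "k \<in> S" and x: "0 < x" "x \<le> 2 powr (- of_int k)" for k x
    proof (rule le_rearr[OF fb[OF \<theta>[OF x(1)]]])
      have "\<theta> x \<le> w k" unfolding w_def \<theta>_def using x by (subst reparam_le_iff[OF F G]) auto
      then have "ennreal (\<theta> x) \<le> emeasure lborel {0..w k}" using w[of k] by (simp add: ennreal_leI)
      also have "\<dots> \<le> emeasure lborel {y \<in> {0..}. t (j k) \<le> \<bar>f y\<bar>}"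
      proof (rule emeasure_mono)
        show "{0..w k} \<subseteq> {y \<in> {0..}. t (j k) \<le> \<bar>f y\<bar>}" using fg[OF k] by fastforce
        show "{y \<in> {0..}. t (j k) \<le> \<bar>f y\<bar>} \<in> sets lborel" using fm by measurable
      qed
      finally show "t (j k) \<in> level_set f (\<theta> x)" by (simp add: level_set_def)
    qed
    let ?I = "\<lambda>k::int. {2 powr (- of_int k - 1)<..2 powr (- of_int k)} :: real set"
    have eq: "(\<Sum>k\<in>S. 2 powr real_of_int (j k - k)) / 2 = (\<Sum>k\<in>S. 2 powr of_int (j k) * (2 powr (- of_int k) - 2 powr (- of_int k - 1)))"
      unfolding sum_divide_distrib by (intro sum.cong refl) (simp add: powr_diff powr_minus field_simps)
    have "ennreal ((\<Sum>k\<in>S. 2 powr real_of_int (j k - k)) / 2)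
        = (\<Sum>k\<in>S. ennreal (2 powr of_int (j k)) * ennreal (2 powr (- of_int k) - 2 powr (- of_int k - 1)))"
      unfolding eq by (simp add: sum_ennreal[symmetric] ennreal_mult)
    also have "\<dots> = (\<integral>\<^sup>+ x. (\<Sum>k\<in>S. ennreal (2 powr of_int (j k)) * indicator (?I k) x) \<partial>lborel)"
      by (simp add: nn_integral_sum nn_integral_cmult)
    also have "\<dots> \<le> modular G (\<lambda>x. rearr f (\<theta> x))"
      unfolding modular_def
    proof (rule nn_integral_mono)
      fix x :: real
      show "(\<Sum>k\<in>S. ennreal (2 powr of_int (j k)) * indicator (?I k) x) \<le> ennreal (G (rearr f (\<theta> x))) * indicator {0<..} x"
      proof (cases "0 < x")
        case True
        define k0 where "k0 = \<lfloor>- log 2 x\<rfloor>"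
        have ind: "indicator (?I k) x = (if k = k0 then 1 else 0 :: ennreal)" for k
          using dyadic_interval_iff[OF True, of k] by (simp add: k0_def indicator_def)
        have "(\<Sum>k\<in>S. ennreal (2 powr of_int (j k)) * indicator (?I k) x) =
            (\<Sum>k\<in>S. if k = k0 then ennreal (2 powr of_int (j k)) else 0)"
          unfolding ind by (intro sum.cong) auto
        also have "\<dots> = (if k0 \<in> S then ennreal (2 powr of_int (j k0)) else 0)" using S by simp
        also have "\<dots> \<le> ennreal (G (rearr f (\<theta> x)))"
        proof (cases "k0 \<in> S")
          case k: True
          have "x \<le> 2 powr (- of_int k0)" using dyadic_interval_iff[OF True, of k0] by (simp add: k0_def)
          then have "t (j k0) \<le> rearr f (\<theta> x)" using rf[OF k True] by simp
          then have "G (t (j k0)) \<le> G (rearr f (\<theta> x))"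
            using t(1)[of "j k0"] phi_le_iff[OF G, of "t (j k0)" "rearr f (\<theta> x)"] by simp
          then show ?thesis using k t by (simp add: ennreal_leI)
        qed simp
        finally show ?thesis using True by simp
      next
        case False
        have "\<not> 2 powr (- real_of_int k - 1) < x" for k :: int
          using False powr_ge_zero[of 2 "- real_of_int k - 1"] by linarith
        then have "indicator (?I k) x = (0::ennreal)" for k by (simp add: indicator_def)
        then show ?thesis by simp
      qed
    qed
    also note m
    finally show "(\<Sum>k\<in>S. 2 powr of_int (j k - k)) \<le> (2::real)" by simp
  qed
qed

section \<open>Blocks of levels\<close>

lemma int_sequence_bracket:
  fixes X :: "int \<Rightarrow> real"
  assumes "\<exists>i. X i \<le> y" "\<And>m. \<exists>n. y < X (m + int n)"
  obtains i where "X i \<le> y" "y < X (i + 1)"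
proof -
  obtain m where m: "X m \<le> y" using assms(1) by blast
  define n where "n = (LEAST n. y < X (m + int n))"
  have n: "y < X (m + int n)" unfolding n_def by (rule LeastI_ex[OF assms(2)])
  then obtain l where l: "n = Suc l" using m by (cases n) auto
  have "\<not> y < X (m + int l)" using not_less_Least[of l "\<lambda>n. y < X (m + int n)"] l by (simp add: n_def)
  then show thesis using that[of "m + int l"] n l by (simp add: add_ac)
qed

lemma greedy_sequence:
  fixes P :: "nat \<Rightarrow> nat \<Rightarrow> bool"
  assumes "\<And>a. \<exists>b>a. P a b"
  obtains s where "s 0 = 0" "\<And>i. s i < s (Suc i)" "\<And>i. P (s i) (s (Suc i))"
    "\<And>i b. s i < b \<Longrightarrow> b < s (Suc i) \<Longrightarrow> \<not> P (s i) b"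
proof -
  define nxt where "nxt a = (LEAST b. a < b \<and> P a b)" for a
  have nxt: "a < nxt a" "P a (nxt a)" for a
    using LeastI_ex[OF assms[of a]] by (auto simp: nxt_def)
  have least: "\<not> P a b" if "a < b" "b < nxt a" for a b
    using not_less_Least[of b "\<lambda>b. a < b \<and> P a b"] that by (simp add: nxt_def)
  define s where "s = rec_nat 0 (\<lambda>_. nxt)"
  have s: "s 0 = 0" "s (Suc i) = nxt (s i)" for i by (auto simp: s_def)
  show thesis by (rule that[of s]) (use s nxt least in auto)
qed

lemma sum_half_powers_le:
  fixes I :: "nat set"
  assumes "finite I"
  shows "(\<Sum>i\<in>I. (1 / 2) ^ i) \<le> (2::real)"
proof -
  have "(\<Sum>i\<in>I. (1 / 2) ^ i) \<le> (\<Sum>i. (1 / 2 :: real) ^ i)"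
    using assms by (intro sum_le_suminf summable_geometric) auto
  also have "\<dots> = 2" by (simp add: suminf_geometric)
  finally show ?thesis .
qed

lemma strict_mono_int:
  fixes f :: "int \<Rightarrow> 'a :: order"
  assumes "\<And>i. f i < f (i + 1)"
  shows "strict_mono f"
proof (rule strict_monoI)
  fix i j :: int assume "i < j"
  then show "f i < f j"
  proof (induct j rule: int_gr_induct)
    case base show ?case using assms by simp
  next
    case (step j) then show ?case using assms[of j] by (auto intro: less_trans)
  qed
qed

locale level_sequence =
  fixes T :: "int \<Rightarrow> real" and \<delta> :: real
  assumes T_pos: "\<And>k. 0 < T k" and T_mono: "strict_mono T"
    and T_small: "\<And>e. 0 < e \<Longrightarrow> \<exists>n. T (- int n) \<le> e" and T_large: "\<And>e. \<exists>n. e \<le> T (int n)"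
    and \<delta>: "0 < \<delta>" and levels: "\<And>S j. finite S \<Longrightarrow> (\<Sum>k\<in>S. T (j k) / T k) < \<delta> \<Longrightarrow>
      (\<Sum>k\<in>S. 2 powr of_int (j k - k)) \<le> (2::real)"
begin

lemma T_le_iff: "T i \<le> T j \<longleftrightarrow> i \<le> j"
  using T_mono by (rule strict_mono_less_eq)

text \<open>When \<open>T k\<close> is the inverse of \<open>G\<close> at \<open>2 powr k\<close>,
  this is \<open>t / G t\<close> at \<open>t = T k\<close>; a rise of \<open>V\<close> measures the
  failure of \<open>G t / t\<close> to increase.\<close>

definition V :: "int \<Rightarrow> real" where "V k = T k / 2 powr of_int k"

lemma V_pos: "0 < V k"
  by (simp add: V_def T_pos)

lemma T_eq: "T k = V k * 2 powr of_int k"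
  by (simp add: V_def)

text \<open>Take \<open>j k = k - 1\<close> in \<open>levels\<close>: five indices with ratio below
  \<open>\<delta> / 6\<close> would have a ratio sum below \<open>\<delta>\<close> and yet
  contribute \<open>5 / 2\<close>. So only finitely many steps are exceptional, and a maximum covers
  them. In the form \<open>2 * E\<close> the constant \<open>E\<close> bounds one step of
  \<open>V\<close>.\<close>

lemma step_bounded:
  obtains E where "2 \<le> E" "\<And>k. T (k + 1) \<le> 2 * E * T k"
proof -
  let ?B = "{k. T (k - 1) / T k < \<delta> / 6}"
  have fin: "finite ?B"
  proof (rule ccontr)
    assume "infinite ?B"
    then obtain S where S: "S \<subseteq> ?B" "finite S" "card S = 5" using infinite_arbitrarily_large by blast
    have "(\<Sum>k\<in>S. T (k - 1) / T k) \<le> (\<Sum>k\<in>S. \<delta> / 6)"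
      using S by (intro sum_mono) auto
    also have "\<dots> < \<delta>" using S \<delta> by simp
    finally have "(\<Sum>k\<in>S. 2 powr of_int (k - 1 - k)) \<le> (2::real)"
      using levels[OF S(2), of "\<lambda>k. k - 1"] by simp
    then show False using S by (simp add: powr_minus)
  qed
  define E where "E = Max (insert 2 (insert (6 / \<delta>) ((\<lambda>k. T k / T (k - 1)) ` ?B)))"
  have E: "2 \<le> E" "6 / \<delta> \<le> E" "\<And>k. k \<in> ?B \<Longrightarrow> T k / T (k - 1) \<le> E"
    unfolding E_def using fin by (intro Max_ge; force)+
  have step: "T k \<le> E * T (k - 1)" for k
  proof (cases "k \<in> ?B")
    case True
    then show ?thesis using E(3)[OF True] T_pos[of "k - 1"] by (simp add: field_simps)
  next
    case False
    then have "T k \<le> 6 / \<delta> * T (k - 1)" using T_pos[of k] \<delta> by (simp add: field_simps)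
    also have "\<dots> \<le> E * T (k - 1)" using E(2) T_pos[of "k - 1"] by (intro mult_right_mono) auto
    finally show ?thesis .
  qed
  show thesis
  proof (rule that[OF E(1)])
    fix k
    have "T (k + 1) \<le> E * T k" using step[of "k + 1"] by simp
    also have "\<dots> \<le> 2 * E * T k" using E(1) T_pos[of k] by simp
    finally show "T (k + 1) \<le> 2 * E * T k" .
  qed
qed

text \<open>The indices are cut into blocks on each of which \<open>V\<close> rises by a factor of about \<open>A\<close>;
  \<open>levels\<close> then says that the blocks are so long that the ratios of consecutive end points are summable.\<close>

lemma blocks:
  obtains a :: "int \<Rightarrow> int" and B E where "2 \<le> B" "2 \<le> E" "\<And>k. T (k + 1) \<le> 2 * E * T k"
    "strict_mono a" "\<And>i. 2 * B * T (a i) \<le> T (a (i + 1))"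
    "\<And>I. finite I \<Longrightarrow> (\<Sum>i\<in>I. T (a i) / T (a (i + 1))) \<le> 1"
    "\<And>i k l. a i \<le> k \<Longrightarrow> k \<le> l \<Longrightarrow> l \<le> a (i + 1) \<Longrightarrow> V l \<le> B * V k"
proof -
  obtain E where E: "2 \<le> E" "\<And>k. T (k + 1) \<le> 2 * E * T k" using step_bounded by blast
  have V_step: "V (k + 1) \<le> E * V k" for k
    using E(2)[of k] by (simp add: V_def powr_add field_simps)
  have V_steps: "V (k + int m) \<le> E ^ m * V k" for k m
  proof (induct m)
    case (Suc m)
    have "V (k + int (Suc m)) \<le> E * V (k + int m)" using V_step[of "k + int m"] by (simp add: add_ac)
    also have "\<dots> \<le> E * (E ^ m * V k)" using Suc E by simp
    finally show ?case by simp
  qed simp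
  \<comment> \<open>\<open>N1\<close> ensures that a rise of \<open>V\<close> by \<open>A\<close>
    multiplies \<open>T\<close> by at least \<open>2 * B\<close>; \<open>N2\<close> serves the final
    bound \<open>4 / A \<le> 1\<close>, and \<open>N3\<close> the bootstrap against
    \<open>\<delta>\<close>.\<close>
  obtain N1 N2 N3 :: nat where N: "2 * E \<le> 2 ^ N1" "6 \<le> E ^ N2" "4 / \<delta> \<le> E ^ N3"
  proof -
    obtain N1 where "2 * E < 2 ^ N1" using real_arch_pow[of 2 "2 * E"] by auto
    moreover obtain N2 where "6 < E ^ N2" using real_arch_pow[of E 6] E by auto
    moreover obtain N3 where "4 / \<delta> < E ^ N3" using real_arch_pow[of E "4 / \<delta>"] E by auto
    ultimately show thesis using that by (meson less_imp_le)
  qed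
  define N where "N = N1 + N2 + N3"
  define A where "A = E ^ N"
  \<comment> \<open>Before the last step of a block there is no rise by \<open>A\<close>, and one
    step can add at most a factor \<open>E\<close>.\<close>
  define B where "B = A * E"
  have E1: "1 \<le> E" "0 < E" using E by auto
  have A: "6 \<le> A" "4 / \<delta> \<le> A"
    using order_trans[OF N(2) power_increasing[of N2 N E]] order_trans[OF N(3) power_increasing[of N3 N E]] E1
    by (auto simp: A_def N_def)
  have N2E: "2 * E \<le> 2 ^ N" using order_trans[OF N(1) power_increasing[of N1 N 2]] by (simp add: N_def)
  have B: "A \<le> B" using mult_left_mono[OF E1(1), of A] A by (simp add: B_def)
  have B2: "2 \<le> B" using B A by linarith
  define rises where "rises u v \<longleftrightarrow> (\<exists>j k. u \<le> j \<and> j < k \<and> k \<le> v \<and> A * V j \<le> V k)" for u v :: int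
  \<comment> \<open>A rise by \<open>E ^ N\<close> takes \<open>V\<close> at least \<open>N\<close>
    steps, and every step doubles \<open>T k / V k\<close>.\<close>
  have rise_long: "2 * B * T u \<le> T v" if r: "rises u v" for u v
  proof -
    obtain j k where jk: "u \<le> j" "j < k" "k \<le> v" "A * V j \<le> V k" using r by (auto simp: rises_def)
    define m where "m = nat (k - j)"
    have k: "k = j + int m" using jk by (simp add: m_def)
    have "A * V j \<le> E ^ m * V j" using jk(4) V_steps[of j m] k by simp
    then have "E ^ N \<le> E ^ m" using V_pos[of j] by (simp add: A_def)
    then have "N \<le> m" using E by (simp add: power_increasing_iff)
    then have "2 * E \<le> 2 ^ m" using N2E power_increasing[of N m "2::real"] by linarith
    have "2 * B * T u \<le> 2 * B * T j" using jk B B2 by (intro mult_left_mono) (auto simp: T_le_iff)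
    also have "\<dots> = (2 * E) * (A * V j) * 2 powr of_int j" by (simp add: B_def T_eq)
    also have "\<dots> \<le> 2 ^ m * V k * 2 powr of_int j"
      using \<open>2 * E \<le> 2 ^ m\<close> jk(4) A V_pos[of j] by (intro mult_right_mono mult_mono) auto
    also have "\<dots> = T k" by (simp add: T_eq k powr_add powr_realpow)
    also have "\<dots> \<le> T v" using jk by (simp add: T_le_iff)
    finally show ?thesis .
  qed
  \<comment> \<open>The second alternative forces a block to end even if \<open>V\<close> never
    rises by \<open>A\<close>. Its weight \<open>2 ^ u\<close> makes the ratios of such blocks
    summable, because a block cannot start before its own number. \<open>P'\<close> is the mirror
    image for blocks built towards minus infinity.\<close>
  define P where "P u v \<longleftrightarrow> rises (int u) (int v) \<or> 2 * B * 2 ^ u * T (int u) \<le> T (int v)" for u v :: nat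
  define P' where "P' u v \<longleftrightarrow> rises (- int v) (- int u) \<or> 2 * B * 2 ^ u * T (- int v) \<le> T (- int u)" for u v :: nat
  have exP: "\<exists>v>u. P u v" for u
  proof -
    obtain n where "2 * B * 2 ^ u * T (int u) \<le> T (int n)" using T_large by blast
    also have "T (int n) \<le> T (int (max n (Suc u)))" by (simp add: T_le_iff)
    finally show ?thesis by (intro exI[of _ "max n (Suc u)"]) (auto simp: P_def)
  qed
  have exP': "\<exists>v>u. P' u v" for u
  proof -
    have p: "0 < 2 * B * 2 ^ u" using B2 by simp
    obtain n where n: "T (- int n) \<le> T (- int u) / (2 * B * 2 ^ u)"
      using T_small[of "T (- int u) / (2 * B * 2 ^ u)"] T_pos[of "- int u"] p by auto
    have "T (- int (max n (Suc u))) \<le> T (- int n)" by (simp add: T_le_iff)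
    then have "T (- int (max n (Suc u))) \<le> T (- int u) / (2 * B * 2 ^ u)" using n by linarith
    then have "2 * B * 2 ^ u * T (- int (max n (Suc u))) \<le> T (- int u)" using p by (simp add: field_simps)
    then show ?thesis by (intro exI[of _ "max n (Suc u)"]) (auto simp: P'_def)
  qed
  obtain s where s: "s 0 = 0" "\<And>i. s i < s (Suc i)" "\<And>i. P (s i) (s (Suc i))"
    "\<And>i b. s i < b \<Longrightarrow> b < s (Suc i) \<Longrightarrow> \<not> P (s i) b"
    using greedy_sequence[OF exP] by metis
  obtain s' where s': "s' 0 = 0" "\<And>i. s' i < s' (Suc i)" "\<And>i. P' (s' i) (s' (Suc i))"
    "\<And>i b. s' i < b \<Longrightarrow> b < s' (Suc i) \<Longrightarrow> \<not> P' (s' i) b"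
    using greedy_sequence[OF exP'] by metis
  have ge: "i \<le> s i" "i \<le> s' i" for i
    using strict_mono_imp_increasing[of s i] strict_mono_imp_increasing[of s' i] s(2) s'(2)
    by (auto simp: strict_mono_Suc_iff)
  define a where "a i = (if 0 \<le> i then int (s (nat i)) else - int (s' (nat (- i))))" for i
  have a_cases: "(\<exists>n. i = int n \<and> a i = int (s n) \<and> a (i + 1) = int (s (Suc n))) \<or>
      (\<exists>n. i = - int n - 1 \<and> a i = - int (s' (Suc n)) \<and> a (i + 1) = - int (s' n))" for i
  proof (cases "0 \<le> i")
    case True
    then have "i = int (nat i)" "nat (i + 1) = Suc (nat i)" by auto
    then show ?thesis using True by (auto simp: a_def intro!: exI[of _ "nat i"])
  next
    case False
    define n where "n = nat (- i - 1)"
    have i: "i = - int n - 1" using False by (simp add: n_def)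
    have "a (i + 1) = - int (s' n)" using s(1) s'(1) by (cases "n = 0") (auto simp: a_def i)
    moreover have "a i = - int (s' (Suc n))" by (simp add: a_def i nat_add_distrib)
    ultimately show ?thesis using i by blast
  qed
  have a_less: "a i < a (i + 1)" for i using a_cases[of i] s(2) s'(2) by auto
  have a_mono: "strict_mono a" by (rule strict_mono_int) (rule a_less)
  define \<omega> :: "int \<Rightarrow> real" where "\<omega> i = (if 0 \<le> i then (1 / 2) ^ nat i else (1 / 2) ^ nat (- i - 1))" for i
  have alt: "rises (a i) (a (i + 1)) \<or> 2 * B * T (a i) \<le> \<omega> i * T (a (i + 1))" for i
  proof -
    have aux: "2 * B * x \<le> (1 / 2) ^ n * y" if "2 * B * 2 ^ u * x \<le> y" "n \<le> u" "0 < x" for n u :: nat and x y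
    proof -
      have "2 * B * 2 ^ n * x \<le> 2 * B * 2 ^ u * x"
        using that B2 by (intro mult_right_mono mult_left_mono power_increasing) auto
      then have "2 * B * 2 ^ n * x \<le> y" using that by linarith
      then show ?thesis by (simp add: power_one_over field_simps)
    qed
    from a_cases[of i] show ?thesis
    proof (elim disjE exE conjE)
      fix n assume i: "i = int n" "a i = int (s n)" "a (i + 1) = int (s (Suc n))"
      then show ?thesis using s(3)[of n] aux[of "s n" "T (a i)" "T (a (i + 1))" n] ge(1)[of n] T_pos
        by (auto simp: P_def \<omega>_def)
    next
      fix n assume i: "i = - int n - 1" "a i = - int (s' (Suc n))" "a (i + 1) = - int (s' n)"
      then show ?thesis using s'(3)[of n] aux[of "s' n" "T (a i)" "T (a (i + 1))" n] ge(2)[of n] T_pos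
        by (auto simp: P'_def \<omega>_def)
    qed
  qed
  have \<omega>: "0 \<le> \<omega> i" "\<omega> i \<le> 1" for i by (auto simp: \<omega>_def power_le_one)
  have long: "2 * B * T (a i) \<le> T (a (i + 1))" for i
    using alt[of i] rise_long[of "a i" "a (i + 1)"]
      mult_right_mono[OF \<omega>(2)[of i], of "T (a (i + 1))"] T_pos[of "a (i + 1)"] by linarith
  have rise_le: "V l \<le> B * V k" if kl: "a i \<le> k" "k \<le> l" "l \<le> a (i + 1)" for i k l
  proof -
    have B1: "V k \<le> B * V k" using mult_right_mono[of 1 B "V k"] B2 V_pos[of k] by simp
    from a_cases[of i] show ?thesis
    proof (elim disjE exE conjE)
      fix n assume i: "i = int n" "a i = int (s n)" "a (i + 1) = int (s (Suc n))"
      \<comment> \<open>The greedy choice makes the end point the first index at which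
        \<open>P\<close> holds, so there is no rise by \<open>A\<close> before it.\<close>
      have small: "V l' \<le> A * V k" if "k \<le> l'" "l' < int (s (Suc n))" for l'
      proof (cases "k = l'")
        case True
        then show ?thesis using mult_right_mono[of 1 A "V k"] A V_pos[of k] by simp
      next
        case False
        then have "\<not> P (s n) (nat l')" using that kl i by (intro s(4)) auto
        then have "\<not> A * V k \<le> V l'" using False that kl i by (auto simp: P_def rises_def)
        then show ?thesis by simp
      qed
      show ?thesis
      proof (cases "l < int (s (Suc n))")
        case True
        have "V l \<le> A * V k" using small True kl by simp
        also have "\<dots> \<le> B * V k" using B V_pos[of k] by simp
        finally show ?thesis .
      next
        case False
        then have l: "l = int (s (Suc n))" using kl i by simp
        show ?thesis
        proof (cases "k = l")
          case True then show ?thesis using B1 by simp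
        next
          case False
          have "V l \<le> E * V (l - 1)" using V_step[of "l - 1"] by simp
          also have "\<dots> \<le> E * (A * V k)" using small[of "l - 1"] False kl l E1 by (intro mult_left_mono) auto
          finally show ?thesis by (simp add: B_def mult_ac)
        qed
      qed
    next
      fix n assume i: "i = - int n - 1" "a i = - int (s' (Suc n))" "a (i + 1) = - int (s' n)"
      have small: "V l \<le> A * V k'" if "k' \<le> l" "- int (s' (Suc n)) < k'" for k'
      proof (cases "k' = l")
        case True
        then show ?thesis using mult_right_mono[of 1 A "V l"] A V_pos[of l] by simp
      next
        case False
        then have "\<not> P' (s' n) (nat (- k'))" using that kl i by (intro s'(4)) auto
        then have "\<not> A * V k' \<le> V l" using False that kl i by (auto simp: P'_def rises_def)
        then show ?thesis by simp
      qed
      show ?thesis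
      proof (cases "- int (s' (Suc n)) < k")
        case True
        have "V l \<le> A * V k" using small True kl by simp
        also have "\<dots> \<le> B * V k" using B V_pos[of k] by simp
        finally show ?thesis .
      next
        case False
        then have k: "k = - int (s' (Suc n))" using kl i by simp
        show ?thesis
        proof (cases "k = l")
          case True then show ?thesis using B1 by simp
        next
          case False
          have "V l \<le> A * V (k + 1)" using small[of "k + 1"] False kl k by simp
          also have "\<dots> \<le> A * (E * V k)" using V_step A by (intro mult_left_mono) auto
          finally show ?thesis by (simp add: B_def mult_ac)
        qed
      qed
    qed
  qed
  have sum_le: "(\<Sum>i\<in>I. T (a i) / T (a (i + 1))) \<le> 1" if I: "finite I" for I
  proof -
    define I1 where "I1 = {i \<in> I. rises (a i) (a (i + 1))}"
    have fin: "finite I1" "finite (I - I1)" using I by (auto simp: I1_def)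
    have "\<forall>i\<in>I1. \<exists>j k. a i \<le> j \<and> j < k \<and> k \<le> a (i + 1) \<and> A * V j \<le> V k"
      by (auto simp: I1_def rises_def)
    then obtain j k where jk: "\<And>i. i \<in> I1 \<Longrightarrow> a i \<le> j i \<and> j i < k i \<and> k i \<le> a (i + 1) \<and> A * V (j i) \<le> V (k i)"
      by metis
    have inj: "inj_on k I1"
    proof (rule inj_onI)
      fix x y assume xy: "x \<in> I1" "y \<in> I1" "k x = k y"
      have "\<not> x < y" if "x \<in> I1" "y \<in> I1" "k x = k y" for x y
      proof
        assume "x < y"
        then have "a (x + 1) \<le> a y" using a_mono by (simp add: strict_mono_less_eq)
        then show False using jk[OF that(1)] jk[OF that(2)] that(3) by linarith
      qed
      then show "x = y" using xy by (metis linorder_neqE)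
    qed
    have ratio: "T (j i) / T (k i) \<le> 2 powr of_int (j i - k i) / A" if "i \<in> I1" for i
    proof -
      have "A * V (j i) * 2 powr of_int (j i) \<le> V (k i) * 2 powr of_int (j i)"
        using jk[OF that] by (intro mult_right_mono) auto
      then show ?thesis using A T_pos[of "k i"] V_pos[of "k i"]
        by (simp add: T_eq powr_diff field_simps)
    qed
    have half: "2 powr of_int (j i - k i) \<le> (1 / 2 :: real)" if "i \<in> I1" for i
    proof -
      have "2 powr of_int (j i - k i) \<le> (2::real) powr - 1" using jk[OF that] by (intro powr_mono) auto
      then show ?thesis by (simp add: powr_minus)
    qed
    \<comment> \<open>Bootstrap: a new term adds at most \<open>1 / 2\<close> to a sum known to be
      at most 2, so the ratio sum stays at most \<open>(5 / 2) / A\<close>, which is below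
      \<open>\<delta>\<close>; \<open>levels\<close> then restores the bound 2 for the enlarged
      set.\<close>
    have two: "(\<Sum>i\<in>J. 2 powr of_int (j i - k i)) \<le> (2::real)" if "finite J" "J \<subseteq> I1" for J
      using that
    proof (induct J)
      case (insert x J)
      have "(\<Sum>i\<in>insert x J. T (j i) / T (k i)) \<le> (\<Sum>i\<in>insert x J. 2 powr of_int (j i - k i) / A)"
        using insert ratio by (intro sum_mono) auto
      also have "\<dots> = (\<Sum>i\<in>insert x J. 2 powr of_int (j i - k i)) / A" by (simp add: sum_divide_distrib)
      also have "\<dots> \<le> (2 + 1 / 2) / A"
        using insert half[of x] A by (intro divide_right_mono) auto
      also have "\<dots> < \<delta>" using A \<delta> by (simp add: field_simps)
      finally have lt: "(\<Sum>i\<in>insert x J. T (j i) / T (k i)) < \<delta>" .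
      have inj': "inj_on k (insert x J)" using inj insert by (meson inj_on_subset)
      \<comment> \<open>\<open>levels\<close> indexes its sums by the upper level; since distinct
        blocks have distinct upper levels, \<open>\<kappa>\<close> recovers the block.\<close>
      define \<kappa> where "\<kappa> = the_inv_into (insert x J) k"
      have \<kappa>: "\<kappa> (k i) = i" if "i \<in> insert x J" for i
        unfolding \<kappa>_def using inj' that by (rule the_inv_into_f_f)
      have "(\<Sum>l\<in>k ` insert x J. T (j (\<kappa> l)) / T l) = (\<Sum>i\<in>insert x J. T (j i) / T (k i))"
        unfolding sum.reindex[OF inj'] by (intro sum.cong) (auto simp: \<kappa>)
      then have "(\<Sum>l\<in>k ` insert x J. 2 powr of_int (j (\<kappa> l) - l)) \<le> (2::real)"
        using lt insert by (intro levels) auto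
      also have "(\<Sum>l\<in>k ` insert x J. 2 powr real_of_int (j (\<kappa> l) - l)) = (\<Sum>i\<in>insert x J. 2 powr of_int (j i - k i))"
        unfolding sum.reindex[OF inj'] by (intro sum.cong) (auto simp: \<kappa>)
      finally show ?case .
    qed simp
    have "(\<Sum>i\<in>I1. T (a i) / T (a (i + 1))) \<le> (\<Sum>i\<in>I1. 2 powr of_int (j i - k i) / A)"
    proof (rule sum_mono)
      fix i assume i: "i \<in> I1"
      have "T (a i) / T (a (i + 1)) \<le> T (j i) / T (k i)"
        using jk[OF i] T_pos by (intro frac_le) (auto simp: T_le_iff less_imp_le)
      then show "T (a i) / T (a (i + 1)) \<le> 2 powr of_int (j i - k i) / A" using ratio[OF i] by linarith
    qed
    also have "\<dots> = (\<Sum>i\<in>I1. 2 powr of_int (j i - k i)) / A" by (simp add: sum_divide_distrib)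
    also have "\<dots> \<le> 2 / A" using two[OF fin(1)] A by (intro divide_right_mono) auto
    finally have s1: "(\<Sum>i\<in>I1. T (a i) / T (a (i + 1))) \<le> 2 / A" .
    have "(\<Sum>i\<in>I - I1. T (a i) / T (a (i + 1))) \<le> (\<Sum>i\<in>I - I1. \<omega> i / (2 * B))"
    proof (rule sum_mono)
      fix i assume "i \<in> I - I1"
      then have "2 * B * T (a i) \<le> \<omega> i * T (a (i + 1))" using alt[of i] by (auto simp: I1_def)
      then show "T (a i) / T (a (i + 1)) \<le> \<omega> i / (2 * B)" using B2 T_pos[of "a (i + 1)"] by (simp add: field_simps)
    qed
    also have "\<dots> = (\<Sum>i\<in>I - I1. \<omega> i) / (2 * B)" by (simp add: sum_divide_distrib)
    also have "\<dots> \<le> 4 / (2 * B)"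
    proof (rule divide_right_mono)
      let ?J = "I - I1"
      have "(\<Sum>i\<in>?J. \<omega> i) = (\<Sum>i\<in>?J \<inter> {0..}. \<omega> i) + (\<Sum>i\<in>?J \<inter> {..<0}. \<omega> i)"
        using fin by (subst sum.union_disjoint[symmetric]) (auto intro!: sum.cong)
      also have "(\<Sum>i\<in>?J \<inter> {0..}. \<omega> i) = (\<Sum>n\<in>nat ` (?J \<inter> {0..}). (1 / 2) ^ n)"
        by (subst sum.reindex) (auto simp: inj_on_def \<omega>_def)
      also have "(\<Sum>i\<in>?J \<inter> {..<0}. \<omega> i) = (\<Sum>n\<in>(\<lambda>i. nat (- i - 1)) ` (?J \<inter> {..<0}). (1 / 2) ^ n)"
        by (subst sum.reindex) (auto simp: inj_on_def \<omega>_def)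
      finally show "(\<Sum>i\<in>?J. \<omega> i) \<le> 4"
        using sum_half_powers_le[of "nat ` (?J \<inter> {0..})"]
          sum_half_powers_le[of "(\<lambda>i. nat (- i - 1)) ` (?J \<inter> {..<0})"] fin by simp
    qed (use B2 in simp)
    also have "\<dots> = 2 / B" by simp
    also have "\<dots> \<le> 2 / A" using A B B2 by (intro divide_left_mono) auto
    finally have "(\<Sum>i\<in>I - I1. T (a i) / T (a (i + 1))) \<le> 2 / A" .
    moreover have "(\<Sum>i\<in>I. T (a i) / T (a (i + 1))) = (\<Sum>i\<in>I - I1. T (a i) / T (a (i + 1))) + (\<Sum>i\<in>I1. T (a i) / T (a (i + 1)))"
      using I by (intro sum.subset_diff) (auto simp: I1_def)
    moreover have "2 / A + 2 / A \<le> 1" using A by (simp add: field_simps)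
    ultimately show ?thesis using s1 by linarith
  qed
  show thesis
    by (rule that[OF B2 E(1) E(2) a_mono long sum_le rise_le])
qed

end

section \<open>Construction of the N-function\<close>

text \<open>Monotonicity of \<open>g\<close> and of \<open>g t / t\<close> in opposite directions
  traps \<open>g t\<close> between \<open>min 1 (t / s) * g s\<close> and
  \<open>max 1 (t / s) * g s\<close>, which gives continuity at \<open>s > 0\<close>; continuity at
  0 comes from \<open>small\<close>.\<close>

lemma phi_function_of_quasi_concave:
  fixes g :: "real \<Rightarrow> real"
  assumes g0: "g 0 = 0" and mono: "\<And>s t. 0 \<le> s \<Longrightarrow> s < t \<Longrightarrow> g s < g t"
    and dec: "\<And>s t. 0 < s \<Longrightarrow> s \<le> t \<Longrightarrow> g t / t \<le> g s / s"
    and small: "\<And>e. 0 < e \<Longrightarrow> \<exists>t>0. g t \<le> e" and large: "\<And>M. \<exists>t>0. M \<le> g t"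
  shows "phi_function g"
proof -
  have le: "g s \<le> g t" if "0 \<le> s" "s \<le> t" for s t using mono[of s t] that by (cases "s = t") auto
  have pos: "0 < g t" if "0 < t" for t using mono[of 0 t] that g0 by simp
  have "continuous (at s within {0..}) g" if s: "0 \<le> s" for s
  proof (cases "s = 0")
    case True
    have "\<exists>d>0. \<forall>t\<in>{0..}. dist t 0 < d \<longrightarrow> dist (g t) (g 0) < e" if e: "0 < e" for e
    proof -
      obtain d where d: "0 < d" "g d \<le> e / 2" using small[of "e / 2"] e by auto
      have "dist (g t) (g 0) < e" if "0 \<le> t" "t < d" for t
        using le[of t d] le[of 0 t] that d e g0 by (simp add: dist_real_def)
      then show ?thesis using d by (intro exI[of _ d]) (auto simp: dist_real_def)
    qed
    then show ?thesis unfolding True continuous_within_eps_delta by blast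
  next
    case False
    then have s: "0 < s" using s by simp
    have ev: "eventually (\<lambda>t. 0 < t) (at s)" by (rule order_tendstoD(1)[OF tendsto_ident_at s])
    have "(g \<longlongrightarrow> g s) (at s)"
    proof (rule tendsto_sandwich)
      show "eventually (\<lambda>t. min 1 (t / s) * g s \<le> g t) (at s)"
        using ev
      proof eventually_elim
        case (elim t)
        show ?case
        proof (cases "s \<le> t")
          case True then show ?thesis using le[of s t] s pos[OF s] by (auto simp: min_def)
        next
          case False
          then have "g s / s \<le> g t / t" using dec[of t s] elim by simp
          then show ?thesis using False elim s by (simp add: min_def field_simps)
        qed
      qed
      show "eventually (\<lambda>t. g t \<le> max 1 (t / s) * g s) (at s)"
        using ev
      proof eventually_elim
        case (elim t)
        show ?case
        proof (cases "s \<le> t")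
          case True
          then have "g t / t \<le> g s / s" using dec[of s t] s by simp
          then show ?thesis using True elim s by (simp add: max_def field_simps)
        next
          case False
          then show ?thesis using le[of t s] elim s by (simp add: max_def)
        qed
      qed
      have "((\<lambda>t. min 1 (t / s) * g s) \<longlongrightarrow> min 1 (s / s) * g s) (at s)" using s by (intro tendsto_intros) auto
      then show "((\<lambda>t. min 1 (t / s) * g s) \<longlongrightarrow> g s) (at s)" using s by simp
      have "((\<lambda>t. max 1 (t / s) * g s) \<longlongrightarrow> max 1 (s / s) * g s) (at s)" using s by (intro tendsto_intros) auto
      then show "((\<lambda>t. max 1 (t / s) * g s) \<longlongrightarrow> g s) (at s)" using s by simp
    qed
    then have "isCont g s" by (simp add: isCont_def)
    then show ?thesis by (rule continuous_at_imp_continuous_at_within)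
  qed
  then have "continuous_on {0..} g" by (simp add: continuous_on_eq_continuous_within)
  moreover have "filterlim g at_top at_top"
    unfolding filterlim_at_top eventually_at_top_linorder
  proof
    fix Z
    obtain t where "0 < t" "Z \<le> g t" using large by blast
    then show "\<exists>N. \<forall>n\<ge>N. Z \<le> g n" using le[of t] by (intro exI[of _ t]) force
  qed
  moreover have "\<forall>t\<ge>0. 0 \<le> g t" using le[of 0] g0 by auto
  ultimately show ?thesis using g0 mono by (auto simp: phi_function_def strict_mono_on_def)
qed

lemma lacunary_growth:
  fixes X :: "int \<Rightarrow> real"
  assumes "1 < b" "\<And>i. 0 < X i" "\<And>i. b * X i \<le> X (i + 1)"
  shows "i \<le> j \<Longrightarrow> b powr of_int (j - i) * X i \<le> X j"
proof (induct j rule: int_ge_induct)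
  case base
  then show ?case using assms by simp
next
  case (step j)
  have "b powr of_int (j + 1 - i) * X i = b * (b powr of_int (j - i) * X i)"
    using assms(1) by (simp add: powr_diff powr_add)
  also have "\<dots> \<le> b * X j" using step assms(1) by simp
  also have "\<dots> \<le> X (j + 1)" by (rule assms(3))
  finally show ?case .
qed

lemma ex_powr_ge: "1 < b \<Longrightarrow> \<exists>n. (M::real) \<le> b powr of_int (int n)"
proof -
  assume b: "1 < b"
  obtain n where "M < b ^ n" using real_arch_pow[OF b] by blast
  then show ?thesis using b by (intro exI[of _ n]) (simp add: powr_realpow)
qed

lemma ex_powr_le: "1 < b \<Longrightarrow> 0 < e \<Longrightarrow> \<exists>n. b powr (- of_int (int n)) \<le> (e::real)"
proof -
  assume b: "1 < b" and e: "0 < e"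
  obtain n where "1 / e \<le> b powr of_int (int n)" using ex_powr_ge[OF b] by blast
  then show ?thesis using b e by (intro exI[of _ n]) (simp add: powr_minus field_simps)
qed

text \<open>The supremum of the quasi-concave functions \<open>q i\<close> equals
  \<open>B powr i\<close> at \<open>X i\<close>, since the growth of \<open>X\<close> keeps the
  other terms below. The summand \<open>t / (X 0 + t)\<close> makes both monotonicities strict; it
  is dominated by \<open>q 0\<close>, whence the factor 2. That \<open>X\<close> grows by
  \<open>2 * B\<close> and not merely by \<open>B\<close> sends \<open>t / \<rho> t\<close> to 0 and
  to infinity.\<close>

lemma slow_function:
  fixes X :: "int \<Rightarrow> real"
  assumes B: "2 \<le> B" and X0: "\<And>i. 0 < X i" and X: "\<And>i. 2 * B * X i \<le> X (i + 1)"
  obtains \<rho> where "phi_function \<rho>" "phi_function (\<lambda>t. t / \<rho> t)"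
    "\<And>i t. X i \<le> t \<Longrightarrow> B powr of_int i \<le> \<rho> t"
    "\<And>i t. 0 \<le> t \<Longrightarrow> t \<le> X i \<Longrightarrow> \<rho> t \<le> 2 * B powr of_int i"
proof -
  have B1: "1 < B" using B by simp
  have XB: "B * X i \<le> X (i + 1)" for i using X[of i] mult_pos_pos[of B "X i"] X0[of i] B by linarith
  have grow: "B powr of_int (j - i) * X i \<le> X j" if "i \<le> j" for i j
    using lacunary_growth[of B X i j] B1 X0 XB that by blast
  have grow2: "(2 * B) powr of_int (j - i) * X i \<le> X j" if "i \<le> j" for i j
    using lacunary_growth[of "2 * B" X i j] B1 X0 X that by simp
  define q where "q i t = B powr of_int i * min 1 (t / X i)" for i t
  have q_le: "q j t \<le> B powr of_int i" if "t \<le> X i" for i j t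
  proof (cases "j \<le> i")
    case True
    have "q j t \<le> B powr of_int j * 1" unfolding q_def by (intro mult_left_mono) auto
    also have "\<dots> \<le> B powr of_int i" using True B1 by simp
    finally show ?thesis .
  next
    case False
    have "q j t \<le> B powr of_int j * (X i / X j)"
    proof -
      have "min 1 (t / X j) \<le> t / X j" by simp
      also have "\<dots> \<le> X i / X j" using that X0[of j] by (intro divide_right_mono) auto
      finally show ?thesis unfolding q_def by (intro mult_left_mono) auto
    qed
    also have "\<dots> \<le> B powr of_int i"
      using grow[of i j] False X0[of j] B1 by (simp add: powr_diff field_simps)
    finally show ?thesis .
  qed
  have XL: "\<exists>n. M \<le> X (int n)" for M
  proof -
    obtain n where "M / X 0 \<le> B powr of_int (int n)" using ex_powr_ge[OF B1] by blast
    then have "M \<le> B powr of_int (int n - 0) * X 0" using X0[of 0] by (simp add: field_simps)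
    then show ?thesis using grow[of 0 "int n"] by (intro exI[of _ n]) simp
  qed
  have bdd: "bdd_above (range (\<lambda>i. q i t))" for t
  proof -
    obtain n where "t \<le> X (int n)" using XL by blast
    then show ?thesis using q_le[of t "int n"] by (intro bdd_aboveI[of _ "B powr of_int (int n)"]) auto
  qed
  define r where "r t = (SUP i. q i t)" for t
  have q_r: "q i t \<le> r t" for i t unfolding r_def by (rule cSUP_upper[OF _ bdd]) simp
  have r_le: "r t \<le> c" if "\<And>i. q i t \<le> c" for t c unfolding r_def using that by (intro cSUP_least) auto
  have r_mono: "r s \<le> r t" if "s \<le> t" for s t
  proof (rule r_le)
    fix i
    have "q i s \<le> q i t" unfolding q_def using that X0[of i]
      by (intro mult_left_mono min.mono divide_right_mono) auto
    then show "q i s \<le> r t" using q_r[of i t] by linarith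
  qed
  have r_dec: "r t \<le> t / s * r s" if "0 < s" "s \<le> t" for s t
  proof (rule r_le)
    fix i
    have "min 1 (t / X i) \<le> t / s * min 1 (s / X i)"
      using that X0[of i] by (auto simp: min_def field_simps)
    then have "q i t \<le> t / s * q i s" unfolding q_def
      using mult_left_mono[of "min 1 (t / X i)" "t / s * min 1 (s / X i)" "B powr of_int i"] by (simp add: mult_ac)
    also have "\<dots> \<le> t / s * r s" using q_r[of i s] that by (intro mult_left_mono) auto
    finally show "q i t \<le> t / s * r s" .
  qed
  have r0: "0 \<le> r t" if "0 \<le> t" for t
  proof -
    have "0 \<le> q 0 t" using that X0[of 0] by (simp add: q_def)
    then show ?thesis using q_r[of 0 t] by linarith
  qed
  have r_ge: "B powr of_int i \<le> r t" if "X i \<le> t" for i t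
    using q_r[of i t] that X0[of i] by (simp add: q_def)
  have r_up: "r t \<le> B powr of_int i" if "t \<le> X i" for i t by (rule r_le) (rule q_le[OF that])
  have extra: "t / (X 0 + t) \<le> r t" if "0 \<le> t" for t
  proof -
    have "t / (X 0 + t) \<le> min 1 (t / X 0)" using that X0[of 0] by (auto intro: divide_left_mono)
    moreover have "q 0 t = min 1 (t / X 0)" using B1 by (simp add: q_def)
    ultimately show ?thesis using q_r[of 0 t] by linarith
  qed
  define \<rho> where "\<rho> t = r t + t / (X 0 + t)" for t
  have r00: "r 0 = 0"
  proof (rule antisym[OF r_le r0])
    show "q i 0 \<le> 0" for i by (simp add: q_def)
  qed simp
  have \<rho>0: "\<rho> 0 = 0" by (simp add: \<rho>_def r00)
  have \<rho>_mono: "\<rho> s < \<rho> t" if "0 \<le> s" "s < t" for s t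
  proof -
    have "s / (X 0 + s) < t / (X 0 + t)" using that X0[of 0] by (simp add: field_simps)
    then show ?thesis using r_mono[of s t] that by (simp add: \<rho>_def)
  qed
  have \<rho>_pos: "0 < \<rho> t" if "0 < t" for t using \<rho>_mono[of 0 t] \<rho>0 that by simp
  have \<rho>_dec: "\<rho> t / t < \<rho> s / s" if "0 < s" "s < t" for s t
  proof -
    have "r t / t \<le> r s / s" using r_dec[of s t] that by (simp add: field_simps)
    moreover have "1 / (X 0 + t) < 1 / (X 0 + s)" using that X0[of 0] by (intro divide_strict_left_mono) auto
    ultimately show ?thesis using that X0[of 0] by (simp add: \<rho>_def add_divide_distrib)
  qed
  have \<rho>_ge: "B powr of_int i \<le> \<rho> t" if "X i \<le> t" for i t
    using r_ge[OF that] that X0[of i] X0[of 0] by (simp add: \<rho>_def add_increasing2)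
  have \<rho>_up: "\<rho> t \<le> 2 * B powr of_int i" if "0 \<le> t" "t \<le> X i" for i t
    using r_up[OF that(2)] extra[OF that(1)] by (simp add: \<rho>_def)
  have phi: "phi_function \<rho>"
  proof (rule phi_function_of_quasi_concave)
    show "\<rho> t / t \<le> \<rho> s / s" if "0 < s" "s \<le> t" for s t
      using \<rho>_dec[of s t] that by (cases "s = t") auto
    show "\<exists>t>0. \<rho> t \<le> e" if e: "0 < e" for e
    proof -
      obtain n where "B powr (- of_int (int n)) \<le> e / 2" using ex_powr_le[OF B1, of "e / 2"] e by auto
      then show ?thesis using \<rho>_up[of "X (- int n)" "- int n"] X0 by (intro exI[of _ "X (- int n)"]) (auto simp: less_imp_le)
    qed
    show "\<exists>t>0. M \<le> \<rho> t" for M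
    proof -
      obtain n where "M \<le> B powr of_int (int n)" using ex_powr_ge[OF B1] by blast
      then show ?thesis using \<rho>_ge[of "int n" "X (int n)"] X0 by (intro exI[of _ "X (int n)"]) auto
    qed
  qed (use \<rho>0 \<rho>_mono in auto)
  have phi2: "phi_function (\<lambda>t. t / \<rho> t)"
  proof (rule phi_function_of_quasi_concave)
    show "s / \<rho> s < t / \<rho> t" if "0 \<le> s" "s < t" for s t
    proof (cases "s = 0")
      case True then show ?thesis using that \<rho>_pos[of t] by simp
    next
      case False
      then have "0 < s" using that by simp
      then show ?thesis using \<rho>_dec[of s t] that \<rho>_pos[of s] \<rho>_pos[of t] by (simp add: field_simps)
    qed
    show "t / \<rho> t / t \<le> s / \<rho> s / s" if "0 < s" "s \<le> t" for s t
      using \<rho>_mono[of s t] that \<rho>_pos[of s] by (cases "s = t") (auto simp: field_simps)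
    show "\<exists>t>0. t / \<rho> t \<le> e" if e: "0 < e" for e
    proof -
      obtain n where n: "2 powr (- of_int (int n)) \<le> e / X 0" using ex_powr_le[of 2 "e / X 0"] e X0[of 0] by auto
      let ?t = "X (- int n)"
      have "(2 * B) powr of_int (int n) * ?t \<le> X 0" using grow2[of "- int n" 0] by simp
      then have "?t / B powr (- of_int (int n)) \<le> X 0 * 2 powr (- of_int (int n))"
        using B1 by (simp add: powr_mult powr_minus field_simps)
      moreover have "?t / \<rho> ?t \<le> ?t / B powr (- of_int (int n))"
        using \<rho>_ge[of "- int n" ?t] X0[of "- int n"] B1 \<rho>_pos[of ?t] by (intro divide_left_mono) auto
      moreover have "X 0 * 2 powr (- of_int (int n)) \<le> e" using n X0[of 0] by (simp add: field_simps)
      ultimately show ?thesis using X0 by (intro exI[of _ ?t]) auto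
    qed
    show "\<exists>t>0. M \<le> t / \<rho> t" for M
    proof -
      obtain n where n: "2 * M / X 0 \<le> 2 powr of_int (int n)" using ex_powr_ge[of 2] by auto
      let ?t = "X (int n)"
      have "(2 * B) powr of_int (int n) * X 0 \<le> ?t" using grow2[of 0 "int n"] by simp
      then have "2 powr of_int (int n) * X 0 / 2 \<le> ?t / (2 * B powr of_int (int n))"
        using B1 by (simp add: powr_mult field_simps)
      moreover have "?t / (2 * B powr of_int (int n)) \<le> ?t / \<rho> ?t"
        using \<rho>_up[of ?t "int n"] X0[of "int n"] B1 \<rho>_pos[of ?t] by (intro divide_left_mono) auto
      moreover have "M \<le> 2 powr of_int (int n) * X 0 / 2" using n X0[of 0] by (simp add: field_simps)
      ultimately show ?thesis using X0 by (intro exI[of _ ?t]) auto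
    qed
  qed (simp add: \<rho>0)
  show thesis by (rule that[OF phi phi2 \<rho>_ge \<rho>_up])
qed

text \<open>\<open>K\<close> is the supremum of the convex functions
  \<open>Q s / s * max 0 (t - s)\<close>. The choice \<open>s = t / 2\<close> bounds it below by
  \<open>Q (t / 2)\<close>. Quasi-monotonicity bounds it above by \<open>C * Q t\<close>, and a
  second use of it turns the factor \<open>C\<close> into a dilation by
  \<open>C * C\<close>.\<close>

lemma convex_equiv_of_quasi_increasing:
  assumes Q: "phi_function Q" and C: "1 \<le> C"
    and quasi: "\<And>s t. 0 < s \<Longrightarrow> s \<le> t \<Longrightarrow> Q s / s \<le> C * (Q t / t)"
  shows "\<exists>K. convex_on {0..} K \<and> phi_equiv Q K"
proof -
  define k where "k s t = Q s / s * max 0 (t - s)" for s t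
  have k_le: "k s t \<le> C * Q t" if "0 < s" "0 \<le> t" for s t
  proof (cases "s < t")
    case True
    have "k s t \<le> Q s / s * t" unfolding k_def using that True phi_pos[OF Q that(1)] by (intro mult_left_mono) auto
    also have "\<dots> \<le> C * (Q t / t) * t" using quasi[of s t] that True by (intro mult_right_mono) auto
    finally show ?thesis using True that by simp
  next
    case False
    then show ?thesis using C phi_nonneg[OF Q that(2)] by (simp add: k_def)
  qed
  have bdd: "bdd_above ((\<lambda>s. k s t) ` {0<..})" if "0 \<le> t" for t
    using k_le that by (intro bdd_aboveI[of _ "C * Q t"]) auto
  define K where "K t = (SUP s\<in>{0<..}. k s t)" for t
  have k_K: "k s t \<le> K t" if "0 < s" "0 \<le> t" for s t
    unfolding K_def using that by (intro cSUP_upper bdd) auto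
  have K_le: "K t \<le> c" if "\<And>s. 0 < s \<Longrightarrow> k s t \<le> c" for t c
    unfolding K_def using that by (intro cSUP_least) auto
  have "convex_on {0..} K"
  proof (rule convex_onI)
    fix a x y :: real assume a: "0 < a" "a < 1" and xy: "x \<in> {0..}" "y \<in> {0..}"
    show "K ((1 - a) *\<^sub>R x + a *\<^sub>R y) \<le> (1 - a) * K x + a * K y"
    proof (rule K_le)
      fix s :: real assume s: "0 < s"
      have "max 0 ((1 - a) * x + a * y - s) \<le> (1 - a) * max 0 (x - s) + a * max 0 (y - s)"
      proof -
        have "(1 - a) * (x - s) \<le> (1 - a) * max 0 (x - s)" "a * (y - s) \<le> a * max 0 (y - s)"
          using a by (auto intro: mult_left_mono)
        then have "(1 - a) * x + a * y - s \<le> (1 - a) * max 0 (x - s) + a * max 0 (y - s)"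
          by (simp add: algebra_simps)
        moreover have "0 \<le> (1 - a) * max 0 (x - s) + a * max 0 (y - s)" using a by simp
        ultimately show ?thesis by simp
      qed
      then have "k s ((1 - a) * x + a * y) \<le> Q s / s * ((1 - a) * max 0 (x - s) + a * max 0 (y - s))"
        unfolding k_def using phi_pos[OF Q s] s by (intro mult_left_mono) auto
      also have "\<dots> = (1 - a) * k s x + a * k s y" unfolding k_def distrib_left by (simp only: mult.left_commute)
      also have "\<dots> \<le> (1 - a) * K x + a * K y"
        using k_K[OF s] xy a by (intro add_mono mult_left_mono) auto
      finally show "k s ((1 - a) *\<^sub>R x + a *\<^sub>R y) \<le> (1 - a) * K x + a * K y" by simp
    qed
  qed simp
  moreover have "phi_equiv Q K"
    unfolding phi_equiv_def
  proof (intro exI conjI allI impI)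
    define c where "c = max 2 (C * C)"
    have c: "2 \<le> c" "C * C \<le> c" by (auto simp: c_def)
    show "0 < max 2 (C * C)" by simp
    fix t :: real assume t: "0 \<le> t"
    have "Q (t / c) \<le> K t"
    proof (cases "t = 0")
      case True
      then show ?thesis using k_K[of 1 0] by (simp add: k_def phi_zero Q)
    next
      case False
      then have t: "0 < t" using t by simp
      have "Q (t / c) \<le> Q (t / 2)" using t c by (subst phi_le_iff[OF Q]) (auto simp: field_simps)
      also have "\<dots> = k (t / 2) t" using t by (simp add: k_def)
      also have "\<dots> \<le> K t" using t by (intro k_K) auto
      finally show ?thesis .
    qed
    then show "Q (t / max 2 (C * C)) \<le> K t" by (simp add: c_def)
    have "K t \<le> C * Q t" using k_le t by (intro K_le)
    also have "\<dots> \<le> Q (C * C * t)"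
    proof (cases "t = 0")
      case False
      then have t: "0 < t" using t by simp
      have CC: "1 \<le> C * C" using mult_mono[OF C C] C by simp
      have "Q t / t \<le> C * (Q (C * C * t) / (C * C * t))"
        using t CC mult_right_mono[OF CC, of t] by (intro quasi) auto
      also have "\<dots> = (Q (C * C * t) / C) / t" using C by simp
      finally show ?thesis using t C by (simp add: field_simps)
    qed (simp add: phi_zero Q)
    also have "\<dots> \<le> Q (c * t)" using t c C by (subst phi_le_iff[OF Q]) (auto intro: mult_right_mono)
    finally show "K t \<le> Q (max 2 (C * C) * t)" by (simp add: c_def)
  qed
  ultimately show ?thesis by blast
qed

text \<open>With these choices the product of the two inverses is exactly \<open>t\<close>, and
  \<open>H t / t = \<rho> (H t)\<close>. The latter is a phi-function of \<open>t\<close>, which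
  supplies the monotonicity and both limits required of an N-function.\<close>

lemma condJ_of_slow_function:
  assumes \<rho>: "phi_function \<rho>" and h: "phi_function (\<lambda>t. t / \<rho> t)"
    and J: "modular (phi_inv \<rho>) (\<lambda>x. \<rho> (1 / x) / c) \<le> 1" and c: "0 < c"
  defines "H \<equiv> phi_inv (\<lambda>t. t / \<rho> t)"
  shows "N_function H" "condJ H"
proof -
  have H: "phi_function H" unfolding H_def by (rule phi_function_phi_inv[OF h])
  define Hs where "Hs = phi_inv \<rho>"
  have Hs: "phi_function Hs" unfolding Hs_def by (rule phi_function_phi_inv[OF \<rho>])
  have invH: "phi_inv H t = t / \<rho> t" if "0 \<le> t" for t
    unfolding H_def using phi_inv_phi_inv[OF h that] by simp
  have invHs: "phi_inv Hs t = \<rho> t" if "0 \<le> t" for t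
    unfolding Hs_def by (rule phi_inv_phi_inv[OF \<rho> that])
  define w where "w t = \<rho> (H t)" for t
  have w: "phi_function w" unfolding w_def by (rule phi_function_compose[OF \<rho> H])
  have Hw: "H t / t = w t" if t: "0 < t" for t
  proof -
    have "0 < H t" using t by (simp add: phi_pos H)
    then have "0 < \<rho> (H t)" by (simp add: phi_pos \<rho>)
    moreover have "H t / \<rho> (H t) = t" unfolding H_def using phi_inv_props(2)[OF h, of t] t by simp
    ultimately show ?thesis using t \<open>0 < H t\<close> by (simp add: w_def field_simps)
  qed
  show "N_function H"
    unfolding N_function_def
  proof (intro conjI exI[of _ H] H)
    show "strict_mono_on {0<..} (\<lambda>t. H t / t)"
      by (auto simp: strict_mono_on_def Hw phi_less_iff w)
    have "filterlim w at_top at_top" using w by (simp add: phi_function_def)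
    moreover have "eventually (\<lambda>t. w t = H t / t) at_top"
      using eventually_gt_at_top[of 0] by eventually_elim (simp add: Hw)
    ultimately show "filterlim (\<lambda>t. H t / t) at_top at_top"
      by (rule filterlim_cong[OF refl refl, THEN iffD1, rotated])
    have "(w \<longlongrightarrow> w 0) (at 0 within {0..})"
      using w unfolding phi_function_def continuous_on_def by blast
    then have "(w \<longlongrightarrow> w 0) (at_right 0)" by (rule tendsto_within_subset) auto
    then have "(w \<longlongrightarrow> 0) (at_right 0)" by (simp add: phi_zero w)
    moreover have "eventually (\<lambda>t. w t = H t / t) (at_right 0)"
      using eventually_at_right_less[of 0] by eventually_elim (simp add: Hw)
    ultimately show "((\<lambda>t. H t / t) \<longlongrightarrow> 0) (at_right 0)"
      by (rule tendsto_cong[THEN iffD1, rotated])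
    show "phi_equiv H H" unfolding phi_equiv_def by (intro exI[of _ 1]) simp
  qed
  show "condJ H"
    unfolding condJ_def
  proof (intro exI[of _ Hs] conjI)
    show "complementary H Hs"
      unfolding complementary_def
    proof (intro conjI Hs exI[of _ 1] allI impI)
      fix t :: real assume t: "0 \<le> t"
      have "phi_inv H t * phi_inv Hs t = t"
        using t phi_pos[OF \<rho>, of t] by (cases "t = 0") (auto simp: invH invHs)
      then show "t / 1 \<le> phi_inv H t * phi_inv Hs t" "phi_inv H t * phi_inv Hs t \<le> 1 * t" by auto
    qed simp
    have "modular Hs (\<lambda>x. \<bar>1 / phi_inv (tilde Hs) x\<bar> / c) = modular Hs (\<lambda>x. \<rho> (1 / x) / c)"
      by (rule modular_cong) (simp add: phi_inv_tilde Hs invHs phi_nonneg \<rho>)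
    then have "lux Hs (\<lambda>x. 1 / phi_inv (tilde Hs) x) \<le> ennreal c"
      using J c by (intro lux_le) (auto simp: Hs_def)
    then show "lux Hs (\<lambda>x. 1 / phi_inv (tilde Hs) x) < \<infinity>" by (auto intro: le_less_trans)
  qed
qed

lemma N_function_of_levels:
  assumes G: "phi_function G" and lev: "level_sequence (\<lambda>k. phi_inv G (2 powr of_int k)) \<delta>"
  shows "\<exists>H. phi_function H \<and> N_function H \<and> condJ H \<and> (\<exists>K. convex_on {0..} K \<and> phi_equiv (\<lambda>t. G (H t)) K)"
proof -
  define T where "T k = phi_inv G (2 powr of_int k)" for k :: int
  interpret level_sequence T \<delta> using lev by (simp add: T_def[abs_def])
  show ?thesis
  proof (rule blocks)
  fix a :: "int \<Rightarrow> int" and B E :: real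
  assume B: "2 \<le> B" and E: "2 \<le> E" "\<And>k. T (k + 1) \<le> 2 * E * T k" and a: "strict_mono a"
    and long: "\<And>i. 2 * B * T (a i) \<le> T (a (i + 1))"
    and sums: "\<And>I. finite I \<Longrightarrow> (\<Sum>i\<in>I. T (a i) / T (a (i + 1))) \<le> 1"
    and rise: "\<And>i k l. a i \<le> k \<Longrightarrow> k \<le> l \<Longrightarrow> l \<le> a (i + 1) \<Longrightarrow> V l \<le> B * V k"
  define X where "X i = T (a i)" for i
  have X0: "0 < X i" for i by (simp add: X_def T_pos)
  have X: "2 * B * X i \<le> X (i + 1)" for i using long by (simp add: X_def)
  have B1: "1 < B" "0 < B" using B by auto
  have XB: "B * X i \<le> X (i + 1)" for i using X[of i] mult_pos_pos[of B "X i"] X0[of i] B by linarith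
  have grow: "B powr of_int (j - i) * X i \<le> X j" if "i \<le> j" for i j
    using lacunary_growth[of B X i j] B1 X0 XB that by blast
  obtain \<rho> where \<rho>: "phi_function \<rho>" "phi_function (\<lambda>t. t / \<rho> t)"
    and \<rho>_ge: "\<And>i t. X i \<le> t \<Longrightarrow> B powr of_int i \<le> \<rho> t"
    and \<rho>_le: "\<And>i t. 0 \<le> t \<Longrightarrow> t \<le> X i \<Longrightarrow> \<rho> t \<le> 2 * B powr of_int i"
    using slow_function[of B X, OF B X0 X] by blast
  have bracket: "\<exists>i. X i \<le> y \<and> y < X (i + 1)" if y: "0 < y" for y
  proof -
    have "\<exists>i. X i \<le> y"
    proof -
      obtain n where n: "B powr (- of_int (int n)) \<le> y / X 0" using ex_powr_le[OF B1(1), of "y / X 0"] y X0[of 0] by auto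
      have "B powr of_int (int n) * X (- int n) \<le> X 0" using grow[of "- int n" 0] by simp
      then have "X (- int n) \<le> X 0 * B powr (- of_int (int n))" using B1 by (simp add: powr_minus field_simps)
      also have "\<dots> \<le> y" using n X0[of 0] by (simp add: field_simps)
      finally show ?thesis by blast
    qed
    moreover have "\<exists>n. y < X (m + int n)" for m
    proof -
      obtain n where n: "(y + 1) / X m \<le> B powr of_int (int n)" using ex_powr_ge[OF B1(1)] by blast
      have "B powr of_int (int n) * X m \<le> X (m + int n)" using grow[of m "m + int n"] by simp
      moreover have "y + 1 \<le> B powr of_int (int n) * X m" using n X0[of m] by (simp add: field_simps)
      ultimately show ?thesis by (intro exI[of _ n]) linarith
    qed
    ultimately show ?thesis using int_sequence_bracket[of X y] by metis
  qed
  define Hs where "Hs = phi_inv \<rho>"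
  have Hs: "phi_function Hs" unfolding Hs_def by (rule phi_function_phi_inv[OF \<rho>(1)])
  \<comment> \<open>For \<open>1 / x\<close> between \<open>X i\<close> and \<open>X (i + 1)\<close>
    the value \<open>\<rho> (1 / x)\<close> is at most \<open>2 * B powr (i + 1)\<close>. Division
    by \<open>2 * B * B\<close> lowers it to \<open>B powr (i - 1)\<close>, so the integrand is at
    most \<open>X (i - 1)\<close> on a set of measure at most \<open>1 / X i\<close>, and the
    integral is at most the sum of the block ratios.\<close>
  have J: "modular Hs (\<lambda>x. \<rho> (1 / x) / (2 * B * B)) \<le> 1"
  proof -
    let ?I = "\<lambda>i. {1 / X (i + 1)..1 / X i}"
    define e where "e = int_decode"
    have e: "bij e" unfolding e_def by (rule bij_int_decode)
    have pt: "ennreal (Hs (\<rho> (1 / x) / (2 * B * B))) * indicator {0<..} x \<le>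
        (\<Sum>n. ennreal (X (e n - 1)) * indicator (?I (e n)) x)" for x
    proof (cases "0 < x")
      case True
      obtain i where i: "X i \<le> 1 / x" "1 / x < X (i + 1)" using bracket[of "1 / x"] True by auto
      have "x \<in> ?I i" using i True X0[of i] X0[of "i + 1"] by (auto simp: field_simps)
      have "\<rho> (1 / x) \<le> 2 * B powr of_int (i + 1)" using i True by (intro \<rho>_le) auto
      then have "\<rho> (1 / x) / (2 * B * B) \<le> B powr of_int (i - 1)"
        using B1 by (simp add: powr_add powr_diff field_simps)
      also have "\<dots> \<le> \<rho> (X (i - 1))" by (rule \<rho>_ge) simp
      finally have "Hs (\<rho> (1 / x) / (2 * B * B)) \<le> Hs (\<rho> (X (i - 1)))"
        using True B1 X0[of "i - 1"] by (subst phi_le_iff[OF Hs]) (auto simp: phi_nonneg \<rho>(1))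
      also have "\<dots> = X (i - 1)" unfolding Hs_def using X0[of "i - 1"] by (intro phi_inv_phi \<rho>) auto
      finally have "ennreal (Hs (\<rho> (1 / x) / (2 * B * B))) * indicator {0<..} x \<le> ennreal (X (i - 1)) * indicator (?I i) x"
        using True \<open>x \<in> ?I i\<close> by (simp add: ennreal_leI)
      also obtain n where "i = e n" using e by (metis bij_pointE)
      then have "ennreal (X (i - 1)) * indicator (?I i) x = (\<Sum>n\<in>{n}. ennreal (X (e n - 1)) * indicator (?I (e n)) x)"
        by (simp only: sum.insert finite.emptyI empty_iff not_False_eq_True sum.empty add_0_right)
      also have "\<dots> \<le> (\<Sum>n. ennreal (X (e n - 1)) * indicator (?I (e n)) x)" by (rule sum_le_suminf) auto
      finally show ?thesis .
    qed simp
    have "modular Hs (\<lambda>x. \<rho> (1 / x) / (2 * B * B)) \<le>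
        (\<integral>\<^sup>+ x. (\<Sum>n. ennreal (X (e n - 1)) * indicator (?I (e n)) x) \<partial>lborel)"
      unfolding modular_def by (rule nn_integral_mono) (rule pt)
    also have "\<dots> = (\<Sum>n. ennreal (X (e n - 1)) * emeasure lborel (?I (e n)))"
      by (simp add: nn_integral_suminf nn_integral_cmult_indicator del: emeasure_lborel_Icc_eq)
    also have "\<dots> \<le> (\<Sum>n. ennreal (X (e n - 1) / X (e n)))"
    proof (rule suminf_le)
      fix n
      have "emeasure lborel (?I (e n)) \<le> ennreal (1 / X (e n))"
        using X0[of "e n"] X0[of "e n + 1"] by (auto simp: emeasure_lborel_Icc_eq intro!: ennreal_leI)
      then have "ennreal (X (e n - 1)) * emeasure lborel (?I (e n)) \<le> ennreal (X (e n - 1)) * ennreal (1 / X (e n))"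
        by (rule mult_left_mono) simp
      also have "\<dots> = ennreal (X (e n - 1) / X (e n))"
        using X0[of "e n"] X0[of "e n - 1"] by (simp add: ennreal_mult[symmetric])
      finally show "ennreal (X (e n - 1)) * emeasure lborel (?I (e n)) \<le> ennreal (X (e n - 1) / X (e n))" .
    qed auto
    also have "\<dots> \<le> 1"
    proof (rule suminf_le_const)
      fix N
      have inj: "inj_on (\<lambda>n. e n - 1) {..<N}" using e by (auto simp: inj_on_def bij_def)
      have "(\<Sum>n<N. X (e n - 1) / X (e n)) = (\<Sum>i\<in>(\<lambda>n. e n - 1) ` {..<N}. T (a i) / T (a (i + 1)))"
        by (subst sum.reindex[OF inj]) (simp add: X_def)
      also have "\<dots> \<le> 1" by (rule sums) simp
      finally show "(\<Sum>n<N. ennreal (X (e n - 1) / X (e n))) \<le> 1"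
        using X0 by (subst sum_ennreal) (auto simp: less_imp_le)
    qed simp
    finally show ?thesis .
  qed
  define H where "H = phi_inv (\<lambda>t. t / \<rho> t)"
  have H: "phi_function H" unfolding H_def by (rule phi_function_phi_inv[OF \<rho>(2)])
  have NJ: "N_function H" "condJ H"
    unfolding H_def using condJ_of_slow_function[OF \<rho>, of "2 * B * B"] J B1 by (auto simp: Hs_def)
  have \<rho>pos: "0 < \<rho> t" if "0 < t" for t using that by (simp add: phi_pos \<rho>)
  have rises: "V l \<le> B ^ (n + 1) * V k"
    if "a i \<le> k" "k \<le> a (i + 1)" "a (i + int n) \<le> l" "l \<le> a (i + int n + 1)" "k \<le> l" for i k l n
    using that
  proof (induct n arbitrary: l)
    case 0
    then show ?case using rise[of i k l] by simp
  next
    case (Suc n)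
    let ?m = "a (i + int n + 1)"
    have eq: "i + int (Suc n) = i + int n + 1" by simp
    have "V l \<le> B * V ?m" using Suc.prems unfolding eq by (intro rise[of "i + int n + 1"]) auto
    also have "\<dots> \<le> B * (B ^ (n + 1) * V k)"
    proof (intro mult_left_mono Suc.hyps)
      show "a (i + int n) \<le> ?m" using a by (simp add: strict_mono_less_eq)
      have "a (i + 1) \<le> ?m" using a by (simp add: strict_mono_less_eq)
      then show "k \<le> ?m" using Suc.prems by linarith
    qed (use Suc.prems B1 in auto)
    finally show ?case by simp
  qed
  \<comment> \<open>From block \<open>i\<close> to block \<open>i'\<close> the value of
    \<open>V\<close> rises by at most \<open>B ^ (i' - i + 1)\<close>, while \<open>\<rho>\<close>
    gains at least \<open>B ^ (i' - i)\<close> up to a factor \<open>2 * B\<close>; the gain of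
    \<open>\<rho>\<close> compensates the rise of \<open>V\<close>.\<close>
  have grid: "\<rho> (T k) / V k \<le> 2 * B * B * (\<rho> (T l) / V l)" if kl: "k \<le> l" for k l
  proof -
    obtain i where i: "X i \<le> T k" "T k < X (i + 1)" using bracket[OF T_pos] by blast
    obtain i' where i': "X i' \<le> T l" "T l < X (i' + 1)" using bracket[OF T_pos] by blast
    have ik: "a i \<le> k" "k < a (i + 1)" "a i' \<le> l" "l < a (i' + 1)"
      using i i' T_mono by (auto simp: X_def strict_mono_less_eq strict_mono_less)
    then have "a i < a (i' + 1)" using kl by linarith
    then have "i < i' + 1" using a by (simp add: strict_mono_less)
    define n where "n = nat (i' - i)"
    have n: "i' = i + int n" using \<open>i < i' + 1\<close> by (simp add: n_def)
    have "V l \<le> B ^ (n + 1) * V k" using ik kl n by (intro rises) auto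
    then have Vk: "1 / V k \<le> B ^ (n + 1) / V l" using V_pos[of k] V_pos[of l] by (simp add: field_simps)
    have "\<rho> (T k) / V k \<le> (2 * B powr of_int (i + 1)) * (B ^ (n + 1) / V l)"
      using mult_mono[OF \<rho>_le[of "T k" "i + 1"] Vk] i T_pos[of k] \<rho>pos[OF T_pos, of k] V_pos[of k] B1
      by (simp add: less_imp_le)
    also have "\<dots> = 2 * B * B * (B powr of_int i' / V l)"
      using B1 by (simp add: n powr_add powr_realpow)
    also have "\<dots> \<le> 2 * B * B * (\<rho> (T l) / V l)"
      using \<rho>_ge[OF i'(1)] V_pos[of l] B1 by (intro mult_left_mono divide_right_mono) auto
    finally show ?thesis .
  qed
  \<comment> \<open>The product of \<open>4 * E\<close> for moving from \<open>y\<close> to the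
    grid, \<open>2 * B * B\<close> for the comparison on the grid, and \<open>2 * E\<close> for
    moving from the grid to \<open>z\<close>.\<close>
  define R where "R = 16 * E\<^sup>2 * B\<^sup>2"
  \<comment> \<open>With \<open>y = H s\<close> the denominator \<open>y / \<rho> y\<close> is
    \<open>s\<close>, so this is the quasi-monotonicity of \<open>G (H s) / s\<close> that makes
    \<open>G o H\<close> equivalent to a convex function.\<close>
  have ratio: "G y / (y / \<rho> y) \<le> R * (G z / (z / \<rho> z))" if y: "0 < y" and yz: "y \<le> z" for y z
  proof -
    have z: "0 < z" using y yz by simp
    have gr: "\<exists>k. T k \<le> x \<and> x \<le> T (k + 1) \<and> G x \<le> 2 powr of_int (k + 1) \<and> 2 powr of_int k \<le> G x \<and> k = \<lfloor>log 2 (G x)\<rfloor>"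
      if x: "0 < x" for x
    proof -
      define k where "k = \<lfloor>log 2 (G x)\<rfloor>"
      have Gx: "0 < G x" using x by (simp add: phi_pos G)
      have k: "of_int k \<le> log 2 (G x)" "log 2 (G x) \<le> of_int (k + 1)"
        unfolding k_def by linarith+
      have k2: "2 powr of_int k \<le> G x" "G x \<le> 2 powr of_int (k + 1)"
        using k Gx by (auto simp: le_log_iff log_le_iff)
      then show ?thesis
        using x phi_inv_le_iff'[OF G, of x "2 powr of_int k"] le_phi_inv_iff[OF G, of x "2 powr of_int (k + 1)"]
        by (intro exI[of _ k]) (auto simp: T_def k_def)
    qed
    obtain k where k: "T k \<le> y" "y \<le> T (k + 1)" "G y \<le> 2 powr of_int (k + 1)" "k = \<lfloor>log 2 (G y)\<rfloor>" using gr[OF y] by blast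
    obtain l where l: "T l \<le> z" "z \<le> T (l + 1)" "2 powr of_int l \<le> G z" "l = \<lfloor>log 2 (G z)\<rfloor>" using gr[OF z] by blast
    have "G y \<le> G z" using y yz by (simp add: phi_le_iff G)
    then have kl: "k \<le> l" unfolding k l using phi_pos[OF G y] by (intro floor_mono) simp
    have Ty: "T (k + 1) / \<rho> (T (k + 1)) \<ge> T k / \<rho> (T k)"
      using phi_le_iff[OF \<rho>(2), of "T k" "T (k + 1)"] T_pos by (simp add: T_le_iff less_imp_le)
    have "\<rho> (T (k + 1)) \<le> (T (k + 1) / T k) * \<rho> (T k)"
      using Ty T_pos[of k] T_pos[of "k + 1"] \<rho>pos[OF T_pos, of k] \<rho>pos[OF T_pos, of "k + 1"] by (simp add: field_simps)
    also have "\<dots> \<le> (2 * E) * \<rho> (T k)"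
      using E(2)[of k] T_pos[of k] \<rho>pos[OF T_pos, of k] by (intro mult_right_mono) (auto simp: field_simps)
    finally have \<rho>1: "\<rho> (T (k + 1)) \<le> 2 * E * \<rho> (T k)" .
    have \<rho>y: "\<rho> y \<le> \<rho> (T (k + 1))" using k y by (simp add: phi_le_iff \<rho>(1))
    have "G y / (y / \<rho> y) = G y * \<rho> y * (1 / y)" by simp
    also have "\<dots> \<le> 2 powr of_int (k + 1) * (2 * E * \<rho> (T k)) * (1 / T k)"
      using k \<rho>1 \<rho>y y T_pos[of k] \<rho>pos[OF y] phi_pos[OF G y] E(1) \<rho>pos[OF T_pos, of k]
      by (intro mult_mono divide_left_mono) (auto simp: less_imp_le)
    also have "\<dots> = 4 * E * (\<rho> (T k) / V k)" by (simp add: V_def powr_add)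
    also have "\<dots> \<le> 4 * E * (2 * B * B * (\<rho> (T l) / V l))" using grid[OF kl] E(1) by (intro mult_left_mono) auto
    also have "\<rho> (T l) / V l \<le> 2 * E * (G z / (z / \<rho> z))"
    proof -
      have "\<rho> (T l) \<le> \<rho> z" using l z T_pos[of l] by (simp add: phi_le_iff \<rho>(1))
      have "\<rho> (T l) / V l = 2 powr of_int l * \<rho> (T l) * (1 / T l)" by (simp add: V_def)
      also have "\<dots> \<le> G z * \<rho> z * (2 * E / z)"
      proof (intro mult_mono l(3) \<open>\<rho> (T l) \<le> \<rho> z\<close>)
        have "z \<le> 2 * E * T l" using l(2) E(2)[of l] by linarith
        then show "1 / T l \<le> 2 * E / z" using z T_pos[of l] by (simp add: field_simps)
      qed (use T_pos[of l] \<rho>pos[OF T_pos, of l] \<rho>pos[OF z] phi_pos[OF G z] in \<open>auto simp: less_imp_le\<close>)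
      also have "\<dots> = 2 * E * (G z / (z / \<rho> z))" by simp
      finally show ?thesis .
    qed
    then have "4 * E * (2 * B * B * (\<rho> (T l) / V l)) \<le> 4 * E * (2 * B * B * (2 * E * (G z / (z / \<rho> z))))"
      using E(1) B1 by (intro mult_left_mono) auto
    also have "\<dots> = R * (G z / (z / \<rho> z))" by (simp add: R_def power2_eq_square)
    finally show ?thesis .
  qed
  have R: "1 \<le> R"
  proof -
    have "1 \<le> E\<^sup>2" "1 \<le> B\<^sup>2" using E(1) B by auto
    then show ?thesis using mult_mono[of 1 "E\<^sup>2" 1 "B\<^sup>2"] by (simp add: R_def)
  qed
  have "\<exists>K. convex_on {0..} K \<and> phi_equiv (\<lambda>t. G (H t)) K"
  proof (rule convex_equiv_of_quasi_increasing[OF phi_function_compose[OF G H] R])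
    fix s t :: real assume st: "0 < s" "s \<le> t"
    have Hs: "H u / \<rho> (H u) = u" if "0 < u" for u
      unfolding H_def using phi_inv_props(2)[OF \<rho>(2), of u] that by simp
    have "G (H s) / (H s / \<rho> (H s)) \<le> R * (G (H t) / (H t / \<rho> (H t)))"
      using st by (intro ratio) (auto simp: phi_pos phi_le_iff H)
    then show "G (H s) / s \<le> R * (G (H t) / t)" using Hs[of s] Hs[of t] st by simp
  qed
  then show ?thesis using H NJ by blast
  qed
qed

theorem theorem5p3:
  fixes F G :: "real \<Rightarrow> real" and p :: real
  assumes "phi_function F" and "phi_function G" and "0 < p"
  shows "(ereal p < lower_boyd F G \<and>
           (\<exists>H. N_function H \<and> condJ H \<and> phi_succ G (\<lambda>t. phi_inv H (t powr p)))
          \<longrightarrow> p_convex F G p)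
       \<and> (p_convex F G p \<longrightarrow>
           ereal p \<le> lower_boyd F G \<and>
           (\<exists>H. N_function H \<and> condJ H \<and> phi_succ G (\<lambda>t. phi_inv H (t powr p))))"
proof (intro conjI impI)
  assume "ereal p < lower_boyd F G \<and> (\<exists>H. N_function H \<and> condJ H \<and> phi_succ G (\<lambda>t. phi_inv H (t powr p)))"
  then obtain H where boyd: "ereal p < lower_boyd F G"
    and H: "N_function H" "condJ H" "phi_succ G (\<lambda>t. phi_inv H (t powr p))" by blast
  obtain K Hs c d where "J_setting (root_scale p G) K Hs (phi_inv Hs) c d"
    by (rule J_setting_of_condJ[OF assms(2,3) _ H(2,3)]) (use H(1) in \<open>auto simp: N_function_def\<close>)
  then show "p_convex F G p" by (rule p_convex_of_J_setting[OF assms boyd])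
next
  assume pc: "p_convex F G p"
  show "ereal p \<le> lower_boyd F G" by (rule lower_boyd_ge_of_p_convex[OF assms pc])
  define G1 where "G1 = root_scale p G"
  have G1: "phi_function G1" unfolding G1_def by (rule phi_function_root_scale[OF assms(2,3)])
  define T where "T k = phi_inv G1 (2 powr of_int k)" for k :: int
  obtain \<delta> where \<delta>: "0 < \<delta>" "\<And>S j. finite S \<Longrightarrow> (\<Sum>k\<in>S. T (j k) / T k) < \<delta> \<Longrightarrow>
      (\<Sum>k\<in>S. 2 powr of_int (j k - k)) \<le> (2::real)"
    using p_convex_levels[OF assms pc] unfolding T_def G1_def by blast
  have "level_sequence T \<delta>"
  proof
    show "0 < T k" for k by (simp add: T_def phi_inv_pos G1)
    show "strict_mono T" by (rule strict_monoI) (simp add: T_def phi_inv_less_iff G1)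
    show "\<exists>n. T (- int n) \<le> e" if e: "0 < e" for e
    proof -
      obtain n where "2 powr (- of_int (int n)) \<le> G1 e" using ex_powr_le[of 2 "G1 e"] phi_pos[OF G1 e] by auto
      then show ?thesis using e by (intro exI[of _ n]) (simp add: T_def phi_inv_le_iff' G1)
    qed
    show "\<exists>n. e \<le> T (int n)" for e
    proof -
      obtain n where "G1 (max e 0) \<le> 2 powr of_int (int n)" using ex_powr_ge[of 2] by auto
      then have "max e 0 \<le> T (int n)" 
        using le_phi_inv_iff[OF G1, of "max e 0" "2 powr of_int (int n)"] unfolding T_def by simp
      then show ?thesis by (intro exI[of _ n]) simp
    qed
  qed (use \<delta> in auto)
  then obtain H K where H: "phi_function H" "N_function H" "condJ H"
    and K: "convex_on {0..} K" "phi_equiv (\<lambda>t. G1 (H t)) K"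
    using N_function_of_levels[OF G1, of \<delta>] unfolding T_def by blast
  have "phi_equiv (\<lambda>t. G (phi_inv (\<lambda>t. phi_inv H (t powr p)) t)) K"
    using K(2) unfolding phi_equiv_def G1_def by (auto simp: phi_inv_inv_powr[OF H(1) assms(3)])
  then show "\<exists>H. N_function H \<and> condJ H \<and> phi_succ G (\<lambda>t. phi_inv H (t powr p))"
    using H K(1) unfolding phi_succ_def by blast
qed

end
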